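(* Let $0<s<1<p<\infty$ and let $\Omega$ be a bounded domain of a stratified Lie group $\mathbb{G}$ of homogeneous dimension $Q$, with $Q>ps$. Then there exists a nonnegative minimizer $\phi_1\in X_0^{s,p}(\Omega)$ of $$I(u)=\iint_{\mathbb{G}\times\mathbb{G}}\frac{|u(x)-u(y)|^p}{|y^{-1}x|^{Q+ps}}\,dx\,dy$$ over $\mathcal{S}=\{u\in X_0^{s,p}(\Omega):\|u\|_{L^p(\Omega)}=1\}$, and $\phi_1$ is a weak solution to the problem $$(-\Delta_{p,\mathbb{G}})^su=\nu|u|^{p-2}u\ \text{ in }\Omega,\qquad u=0\ \text{ in }\mathbb{G}\setminus\Omega,$$ for $\nu=\lambda_1(\Omega):=\inf\{I(u):u\in\mathcal{S}\}$. Moreover, $\phi_1\in L^\infty(\Omega)$. Furthermore, there exists a constant $C=C(Q,p,s)>0$ such that $\lambda_1(\Omega)\ge C|\Omega|^{-\frac{ps}{Q}}$.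
   Context: Stratified Lie group: a Lie group $\mathbb{G}=(\mathbb{R}^N,\circ)$ with identity $0$ such that (i) there is a decomposition $\mathbb{R}^N=\mathbb{R}^{N_1}\times\cdots\times\mathbb{R}^{N_k}$ for which, for every $\lambda>0$, the dilation $D_\lambda(x)=(\lambda x^{(1)},\lambda^2x^{(2)},\dots,\lambda^kx^{(k)})$, $x^{(i)}\in\mathbb{R}^{N_i}$, is an automorphism of $\mathbb{G}$; (ii) if $X_1,\dots,X_{N_1}$ are the left-invariant vector fields with $X_j(0)=\partial/\partial x_j|_0$, then the Lie algebra generated by $X_1,\dots,X_{N_1}$ has rank $N$ at every point. The homogeneous dimension is $Q=\sum_{i=1}^k iN_i$. The Haar measure $dx$ is Lebesgue measure on $\mathbb{R}^N$; $|\Omega|$ denotes the measure of $\Omega$. We write $xy$ for $x\circ y$ and fix a homogeneous quasi-norm $|\cdot|$ on $\mathbb{G}$: a continuous function $|\cdot|:\mathbb{G}\to[0,\infty)$ with $|x|=0$ iff $x=0$, $|x^{-1}|=|x|$, and $|D_\lambda x|=\lambda|x|$ for $\lambda>0$. The group and the quasi-norm are fixed, and constants may depend on them. A domain is a nonempty connected open set. Functions are real-valued. $[u]_{s,p,\mathbb{G}}:=\left(\iint_{\mathbb{G}\times\mathbb{G}}\frac{|u(x)-u(y)|^p}{|y^{-1}x|^{Q+ps}}\,dx\,dy\right)^{1/p}$. $X_0^{s,p}(\Omega)$ is the closure of $C_c^\infty(\Omega)$ with respect to the norm $\|u\|_{L^p(\Omega)}+[u]_{s,p,\mathbb{G}}$,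 functions being extended by $0$ to $\mathbb{G}\setminus\Omega$. The fractional $p$-sub-Laplacian is understood weakly: $$\langle(-\Delta_{p,\mathbb{G}})^su,\varphi\rangle=\iint_{\mathbb{G}\times\mathbb{G}}\frac{|u(x)-u(y)|^{p-2}(u(x)-u(y))(\varphi(x)-\varphi(y))}{|y^{-1}x|^{Q+ps}}\,dx\,dy.$$ A function $u\in X_0^{s,p}(\Omega)$ is a weak solution of the eigenvalue problem if $\langle(-\Delta_{p,\mathbb{G}})^su,\phi\rangle=\nu\int_\Omega|u|^{p-2}u\phi\,dx$ for all $\phi\in C_c^\infty(\Omega)$. *)

theory Defs
  imports "HOL-Analysis.Analysis"
begin

section \<open>Smooth maps and vector fields\<close>

text \<open>In finite dimension, continuity of all iterated directional derivatives is the usual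
  notion of n-fold continuous differentiability.\<close>

primrec Ck :: "nat \<Rightarrow> ('a::real_normed_vector \<Rightarrow> 'b::real_normed_vector) \<Rightarrow> bool" where
  "Ck 0 f \<longleftrightarrow> continuous_on UNIV f"
| "Ck (Suc n) f \<longleftrightarrow> (\<forall>x. f differentiable (at x)) \<and>
     (\<forall>v. Ck n (\<lambda>x. frechet_derivative f (at x) v))"

definition smooth :: "('a::real_normed_vector \<Rightarrow> 'b::real_normed_vector) \<Rightarrow> bool" where
  "smooth f \<longleftrightarrow> (\<forall>n. Ck n f)"

definition Lie_bracket ::
  "('a::real_normed_vector \<Rightarrow> 'a) \<Rightarrow> ('a \<Rightarrow> 'a) \<Rightarrow> 'a \<Rightarrow> 'a" where
  "Lie_bracket X Y x =
     frechet_derivative Y (at x) (X x) - frechet_derivative X (at x) (Y x)"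

inductive_set Lie_generated :: "('a::real_normed_vector \<Rightarrow> 'a) set \<Rightarrow> ('a \<Rightarrow> 'a) set"
  for B :: "('a \<Rightarrow> 'a) set" where
  base: "X \<in> B \<Longrightarrow> X \<in> Lie_generated B"
| zero: "(\<lambda>x. 0) \<in> Lie_generated B"
| add: "X \<in> Lie_generated B \<Longrightarrow> Y \<in> Lie_generated B \<Longrightarrow> (\<lambda>x. X x + Y x) \<in> Lie_generated B"
| scale: "X \<in> Lie_generated B \<Longrightarrow> (\<lambda>x. c *\<^sub>R X x) \<in> Lie_generated B"
| bracket: "X \<in> Lie_generated B \<Longrightarrow> Y \<in> Lie_generated B \<Longrightarrow> Lie_bracket X Y \<in> Lie_generated B"

section \<open>Stratified Lie groups\<close>

text \<open>The decomposition of the underlying space into k blocks is encoded by the function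
  \<open>layer\<close>: coordinate j belongs to the i-th block iff \<open>layer G j = i\<close>, and \<open>step G\<close> is k.
  So the i-th block has dimension \<open>card {j. layer G j = i}\<close>. The neutral element is the
  zero vector.\<close>

record 'n stratified =
  mul :: "real^'n \<Rightarrow> real^'n \<Rightarrow> real^'n"
  inv_el :: "real^'n \<Rightarrow> real^'n"
  step :: nat
  layer :: "'n \<Rightarrow> nat"

definition dilation :: "'n stratified \<Rightarrow> real \<Rightarrow> real^'n \<Rightarrow> real^'n" where
  "dilation G r x = (\<chi> j. r ^ layer G j * x $ j)"

definition homogeneous_dim :: "'n::finite stratified \<Rightarrow> nat" where
  "homogeneous_dim G = (\<Sum>i=1..step G. i * card {j. layer G j = i})"

definition left_invariant :: "'n::finite stratified \<Rightarrow> (real^'n \<Rightarrow> real^'n) \<Rightarrow> bool" where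
  "left_invariant G X \<longleftrightarrow> smooth X \<and>
     (\<forall>a x. frechet_derivative (mul G a) (at x) (X x) = X (mul G a x))"

text \<open>The left-invariant fields that agree at the identity with a coordinate vector of the
  first layer.\<close>

definition first_layer_fields :: "'n::finite stratified \<Rightarrow> (real^'n \<Rightarrow> real^'n) set" where
  "first_layer_fields G = {X. left_invariant G X \<and> (\<exists>j. layer G j = 1 \<and> X 0 = axis j 1)}"

definition stratified_Lie_group :: "'n::finite stratified \<Rightarrow> bool" where
  "stratified_Lie_group G \<longleftrightarrow>
     Groups.group (mul G) 0 (inv_el G) \<and>
     smooth (\<lambda>(x, y). mul G x y) \<and> smooth (inv_el G) \<and>
     range (layer G) \<subseteq> {1..step G} \<and>
     (\<forall>r>0. bij (dilation G r) \<and>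
        (\<forall>x y. dilation G r (mul G x y) = mul G (dilation G r x) (dilation G r y))) \<and>
     (\<forall>x. dim {X x | X. X \<in> Lie_generated (first_layer_fields G)} = CARD('n))"

definition homogeneous_quasi_norm :: "'n::finite stratified \<Rightarrow> (real^'n \<Rightarrow> real) \<Rightarrow> bool" where
  "homogeneous_quasi_norm G N \<longleftrightarrow>
     continuous_on UNIV N \<and> (\<forall>x. 0 \<le> N x) \<and> (\<forall>x. N x = 0 \<longleftrightarrow> x = 0) \<and>
     (\<forall>x. N (inv_el G x) = N x) \<and> (\<forall>r>0. \<forall>x. N (dilation G r x) = r * N x)"

section \<open>Function spaces\<close>

definition bounded_domain :: "'a::real_normed_vector set \<Rightarrow> bool" where
  "bounded_domain \<Omega> \<longleftrightarrow> open \<Omega> \<and> connected \<Omega> \<and> \<Omega> \<noteq> {} \<and> bounded \<Omega>"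

text \<open>Test functions on \<open>\<Omega>\<close>, already extended by zero to the whole space.\<close>

definition test_functions :: "'a::real_normed_vector set \<Rightarrow> ('a \<Rightarrow> real) set" where
  "test_functions \<Omega> =
     {f. smooth f \<and> compact (closure {x. f x \<noteq> 0}) \<and> closure {x. f x \<noteq> 0} \<subseteq> \<Omega>}"

definition Lp_norm :: "real \<Rightarrow> (real^'n::finite) set \<Rightarrow> (real^'n \<Rightarrow> real) \<Rightarrow> real" where
  "Lp_norm p \<Omega> u = (LINT x:\<Omega>|lborel. \<bar>u x\<bar> powr p) powr (1 / p)"

definition essentially_bounded_on :: "(real^'n::finite) set \<Rightarrow> (real^'n \<Rightarrow> real) \<Rightarrow> bool" where
  "essentially_bounded_on \<Omega> u \<longleftrightarrow>
     set_borel_measurable lborel \<Omega> u \<and> (\<exists>M. AE x in lborel. x \<in> \<Omega> \<longrightarrow> \<bar>u x\<bar> \<le> M)"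

definition kernel ::
  "'n::finite stratified \<Rightarrow> (real^'n \<Rightarrow> real) \<Rightarrow> real \<Rightarrow> real \<Rightarrow> real^'n \<Rightarrow> real^'n \<Rightarrow> real" where
  "kernel G N s p x y = N (mul G (inv_el G y) x) powr (real (homogeneous_dim G) + p * s)"

text \<open>The functional I. It is a Bochner integral, hence meaningful only when the
  integrand is integrable; this is part of the definition of \<open>finite_norm_functions\<close> below.\<close>

definition energy ::
  "'n::finite stratified \<Rightarrow> (real^'n \<Rightarrow> real) \<Rightarrow> real \<Rightarrow> real \<Rightarrow> (real^'n \<Rightarrow> real) \<Rightarrow> real" where
  "energy G N s p u =
     (\<integral>(x, y). \<bar>u x - u y\<bar> powr p / kernel G N s p x y \<partial>(lborel \<Otimes>\<^sub>M lborel))"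

definition Gagliardo_seminorm ::
  "'n::finite stratified \<Rightarrow> (real^'n \<Rightarrow> real) \<Rightarrow> real \<Rightarrow> real \<Rightarrow> (real^'n \<Rightarrow> real) \<Rightarrow> real" where
  "Gagliardo_seminorm G N s p u = energy G N s p u powr (1 / p)"

text \<open>Elements of Lebesgue spaces are represented by Borel functions, extended by zero
  outside \<open>\<Omega>\<close>.\<close>

definition finite_norm_functions ::
  "'n::finite stratified \<Rightarrow> (real^'n \<Rightarrow> real) \<Rightarrow> real \<Rightarrow> real \<Rightarrow> (real^'n) set \<Rightarrow>
     (real^'n \<Rightarrow> real) set" where
  "finite_norm_functions G N s p \<Omega> =
     {u \<in> borel_measurable borel. (\<forall>x. x \<notin> \<Omega> \<longrightarrow> u x = 0) \<and>
        set_integrable lborel \<Omega> (\<lambda>x. \<bar>u x\<bar> powr p) \<and>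
        integrable (lborel \<Otimes>\<^sub>M lborel) (\<lambda>(x, y). \<bar>u x - u y\<bar> powr p / kernel G N s p x y)}"

text \<open>The closure of the test functions in the norm \<open>Lp_norm + Gagliardo_seminorm\<close>. Test
  functions themselves lie in \<open>finite_norm_functions\<close> when \<open>0 < s < 1 < p\<close>, so the integrals
  in the approximation condition are those of integrable functions.\<close>

definition X0 ::
  "'n::finite stratified \<Rightarrow> (real^'n \<Rightarrow> real) \<Rightarrow> real \<Rightarrow> real \<Rightarrow> (real^'n) set \<Rightarrow>
     (real^'n \<Rightarrow> real) set" where
  "X0 G N s p \<Omega> =
     {u \<in> finite_norm_functions G N s p \<Omega>.
        \<forall>e>0. \<exists>f\<in>test_functions \<Omega>.
          Lp_norm p \<Omega> (\<lambda>x. u x - f x) + Gagliardo_seminorm G N s p (\<lambda>x. u x - f x) < e}"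

section \<open>The eigenvalue problem\<close>

definition sub_Laplacian_form ::
  "'n::finite stratified \<Rightarrow> (real^'n \<Rightarrow> real) \<Rightarrow> real \<Rightarrow> real \<Rightarrow>
     (real^'n \<Rightarrow> real) \<Rightarrow> (real^'n \<Rightarrow> real) \<Rightarrow> real" where
  "sub_Laplacian_form G N s p u \<phi> =
     (\<integral>(x, y). \<bar>u x - u y\<bar> powr (p - 2) * (u x - u y) * (\<phi> x - \<phi> y) / kernel G N s p x y
        \<partial>(lborel \<Otimes>\<^sub>M lborel))"

text \<open>The boundary condition, u = 0 outside \<open>\<Omega>\<close>, is part of membership in \<open>X0\<close>. The
  convention \<open>0 powr a = 0\<close> gives the right value \<open>0\<close> to \<open>\<bar>t\<bar> powr (p - 2) * t\<close> at \<open>t = 0\<close>.\<close>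

definition weak_eigensolution ::
  "'n::finite stratified \<Rightarrow> (real^'n \<Rightarrow> real) \<Rightarrow> real \<Rightarrow> real \<Rightarrow> (real^'n) set \<Rightarrow> real \<Rightarrow>
     (real^'n \<Rightarrow> real) \<Rightarrow> bool" where
  "weak_eigensolution G N s p \<Omega> \<nu> u \<longleftrightarrow>
     u \<in> X0 G N s p \<Omega> \<and>
     (\<forall>\<phi>\<in>test_functions \<Omega>.
        sub_Laplacian_form G N s p u \<phi> =
          \<nu> * (LINT x:\<Omega>|lborel. \<bar>u x\<bar> powr (p - 2) * u x * \<phi> x))"

definition unit_sphere ::
  "'n::finite stratified \<Rightarrow> (real^'n \<Rightarrow> real) \<Rightarrow> real \<Rightarrow> real \<Rightarrow> (real^'n) set \<Rightarrow>
     (real^'n \<Rightarrow> real) set" where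
  "unit_sphere G N s p \<Omega> = {u \<in> X0 G N s p \<Omega>. Lp_norm p \<Omega> u = 1}"

definition lambda1 ::
  "'n::finite stratified \<Rightarrow> (real^'n \<Rightarrow> real) \<Rightarrow> real \<Rightarrow> real \<Rightarrow> (real^'n) set \<Rightarrow> real" where
  "lambda1 G N s p \<Omega> = (INF u\<in>unit_sphere G N s p \<Omega>. energy G N s p u)"

end

theory Submission
  imports Defs "HOL-Complex_Analysis.Great_Picard" "HOL-Library.Diagonal_Subsequence"
begin

text \<open>The left translations preserve Lebesgue measure, since their Jacobian is invariant under dilations and
  equals one at the identity; hence the quasi-norm balls of radius r have volume proportional to
  r powr Q. If u vanishes outside a set A of finite volume V, every point x sees, within a ball of
  volume 2 V, points outside A of total volume at least V, where u(x) - u(y) = u(x). Integrating gives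
  the Faber-Krahn inequality, which yields the lower bound for the first eigenvalue and replaces the
  Sobolev inequality throughout.

  Sequences of bounded energy are precompact in the p-th mean, because averages over small balls are
  equicontinuous and uniformly close to the functions. A minimizing sequence that converges in the
  p-th mean is then Cauchy in energy by uniform convexity, so its limit is a strong limit and stays in
  the closure of the test functions. That closure is stable under u \<mapsto> |u| and u \<mapsto> min u k, because these
  are uniform limits of smooth contractions. The eigenvalue equation is the derivative of the energy at
  the minimizer. Comparing the minimizer with its truncations min u k bounds the energy of
  u - min u k, and De Giorgi's iteration with the Faber-Krahn inequality shows that u is bounded.\<close>

section \<open>Powers of absolute values\<close>

text \<open>The obstacle is that \<open>X0\<close> is a closure. A pointwise limit of functions of
  bounded energy has finite energy by Fatou's lemma, but this alone does not place it in the
  closure; convergence in the full norm does. Hence the proof works with strong limits. For the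
  minimizing sequence they come from midpoints: the midpoint of two late terms has p-th mean close
  to one, so its energy cannot fall much below the infimum, which is also about the average of the
  two energies, and uniform convexity leaves no room for a difference. For u \<mapsto> |u| and u
  \<mapsto> min u k they come from dominated convergence, applied to the functions and to their
  difference quotients.

  Norms are handled through their p-th powers. A sum then costs a factor \<open>2 powr p\<close>,
  which is harmless for convergence to zero; where a factor close to one is needed, a perturbation
  inequality with arbitrarily small relative error takes over.\<close>

lemma powr_minus_two_times:
  fixes p t :: real
  shows "\<bar>t\<bar> powr (p - 2) * t = sgn t * \<bar>t\<bar> powr (p - 1)"
proof (cases "t = 0")
  case False
  have *: "\<bar>t\<bar> powr (p - 2) * \<bar>t\<bar> = \<bar>t\<bar> powr (p - 1)"
    using False powr_add[of "\<bar>t\<bar>" "p - 2" 1] by simp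
  have "\<bar>t\<bar> powr (p - 2) * t = \<bar>t\<bar> powr (p - 2) * (sgn t * \<bar>t\<bar>)"
    by (simp only: sgn_mult_abs)
  also have "\<dots> = sgn t * \<bar>t\<bar> powr (p - 1)"
    by (simp only: *[symmetric] mult_ac)
  finally show ?thesis .
qed auto

lemma powr_minus_two_times_strict_mono:
  fixes p t u :: real
  assumes "1 < p" "t < u"
  shows "\<bar>t\<bar> powr (p - 2) * t < \<bar>u\<bar> powr (p - 2) * u"
  unfolding powr_minus_two_times
proof -
  consider "0 \<le> t" | "t < 0" "0 < u" | "u \<le> 0" using assms by linarith
  then show "sgn t * \<bar>t\<bar> powr (p - 1) < sgn u * \<bar>u\<bar> powr (p - 1)"
  proof cases
    case 1 then show ?thesis using assms powr_less_mono2[of "p-1" t u] by (auto simp: sgn_if)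
  next
    case 2
    then have "sgn t * \<bar>t\<bar> powr (p - 1) < 0" "0 < sgn u * \<bar>u\<bar> powr (p - 1)" by auto
    then show ?thesis by linarith
  next
    case 3 then show ?thesis using assms powr_less_mono2[of "p-1" "-u" "-t"] by (auto simp: sgn_if)
  qed
qed

text \<open>Away from zero this is the derivative of a power on the positive half-line, reflected
  for negative arguments. At zero the difference quotient is at most |h|^(p-1), which vanishes
  because p > 1.\<close>

lemma has_real_derivative_abs_powr:
  fixes p x :: real
  assumes "1 < p"
  shows "((\<lambda>t. \<bar>t\<bar> powr p) has_real_derivative p * (\<bar>x\<bar> powr (p - 2) * x)) (at x)"
proof -
  have pos: "((\<lambda>t. \<bar>t\<bar> powr p) has_real_derivative p * y powr (p - 1)) (at y)" if "0 < y" for y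
  proof -
    have "((\<lambda>t. t powr p) has_real_derivative p * y powr (p - 1)) (at y)"
      using has_real_derivative_powr[OF that, of p] by simp
    then show ?thesis
      by (rule DERIV_cong_ev[OF refl _ refl, THEN iffD1, rotated])
         (use that eventually_nhds_in_open[of "{0<..}" y] in \<open>auto elim: eventually_mono\<close>)
  qed
  consider "x = 0" | "0 < x" | "x < 0" by linarith
  then show ?thesis
  proof cases
    case 1
    have "((\<lambda>h. (\<bar>h\<bar> powr p) / h) \<longlongrightarrow> 0) (at 0)"
    proof (rule Lim_null_comparison)
      show "((\<lambda>h::real. \<bar>h\<bar> powr (p - 1)) \<longlongrightarrow> 0) (at 0)"
        using assms by (auto intro!: tendsto_eq_intros)
      have "norm (\<bar>h\<bar> powr p / h) \<le> \<bar>h\<bar> powr (p - 1)" if "h \<noteq> 0" for h :: real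
        using that powr_diff[of "\<bar>h\<bar>" p 1] by simp
      then show "\<forall>\<^sub>F h in at 0. norm (\<bar>h\<bar> powr p / h) \<le> \<bar>h\<bar> powr (p - 1)"
        by (auto simp: eventually_at_filter)
    qed
    then show ?thesis using 1 by (simp add: DERIV_def)
  next
    case 2 then show ?thesis using pos[of x] unfolding powr_minus_two_times by simp
  next
    case 3
    have "((\<lambda>t. \<bar>t\<bar> powr p) has_real_derivative p * (-x) powr (p - 1)) (at (-x))"
      using 3 by (intro pos) auto
    then have "((\<lambda>t. \<bar>-t\<bar> powr p) has_real_derivative - (p * (-x) powr (p - 1))) (at x)"
      using DERIV_mirror[of "\<lambda>t. \<bar>t\<bar> powr p" "p * (-x) powr (p - 1)" x] by blast
    then show ?thesis using 3 unfolding powr_minus_two_times by simp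
  qed
qed

text \<open>The secant slope equals the derivative at an intermediate point, and the derivative is
  strictly increasing, so the graph lies strictly above each tangent.\<close>

lemma abs_powr_tangent_strict:
  fixes p x m :: real
  assumes "1 < p" "x \<noteq> m"
  shows "\<bar>m\<bar> powr p + p * (\<bar>m\<bar> powr (p - 2) * m) * (x - m) < \<bar>x\<bar> powr p"
proof (cases "m < x")
  case True
  obtain z where z: "m < z" "z < x"
    "\<bar>x\<bar> powr p - \<bar>m\<bar> powr p = (x - m) * (p * (\<bar>z\<bar> powr (p - 2) * z))"
    using MVT2[OF True has_real_derivative_abs_powr[OF assms(1)]] by blast
  have "(x - m) * (p * (\<bar>m\<bar> powr (p - 2) * m)) < (x - m) * (p * (\<bar>z\<bar> powr (p - 2) * z))"
    using powr_minus_two_times_strict_mono[OF assms(1) z(1)] assms True by simp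
  then show ?thesis using z(3) by (simp add: mult_ac)
next
  case False
  then have "x < m" using assms by simp
  obtain z where z: "x < z" "z < m"
    "\<bar>m\<bar> powr p - \<bar>x\<bar> powr p = (m - x) * (p * (\<bar>z\<bar> powr (p - 2) * z))"
    using MVT2[OF \<open>x < m\<close> has_real_derivative_abs_powr[OF assms(1)]] by blast
  have "(m - x) * (p * (\<bar>z\<bar> powr (p - 2) * z)) < (m - x) * (p * (\<bar>m\<bar> powr (p - 2) * m))"
    using powr_minus_two_times_strict_mono[OF assms(1) z(2)] assms \<open>x < m\<close> by simp
  then show ?thesis using z(3) by (simp add: algebra_simps)
qed

lemma abs_powr_tangent:
  fixes p x m :: real
  assumes "1 < p"
  shows "\<bar>m\<bar> powr p + p * (\<bar>m\<bar> powr (p - 2) * m) * (x - m) \<le> \<bar>x\<bar> powr p"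
  using abs_powr_tangent_strict[OF assms, of x m] by (cases "x = m") auto

text \<open>Both endpoints are compared with the tangent at the midpoint; the two linear terms are
  opposite and cancel in the average.\<close>

lemma abs_powr_midpoint_strict:
  fixes p a b :: real
  assumes "1 < p" "a \<noteq> b"
  shows "\<bar>(a + b) / 2\<bar> powr p < (\<bar>a\<bar> powr p + \<bar>b\<bar> powr p) / 2"
proof -
  define m d where "m = (a + b) / 2" and "d = p * (\<bar>m\<bar> powr (p - 2) * m)"
  have "\<bar>m\<bar> powr p + d * (a - m) < \<bar>a\<bar> powr p" "\<bar>m\<bar> powr p + d * (b - m) < \<bar>b\<bar> powr p"
    unfolding d_def using assms by (intro abs_powr_tangent_strict; simp add: m_def field_simps)+
  moreover have "d * (a - m) + d * (b - m) = 0"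
    by (simp add: m_def field_simps)
  moreover have "X < (A + B) / 2" if "X + Y < A" "X + Z < B" "Y + Z = 0" for X Y Z A B :: real
    using add_strict_mono[OF that(1,2)] that(3) by (simp add: field_simps)
  ultimately have "\<bar>m\<bar> powr p < (\<bar>a\<bar> powr p + \<bar>b\<bar> powr p) / 2" by blast
  then show ?thesis by (simp add: m_def)
qed

lemma abs_powr_midpoint:
  fixes p a b :: real
  assumes "1 < p"
  shows "\<bar>(a + b) / 2\<bar> powr p \<le> (\<bar>a\<bar> powr p + \<bar>b\<bar> powr p) / 2"
  using abs_powr_midpoint_strict[OF assms, of a b] by (cases "a = b") auto

lemma abs_powr_add_le:
  fixes p a b :: real
  assumes "0 \<le> p"
  shows "\<bar>a + b\<bar> powr p \<le> 2 powr p * (\<bar>a\<bar> powr p + \<bar>b\<bar> powr p)"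
proof -
  have "\<bar>a + b\<bar> powr p \<le> (2 * max \<bar>a\<bar> \<bar>b\<bar>) powr p"
    using assms by (intro powr_mono2) auto
  also have "\<dots> = 2 powr p * max \<bar>a\<bar> \<bar>b\<bar> powr p" by (simp add: powr_mult)
  also have "\<dots> \<le> 2 powr p * (\<bar>a\<bar> powr p + \<bar>b\<bar> powr p)"
    by (intro mult_left_mono) (auto simp: max_def)
  finally show ?thesis .
qed

lemma abs_powr_diff_le:
  fixes p x y :: real
  assumes "1 < p"
  shows "\<bar>\<bar>x\<bar> powr p - \<bar>y\<bar> powr p\<bar> \<le> p * max \<bar>x\<bar> \<bar>y\<bar> powr (p - 1) * \<bar>x - y\<bar>"
proof -
  have *: "\<bar>\<bar>x\<bar> powr p - \<bar>y\<bar> powr p\<bar> \<le> p * max \<bar>x\<bar> \<bar>y\<bar> powr (p - 1) * \<bar>x - y\<bar>"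
    if yx: "y < x" for x y :: real
  proof -
    obtain z where z: "y < z" "z < x"
      "\<bar>x\<bar> powr p - \<bar>y\<bar> powr p = (x - y) * (p * (\<bar>z\<bar> powr (p - 2) * z))"
      using MVT2[OF yx has_real_derivative_abs_powr[OF assms]] by blast
    have "\<bar>\<bar>z\<bar> powr (p - 2) * z\<bar> \<le> \<bar>z\<bar> powr (p - 1)"
      by (simp add: powr_minus_two_times abs_mult abs_sgn_eq)
    also have "\<dots> \<le> max \<bar>x\<bar> \<bar>y\<bar> powr (p - 1)"
      using z assms by (intro powr_mono2) auto
    finally have "\<bar>x - y\<bar> * (p * \<bar>\<bar>z\<bar> powr (p - 2) * z\<bar>)
        \<le> \<bar>x - y\<bar> * (p * max \<bar>x\<bar> \<bar>y\<bar> powr (p - 1))"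
      using assms by (intro mult_left_mono) auto
    then show ?thesis using z(3) assms by (simp add: abs_mult mult_ac)
  qed
  consider "y < x" | "x < y" | "x = y" by linarith
  then show ?thesis
    by cases (use *[of y x] *[of x y] in \<open>auto simp: abs_minus_commute max.commute\<close>)
qed

text \<open>If b is small relative to a, the mean value bound costs only a fraction e of |a|^p;
  otherwise |a| is at most a multiple of |b|, and |b|^p pays for everything.\<close>

lemma abs_powr_add_eps:
  fixes p e :: real
  assumes "1 < p" "0 < e"
  obtains C where "0 < C"
    "\<And>a b :: real. \<bar>\<bar>a + b\<bar> powr p - \<bar>a\<bar> powr p\<bar> \<le> e * \<bar>a\<bar> powr p + C * \<bar>b\<bar> powr p"
proof -
  \<comment> \<open>\<open>d\<close> is the threshold for the ratio |b| / |a|. The cap 1 gives |b|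
    \<le> |a| below the threshold, and the second bound keeps the relative error
    \<open>p * 2 powr (p - 1) * d\<close> within e.\<close>
  define d where "d = min 1 (e / (p * 2 powr (p - 1)))"
  have d: "0 < d" "d \<le> 1" "p * 2 powr (p - 1) * d \<le> e"
    using assms by (auto simp: d_def min_def field_simps)
  define C where "C = p * (1 + 1 / d) powr (p - 1)"
  have "0 < C" using assms d by (simp add: C_def add_pos_pos less_imp_neq[symmetric])
  have split: "\<bar>t\<bar> powr (p - 1) * \<bar>t\<bar> = \<bar>t\<bar> powr p" for t :: real
    using powr_add[of "\<bar>t\<bar>" "p - 1" 1] by (cases "t = 0") auto
  have "\<bar>\<bar>a + b\<bar> powr p - \<bar>a\<bar> powr p\<bar> \<le> e * \<bar>a\<bar> powr p + C * \<bar>b\<bar> powr p" for a b :: real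
  proof -
    have "\<bar>\<bar>a + b\<bar> powr p - \<bar>a\<bar> powr p\<bar> \<le> p * max \<bar>a + b\<bar> \<bar>a\<bar> powr (p - 1) * \<bar>b\<bar>"
      using abs_powr_diff_le[OF assms(1), of "a + b" a] by simp
    also have "\<dots> \<le> p * (\<bar>a\<bar> + \<bar>b\<bar>) powr (p - 1) * \<bar>b\<bar>"
      using assms by (intro mult_right_mono mult_left_mono powr_mono2) auto
    finally have *: "\<bar>\<bar>a + b\<bar> powr p - \<bar>a\<bar> powr p\<bar> \<le> p * (\<bar>a\<bar> + \<bar>b\<bar>) powr (p - 1) * \<bar>b\<bar>" .
    show ?thesis
    proof (cases "\<bar>b\<bar> \<le> d * \<bar>a\<bar>")
      case True
      then have "\<bar>b\<bar> \<le> \<bar>a\<bar>" using d mult_right_mono[of d 1 "\<bar>a\<bar>"] by simp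
      have "p * (\<bar>a\<bar> + \<bar>b\<bar>) powr (p - 1) * \<bar>b\<bar> \<le> p * (2 * \<bar>a\<bar>) powr (p - 1) * (d * \<bar>a\<bar>)"
        using assms True \<open>\<bar>b\<bar> \<le> \<bar>a\<bar>\<close> by (intro mult_mono mult_left_mono powr_mono2) auto
      also have "\<dots> = p * 2 powr (p - 1) * d * \<bar>a\<bar> powr p"
        by (simp add: powr_mult split[symmetric])
      also have "\<dots> \<le> e * \<bar>a\<bar> powr p" using d by (intro mult_right_mono) auto
      finally show ?thesis using * \<open>0 < C\<close>
        by (smt (verit) mult_nonneg_nonneg powr_ge_zero)
    next
      case False
      then have "\<bar>a\<bar> + \<bar>b\<bar> \<le> (1 + 1 / d) * \<bar>b\<bar>"
        using d by (simp add: field_simps)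
      then have "p * (\<bar>a\<bar> + \<bar>b\<bar>) powr (p - 1) * \<bar>b\<bar> \<le> p * ((1 + 1 / d) * \<bar>b\<bar>) powr (p - 1) * \<bar>b\<bar>"
        using assms by (intro mult_right_mono mult_left_mono powr_mono2) auto
      also have "\<dots> = C * \<bar>b\<bar> powr p"
        using d by (simp add: powr_mult split[symmetric] C_def)
      finally show ?thesis using * \<open>0 < e\<close>
        by (smt (verit) mult_nonneg_nonneg powr_ge_zero)
    qed
  qed
  with \<open>0 < C\<close> that show ?thesis by blast
qed

text \<open>A qualitative substitute for the Clarkson inequalities, valid for all exponents above one:
  by homogeneity it suffices to compare both sides on a compact set, where strict convexity
  bounds the convexity defect from below.\<close>

lemma continuous_on_abs_powr [continuous_intros]:
  fixes f :: "'a::topological_space \<Rightarrow> real"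
  assumes "continuous_on S f" "0 < p"
  shows "continuous_on S (\<lambda>x. \<bar>f x\<bar> powr p)"
  using assms by (intro continuous_on_powr' continuous_intros) auto

lemma uniform_convexity_abs_powr:
  fixes p e :: real
  assumes "1 < p" "0 < e"
  obtains K where "0 < K"
    "\<And>a b :: real. \<bar>a - b\<bar> powr p \<le> e * (\<bar>a\<bar> powr p + \<bar>b\<bar> powr p)
        + K * ((\<bar>a\<bar> powr p + \<bar>b\<bar> powr p) / 2 - \<bar>(a + b) / 2\<bar> powr p)"
proof -
  define X where "X = (\<lambda>(a::real, b). \<bar>a - b\<bar> powr p - e * (\<bar>a\<bar> powr p + \<bar>b\<bar> powr p))"
  define Y where "Y = (\<lambda>(a::real, b). (\<bar>a\<bar> powr p + \<bar>b\<bar> powr p) / 2 - \<bar>(a + b) / 2\<bar> powr p)"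
  have cX: "continuous_on UNIV X" and cY: "continuous_on UNIV Y"
    unfolding X_def Y_def case_prod_beta by (intro continuous_intros; use assms in simp)+
  have Y0: "0 \<le> Y z" for z
    using abs_powr_midpoint[OF assms(1)] by (auto simp: Y_def case_prod_beta)
  \<comment> \<open>Since \<open>Y\<close> is nonnegative everywhere, only points with
    \<open>X\<close> nonnegative matter. This closed condition excludes the diagonal of the unit
    sphere, where \<open>X\<close> is negative and strict convexity gives nothing.\<close>
  define S where "S = {z :: real \<times> real. max \<bar>fst z\<bar> \<bar>snd z\<bar> = 1 \<and> 0 \<le> X z}"
  have "compact S"
  proof (rule compact_Int_closed[of "cbox (-1,-1) (1,1)" "{z. max \<bar>fst z\<bar> \<bar>snd z\<bar> = 1 \<and> 0 \<le> X z}",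
        THEN back_subst[of compact]])
    show "closed {z. max \<bar>fst z\<bar> \<bar>snd z\<bar> = 1 \<and> 0 \<le> X z}"
      using cX by (intro closed_Collect_conj closed_Collect_eq closed_Collect_le continuous_intros)
    show "cbox (-1,-1) (1,1) \<inter> {z. max \<bar>fst z\<bar> \<bar>snd z\<bar> = 1 \<and> 0 \<le> X z} = S"
      by (auto simp: S_def max_def split: if_splits)
  qed auto
  obtain c where c: "0 < c" "\<And>z. z \<in> S \<Longrightarrow> c \<le> Y z"
  proof (cases "S = {}")
    case False
    obtain z where z: "z \<in> S" "\<And>w. w \<in> S \<Longrightarrow> Y z \<le> Y w"
      using continuous_attains_inf[OF \<open>compact S\<close> False continuous_on_subset[OF cY]] by blast
    obtain a b where ab: "z = (a, b)" by (cases z)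
    have "a \<noteq> b"
    proof
      assume "a = b"
      then have "X z < 0" using z ab assms by (auto simp: X_def S_def)
      then show False using z by (simp add: S_def)
    qed
    then have "0 < Y z" using abs_powr_midpoint_strict[OF assms(1)] by (simp add: Y_def ab)
    with z that show ?thesis by blast
  qed (use that[of 1] in auto)
  \<comment> \<open>For numbers of modulus at most one, |a - b| is at most 2, so \<open>X\<close> is
    at most \<open>2 powr p\<close> there.\<close>
  define K where "K = 2 powr p / c"
  have K: "0 < K" using c by (simp add: K_def)
  have unit: "X z \<le> K * Y z" if "max \<bar>fst z\<bar> \<bar>snd z\<bar> = 1" for z
  proof (cases "0 \<le> X z")
    case True
    then have "c \<le> Y z" using that c by (simp add: S_def)
    have "X z \<le> \<bar>fst z - snd z\<bar> powr p"
      using assms by (simp add: X_def case_prod_beta)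
    also have "\<dots> \<le> 2 powr p" using that assms by (intro powr_mono2) auto
    also have "\<dots> = K * c" using c by (simp add: K_def)
    also have "\<dots> \<le> K * Y z" using \<open>c \<le> Y z\<close> K by simp
    finally show ?thesis .
  next
    case False
    then show ?thesis using K Y0[of z] by (smt (verit) mult_nonneg_nonneg)
  qed
  have main: "X (a, b) \<le> K * Y (a, b)" for a b
  proof (cases "max \<bar>a\<bar> \<bar>b\<bar> = 0")
    case True
    then have "a = 0" "b = 0" by (auto simp: max_def split: if_splits)
    then show ?thesis by (simp add: X_def Y_def)
  next
    case False
    define r where "r = max \<bar>a\<bar> \<bar>b\<bar>"
    have r: "0 < r" using False by (auto simp: r_def)
    have hom: "\<bar>r * t\<bar> powr p = r powr p * \<bar>t\<bar> powr p" for t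
      using r by (simp add: abs_mult powr_mult)
    have "max \<bar>a / r\<bar> \<bar>b / r\<bar> = 1"
      using r by (auto simp: r_def max_def split: if_splits)
    then have "X (a / r, b / r) \<le> K * Y (a / r, b / r)" using unit[of "(a / r, b / r)"] by simp
    then have "r powr p * X (a / r, b / r) \<le> r powr p * (K * Y (a / r, b / r))"
      by (intro mult_left_mono) auto
    moreover have "X (a, b) = r powr p * X (a / r, b / r)"
      using r hom[of "a / r"] hom[of "b / r"] hom[of "a / r - b / r"]
      by (simp add: X_def algebra_simps)
    moreover have "Y (a, b) = r powr p * Y (a / r, b / r)"
      using r hom[of "a / r"] hom[of "b / r"] hom[of "(a / r + b / r) / 2"]
      by (simp add: Y_def algebra_simps)
    ultimately show ?thesis by (simp add: mult_ac)
  qed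
  show ?thesis
  proof (rule that[OF K])
    fix a b :: real
    show "\<bar>a - b\<bar> powr p \<le> e * (\<bar>a\<bar> powr p + \<bar>b\<bar> powr p)
        + K * ((\<bar>a\<bar> powr p + \<bar>b\<bar> powr p) / 2 - \<bar>(a + b) / 2\<bar> powr p)"
      using main[of a b] by (simp add: X_def Y_def)
  qed
qed

section \<open>Integrals of p-th powers\<close>

text \<open>Functions rather than classes, over an arbitrary measure: the same facts serve functions
  on the group and difference quotients on the product space. Measurability is demanded separately
  because that of |f|^p does not imply it.\<close>

definition Lp :: "'a measure \<Rightarrow> real \<Rightarrow> ('a \<Rightarrow> real) set" where
  "Lp M p = {f \<in> borel_measurable M. integrable M (\<lambda>x. \<bar>f x\<bar> powr p)}"

definition Lp_int :: "'a measure \<Rightarrow> real \<Rightarrow> ('a \<Rightarrow> real) \<Rightarrow> real" where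
  "Lp_int M p f = (\<integral>x. \<bar>f x\<bar> powr p \<partial>M)"

lemma Lp_measurable [measurable_dest]: "f \<in> Lp M p \<Longrightarrow> f \<in> borel_measurable M"
  by (simp add: Lp_def)

lemma Lp_integrable: "f \<in> Lp M p \<Longrightarrow> integrable M (\<lambda>x. \<bar>f x\<bar> powr p)"
  by (simp add: Lp_def)

lemma Lp_int_nonneg [simp]: "0 \<le> Lp_int M p f"
  by (simp add: Lp_int_def)

lemma Lp_dominated:
  assumes [measurable]: "g \<in> borel_measurable M"
    and f: "f \<in> Lp M p" and "AE x in M. \<bar>g x\<bar> \<le> \<bar>f x\<bar>" "0 \<le> p"
  shows "g \<in> Lp M p" "Lp_int M p g \<le> Lp_int M p f"
proof -
  have AE: "AE x in M. \<bar>g x\<bar> powr p \<le> \<bar>f x\<bar> powr p"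
    using assms(3) by eventually_elim (use assms(4) in \<open>auto intro: powr_mono2\<close>)
  have "integrable M (\<lambda>x. \<bar>g x\<bar> powr p)"
    by (rule Bochner_Integration.integrable_bound[OF Lp_integrable[OF f]]) (use AE in auto)
  then show "g \<in> Lp M p" by (simp add: Lp_def)
  show "Lp_int M p g \<le> Lp_int M p f"
    unfolding Lp_int_def using AE \<open>integrable M (\<lambda>x. \<bar>g x\<bar> powr p)\<close> Lp_integrable[OF f]
    by (intro integral_mono_AE)
qed

lemma
  assumes f: "f \<in> Lp M p" and g: "g \<in> Lp M p" and p: "0 \<le> p"
  shows Lp_add: "(\<lambda>x. f x + g x) \<in> Lp M p"
    and Lp_int_add_le: "Lp_int M p (\<lambda>x. f x + g x) \<le> 2 powr p * (Lp_int M p f + Lp_int M p g)"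
proof -
  note [measurable] = f g
  have int: "integrable M (\<lambda>x. 2 powr p * (\<bar>f x\<bar> powr p + \<bar>g x\<bar> powr p))"
    using Lp_integrable[OF f] Lp_integrable[OF g] by auto
  have "integrable M (\<lambda>x. \<bar>f x + g x\<bar> powr p)"
    by (rule Bochner_Integration.integrable_bound[OF int])
       (use abs_powr_add_le[OF p] in auto)
  then show "(\<lambda>x. f x + g x) \<in> Lp M p" by (simp add: Lp_def)
  have "Lp_int M p (\<lambda>x. f x + g x) \<le> (\<integral>x. 2 powr p * (\<bar>f x\<bar> powr p + \<bar>g x\<bar> powr p) \<partial>M)"
    unfolding Lp_int_def
    by (intro integral_mono \<open>integrable M (\<lambda>x. \<bar>f x + g x\<bar> powr p)\<close> int abs_powr_add_le p)
  also have "\<dots> = 2 powr p * (Lp_int M p f + Lp_int M p g)"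
    using Lp_integrable[OF f] Lp_integrable[OF g] by (simp add: Lp_int_def)
  finally show "Lp_int M p (\<lambda>x. f x + g x) \<le> 2 powr p * (Lp_int M p f + Lp_int M p g)" .
qed

lemma Lp_cmult: "f \<in> Lp M p \<Longrightarrow> (\<lambda>x. c * f x) \<in> Lp M p"
  by (auto simp: Lp_def abs_mult powr_mult)

lemma Lp_int_cmult: "Lp_int M p (\<lambda>x. c * f x) = \<bar>c\<bar> powr p * Lp_int M p f"
  by (simp add: Lp_int_def abs_mult powr_mult)

lemma Lp_int_minus_commute: "Lp_int M p (\<lambda>x. f x - g x) = Lp_int M p (\<lambda>x. g x - f x)"
  by (simp add: Lp_int_def abs_minus_commute)

lemma
  assumes f: "f \<in> Lp M p" and g: "g \<in> Lp M p" and p: "0 \<le> p"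
  shows Lp_diff: "(\<lambda>x. f x - g x) \<in> Lp M p"
    and Lp_int_diff_le: "Lp_int M p (\<lambda>x. f x - g x) \<le> 2 powr p * (Lp_int M p f + Lp_int M p g)"
  using Lp_add[OF f Lp_cmult[OF g, of "-1"] p] Lp_int_add_le[OF f Lp_cmult[OF g, of "-1"] p]
    Lp_int_cmult[of M p "-1" g] by auto

text \<open>The pointwise perturbation inequality, integrated. The constant depends on neither f nor
  g, so the p-th mean is uniformly continuous on sets where it is bounded.\<close>

lemma Lp_int_eps:
  fixes p e :: real and M :: "'a measure"
  assumes "1 < p" "0 < e"
  obtains C where "0 < C"
    "\<And>f g. f \<in> Lp M p \<Longrightarrow> g \<in> Lp M p \<Longrightarrow>
       \<bar>Lp_int M p (\<lambda>x. f x + g x) - Lp_int M p f\<bar> \<le> e * Lp_int M p f + C * Lp_int M p g"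
proof -
  obtain C where C: "0 < C"
    "\<And>a b :: real. \<bar>\<bar>a + b\<bar> powr p - \<bar>a\<bar> powr p\<bar> \<le> e * \<bar>a\<bar> powr p + C * \<bar>b\<bar> powr p"
    using abs_powr_add_eps[OF assms] by blast
  show ?thesis
  proof (rule that[OF C(1)])
    fix f g assume f: "f \<in> Lp M p" and g: "g \<in> Lp M p"
    have fg: "(\<lambda>x. f x + g x) \<in> Lp M p" using f g assms by (intro Lp_add) auto
    note int = Lp_integrable[OF f] Lp_integrable[OF g] Lp_integrable[OF fg]
    have "\<bar>Lp_int M p (\<lambda>x. f x + g x) - Lp_int M p f\<bar>
        = \<bar>\<integral>x. \<bar>f x + g x\<bar> powr p - \<bar>f x\<bar> powr p \<partial>M\<bar>"
      using int by (simp add: Lp_int_def)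
    also have "\<dots> \<le> (\<integral>x. \<bar>\<bar>f x + g x\<bar> powr p - \<bar>f x\<bar> powr p\<bar> \<partial>M)"
      by (rule integral_abs_bound)
    also have "\<dots> \<le> (\<integral>x. e * \<bar>f x\<bar> powr p + C * \<bar>g x\<bar> powr p \<partial>M)"
      using int C(2) by (intro integral_mono) auto
    also have "\<dots> = e * Lp_int M p f + C * Lp_int M p g"
      using int by (simp add: Lp_int_def)
    finally show "\<bar>Lp_int M p (\<lambda>x. f x + g x) - Lp_int M p f\<bar> \<le> e * Lp_int M p f + C * Lp_int M p g" .
  qed
qed

lemma Lp_int_tendsto:
  fixes p :: real
  assumes p: "1 < p" and f: "\<And>n. f n \<in> Lp M p" and g: "g \<in> Lp M p"
    and lim: "((\<lambda>n. Lp_int M p (\<lambda>x. f n x - g x)) \<longlongrightarrow> 0) F"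
  shows "((\<lambda>n. Lp_int M p (f n)) \<longlongrightarrow> Lp_int M p g) F"
proof (rule tendstoI)
  fix e :: real assume "0 < e"
  \<comment> \<open>The added 1 keeps the denominator positive when the mean of g vanishes; each of
    the two error terms receives half of e.\<close>
  define d where "d = e / (2 * (Lp_int M p g + 1))"
  have "0 < d" using \<open>0 < e\<close> by (simp add: d_def add_nonneg_pos)
  obtain C where C: "0 < C"
    "\<And>f g. f \<in> Lp M p \<Longrightarrow> g \<in> Lp M p \<Longrightarrow>
       \<bar>Lp_int M p (\<lambda>x. f x + g x) - Lp_int M p f\<bar> \<le> d * Lp_int M p f + C * Lp_int M p g"
    using Lp_int_eps[OF p \<open>0 < d\<close>] by blast
  have "\<forall>\<^sub>F n in F. Lp_int M p (\<lambda>x. f n x - g x) < e / (2 * C)"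
    using order_tendstoD(2)[OF lim, of "e / (2 * C)"] \<open>0 < C\<close> \<open>0 < e\<close> by simp
  then show "\<forall>\<^sub>F n in F. dist (Lp_int M p (f n)) (Lp_int M p g) < e"
  proof eventually_elim
    fix n assume n: "Lp_int M p (\<lambda>x. f n x - g x) < e / (2 * C)"
    have "\<bar>Lp_int M p (\<lambda>x. g x + (f n x - g x)) - Lp_int M p g\<bar>
        \<le> d * Lp_int M p g + C * Lp_int M p (\<lambda>x. f n x - g x)"
      using f g p by (intro C(2) Lp_diff) auto
    moreover have "d * Lp_int M p g \<le> e / 2"
    proof -
      have "d * Lp_int M p g \<le> d * (Lp_int M p g + 1)" using \<open>0 < d\<close> by simp
      also have "\<dots> = e / 2"
      proof -
        have "e / (2 * y) * y = e / 2" if "y \<noteq> 0" for y using that by simp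
        moreover have "Lp_int M p g + 1 \<noteq> 0" using Lp_int_nonneg[of M p g] by linarith
        ultimately show ?thesis unfolding d_def by blast
      qed
      finally show ?thesis .
    qed
    moreover have "C * Lp_int M p (\<lambda>x. f n x - g x) < e / 2"
      using n \<open>0 < C\<close> by (simp add: field_simps)
    ultimately show "dist (Lp_int M p (f n)) (Lp_int M p g) < e"
      by (simp add: dist_real_def)
  qed
qed

lemma Lp_Fatou:
  fixes f :: "nat \<Rightarrow> 'a \<Rightarrow> real"
  assumes f: "\<And>n. f n \<in> Lp M p" and [measurable]: "g \<in> borel_measurable M"
    and lim: "AE x in M. (\<lambda>n. f n x) \<longlonglongrightarrow> g x" and B: "\<And>n. Lp_int M p (f n) \<le> B" and "0 < p"
  shows "g \<in> Lp M p" "Lp_int M p g \<le> B"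
proof -
  note [measurable] = f
  have "0 \<le> B" using B[of 0] Lp_int_nonneg[of M p "f 0"] by linarith
  have nn: "(\<integral>\<^sup>+x. ennreal (\<bar>f n x\<bar> powr p) \<partial>M) = ennreal (Lp_int M p (f n))" for n
    unfolding Lp_int_def by (intro nn_integral_eq_integral Lp_integrable f) auto
  have "(\<integral>\<^sup>+x. ennreal (\<bar>g x\<bar> powr p) \<partial>M) = (\<integral>\<^sup>+x. liminf (\<lambda>n. ennreal (\<bar>f n x\<bar> powr p)) \<partial>M)"
  proof (rule nn_integral_cong_AE, use lim in eventually_elim)
    fix x assume "(\<lambda>n. f n x) \<longlonglongrightarrow> g x"
    then have "(\<lambda>n. ennreal (\<bar>f n x\<bar> powr p)) \<longlonglongrightarrow> ennreal (\<bar>g x\<bar> powr p)"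
      using \<open>0 < p\<close> by (intro tendsto_ennrealI tendsto_powr' tendsto_intros) auto
    then show "ennreal (\<bar>g x\<bar> powr p) = liminf (\<lambda>n. ennreal (\<bar>f n x\<bar> powr p))"
      by (intro lim_imp_Liminf[symmetric]) auto
  qed
  also have "\<dots> \<le> liminf (\<lambda>n. \<integral>\<^sup>+x. ennreal (\<bar>f n x\<bar> powr p) \<partial>M)"
    by (intro nn_integral_liminf) measurable
  also have "\<dots> = liminf (\<lambda>n. ennreal (Lp_int M p (f n)))" by (simp add: nn)
  also have "\<dots> \<le> liminf (\<lambda>n. ennreal B)"
    by (intro Liminf_mono always_eventually allI ennreal_leI B)
  also have "\<dots> = ennreal B" by (simp add: Liminf_const)
  finally have le: "(\<integral>\<^sup>+x. ennreal (\<bar>g x\<bar> powr p) \<partial>M) \<le> ennreal B" .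
  have "integrable M (\<lambda>x. \<bar>g x\<bar> powr p)"
    using le by (intro integrableI_bounded) (auto simp: less_top[symmetric] top_unique)
  then show "g \<in> Lp M p" by (simp add: Lp_def)
  have "ennreal (Lp_int M p g) \<le> ennreal B"
    using le nn_integral_eq_integral[OF \<open>integrable M (\<lambda>x. \<bar>g x\<bar> powr p)\<close>]
    by (simp add: Lp_int_def)
  then show "Lp_int M p g \<le> B" using \<open>0 \<le> B\<close> by simp
qed

text \<open>Choose a subsequence whose n-th increment has p-th mean below 4^-n. The increments
  weighted by 2^n are still summable, hence have a finite sum almost everywhere. At such a point the
  n-th increment is at most a constant times q^n with q = 2^(-1/p), and the telescoping series
  converges.\<close>

lemma Lp_Cauchy_AE_subseq:
  fixes f :: "nat \<Rightarrow> 'a \<Rightarrow> real"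
  assumes f: "\<And>n. f n \<in> Lp M p" and p: "0 < p"
    and Cauchy: "\<And>e. 0 < e \<Longrightarrow> \<exists>N. \<forall>m\<ge>N. \<forall>n\<ge>N. Lp_int M p (\<lambda>x. f m x - f n x) < e"
  shows "\<exists>r. strict_mono r \<and> (AE x in M. convergent (\<lambda>n. f (r n) x))"
proof -
  note [measurable] = f
  obtain N where N: "\<And>k m n. N k \<le> m \<Longrightarrow> N k \<le> n \<Longrightarrow> Lp_int M p (\<lambda>x. f m x - f n x) < (1/4) ^ k"
    using Cauchy[of "(1/4) ^ k" for k] by (metis zero_less_divide_1_iff zero_less_numeral zero_less_power)
  \<comment> \<open>Partial sums of \<open>Suc (N i)\<close> are strictly increasing and dominate
    \<open>N n\<close>, whether or not \<open>N\<close> is monotone.\<close>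
  define r where "r n = (\<Sum>i\<le>n. Suc (N i))" for n
  have r: "strict_mono r" by (simp add: strict_mono_Suc_iff r_def)
  have Nr: "N n \<le> r n" for n
    using member_le_sum[of n "{..n}" "\<lambda>i. Suc (N i)"] by (simp add: r_def)
  define d where "d n x = \<bar>f (r (Suc n)) x - f (r n) x\<bar> powr p" for n x
  have dL: "(\<lambda>x. f (r (Suc n)) x - f (r n) x) \<in> Lp M p" for n
    using f p by (intro Lp_diff) auto
  have d: "(\<integral>\<^sup>+x. ennreal (d n x) \<partial>M) \<le> ennreal ((1/4) ^ n)" for n
  proof -
    have "(\<integral>\<^sup>+x. ennreal (d n x) \<partial>M) = ennreal (Lp_int M p (\<lambda>x. f (r (Suc n)) x - f (r n) x))"
      unfolding Lp_int_def d_def using Lp_integrable[OF dL] by (intro nn_integral_eq_integral) auto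
    also have "\<dots> \<le> ennreal ((1/4) ^ n)"
      using Nr[of n] Nr[of "Suc n"] strict_monoD[OF r, of n "Suc n"]
      by (intro ennreal_leI less_imp_le[OF N]) auto
    finally show ?thesis .
  qed
  have [measurable]: "d n \<in> borel_measurable M" for n unfolding d_def by measurable
  have "(\<integral>\<^sup>+x. (\<Sum>n. ennreal (2 ^ n * d n x)) \<partial>M) = (\<Sum>n. \<integral>\<^sup>+x. ennreal (2 ^ n * d n x) \<partial>M)"
    by (intro nn_integral_suminf) measurable
  also have "\<dots> = (\<Sum>n. ennreal (2 ^ n) * \<integral>\<^sup>+x. ennreal (d n x) \<partial>M)"
    by (subst nn_integral_cmult[symmetric]) (auto simp: ennreal_mult' )
  also have "\<dots> \<le> (\<Sum>n. ennreal ((1/2) ^ n))"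
  proof (intro suminf_le summableI)
    fix n
    have "ennreal (2 ^ n) * (\<integral>\<^sup>+x. ennreal (d n x) \<partial>M) \<le> ennreal (2 ^ n) * ennreal ((1/4) ^ n)"
      by (intro mult_left_mono d) auto
    also have "\<dots> = ennreal ((1/2) ^ n)"
      by (simp flip: ennreal_mult power_mult_distrib)
    finally show "ennreal (2 ^ n) * (\<integral>\<^sup>+x. ennreal (d n x) \<partial>M) \<le> ennreal ((1/2) ^ n)" .
  qed
  also have "\<dots> = ennreal (\<Sum>n. (1/2) ^ n)"
    by (intro suminf_ennreal2 summable_geometric) auto
  finally have fin: "(\<integral>\<^sup>+x. (\<Sum>n. ennreal (2 ^ n * d n x)) \<partial>M) \<noteq> \<infinity>"
    by (auto simp: top_unique)
  have "AE x in M. (\<Sum>n. ennreal (2 ^ n * d n x)) \<noteq> \<infinity>"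
    using fin by (intro nn_integral_noteq_infinite) measurable
  then have "AE x in M. convergent (\<lambda>n. f (r n) x)"
  proof eventually_elim
    fix x assume "(\<Sum>n. ennreal (2 ^ n * d n x)) \<noteq> \<infinity>"
    then have sm: "summable (\<lambda>n. 2 ^ n * d n x)"
      by (intro summable_suminf_not_top) (auto simp: d_def)
    define C where "C = (\<Sum>n. 2 ^ n * d n x)"
    have C: "2 ^ n * d n x \<le> C" for n
      using sum_le_suminf[OF sm, of "{n}"] by (simp add: C_def d_def)
    have "0 \<le> C" using C[of 0] by (simp add: d_def) (meson order_trans powr_ge_zero)
    define q where "q = (1/2) powr (1/p)"
    have q: "0 < q" "q < 1" using p powr_less_mono2[of "1/p" "1/2" 1] by (auto simp: q_def)
    have bound: "\<bar>f (r (Suc n)) x - f (r n) x\<bar> \<le> C powr (1/p) * q ^ n" for n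
    proof -
      have "d n x \<le> C * (1/2) ^ n" using C[of n] by (simp add: field_simps)
      then have "d n x powr (1/p) \<le> (C * (1/2) ^ n) powr (1/p)"
        using p by (intro powr_mono2) (auto simp: d_def)
      also have "\<dots> = C powr (1/p) * q ^ n"
        by (simp add: powr_mult q_def powr_powr mult.commute flip: powr_realpow)
      finally show ?thesis using p by (simp add: d_def powr_powr)
    qed
    have "summable (\<lambda>n. C powr (1/p) * q ^ n)"
      using q by (intro summable_mult summable_geometric) auto
    then have "summable (\<lambda>n. f (r (Suc n)) x - f (r n) x)"
      by (rule summable_comparison_test'[where N = 0]) (use bound in auto)
    then have "convergent (\<lambda>n. f (r 0) x + (\<Sum>i<n. f (r (Suc i)) x - f (r i) x))"
      unfolding summable_iff_convergent by (intro convergent_add convergent_const)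
    then show "convergent (\<lambda>n. f (r n) x)"
      by (simp add: sum_lessThan_telescope[where f = "\<lambda>i. f (r i) x"])
  qed
  with r show ?thesis by blast
qed

text \<open>The majorants |f n| + |g| vary with n. Capping |h n| at 2 |g| leaves a part with a fixed
  majorant, and the excess is at most |f n - g|, whose p-th mean vanishes by assumption.\<close>

lemma Lp_dominated_convergence:
  fixes f h :: "nat \<Rightarrow> 'a \<Rightarrow> real"
  assumes p: "0 < p" and f: "\<And>n. f n \<in> Lp M p" and g: "g \<in> Lp M p"
    and fg: "(\<lambda>n. Lp_int M p (\<lambda>x. f n x - g x)) \<longlonglongrightarrow> 0"
    and h[measurable]: "\<And>n. h n \<in> borel_measurable M"
    and hb: "\<And>n x. \<bar>h n x\<bar> \<le> \<bar>f n x\<bar> + \<bar>g x\<bar>"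
    and h0: "AE x in M. (\<lambda>n. h n x) \<longlonglongrightarrow> 0"
  shows "(\<lambda>n. Lp_int M p (h n)) \<longlonglongrightarrow> 0"
proof -
  note [measurable] = f g
  define m where "m n x = min \<bar>h n x\<bar> (2 * \<bar>g x\<bar>)" for n x
  have [measurable]: "m n \<in> borel_measurable M" for n unfolding m_def by measurable
  have g2: "(\<lambda>x. 2 * g x) \<in> Lp M p" using g by (rule Lp_cmult)
  have m: "m n \<in> Lp M p" for n
    by (rule Lp_dominated(1)[OF _ g2]) (use p in \<open>auto simp: m_def\<close>)
  have "(\<lambda>n. Lp_int M p (m n)) \<longlonglongrightarrow> (\<integral>x. 0 \<partial>M)"
    unfolding Lp_int_def
  proof (rule integral_dominated_convergence[OF _ _ Lp_integrable[OF g2]])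
    show "AE x in M. (\<lambda>n. \<bar>m n x\<bar> powr p) \<longlonglongrightarrow> 0"
      using h0
    proof eventually_elim
      fix x assume "(\<lambda>n. h n x) \<longlonglongrightarrow> 0"
      then have "(\<lambda>n. m n x) \<longlonglongrightarrow> min \<bar>0\<bar> (2 * \<bar>g x\<bar>)"
        unfolding m_def by (intro tendsto_intros)
      then have "(\<lambda>n. \<bar>m n x\<bar> powr p) \<longlonglongrightarrow> \<bar>0\<bar> powr p"
        using p by (intro tendsto_powr' tendsto_intros) (auto simp: min_def)
      then show "(\<lambda>n. \<bar>m n x\<bar> powr p) \<longlonglongrightarrow> 0" by simp
    qed
    show "AE x in M. norm (\<bar>m n x\<bar> powr p) \<le> \<bar>2 * g x\<bar> powr p" for n
      using p by (auto intro!: AE_I2 powr_mono2 simp: m_def abs_mult)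
  qed measurable
  then have lim: "(\<lambda>n. 2 powr p * (Lp_int M p (\<lambda>x. f n x - g x) + Lp_int M p (m n))) \<longlonglongrightarrow> 2 powr p * (0 + 0)"
    using fg by (intro tendsto_intros) auto
  have le: "Lp_int M p (h n) \<le> 2 powr p * (Lp_int M p (\<lambda>x. f n x - g x) + Lp_int M p (m n))" for n
  proof -
    have df: "(\<lambda>x. \<bar>f n x - g x\<bar>) \<in> Lp M p"
      by (rule Lp_dominated(1)[OF _ Lp_diff[OF f g]]) (use p in auto)
    have pt: "\<bar>h n x\<bar> \<le> \<bar>\<bar>f n x - g x\<bar> + m n x\<bar>" for x
      using hb[of n x] by (auto simp: m_def min_def)
    have "Lp_int M p (h n) \<le> Lp_int M p (\<lambda>x. \<bar>f n x - g x\<bar> + m n x)"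
      by (rule Lp_dominated(2)) (use p pt df m in \<open>auto intro: Lp_add\<close>)
    also have "\<dots> \<le> 2 powr p * (Lp_int M p (\<lambda>x. \<bar>f n x - g x\<bar>) + Lp_int M p (m n))"
      using p by (intro Lp_int_add_le df m) auto
    also have "Lp_int M p (\<lambda>x. \<bar>f n x - g x\<bar>) = Lp_int M p (\<lambda>x. f n x - g x)"
      by (simp add: Lp_int_def)
    finally show ?thesis .
  qed
  show ?thesis
    by (rule tendsto_sandwich[OF always_eventually always_eventually tendsto_const lim[simplified mult_zero_right add_0]])
       (use le in auto)
qed

text \<open>Differentiation under the integral sign. The difference quotients are tested along
  sequences so that dominated convergence applies; the majorant comes from the mean value bound for
  |t|^p.\<close>

lemma has_real_derivative_Lp_int:
  assumes p: "1 < p" and f: "f \<in> Lp M p" and g: "g \<in> Lp M p"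
  shows "((\<lambda>t. Lp_int M p (\<lambda>x. f x + t * g x)) has_real_derivative
           p * (\<integral>x. \<bar>f x\<bar> powr (p - 2) * f x * g x \<partial>M)) (at 0)"
  unfolding DERIV_def
proof (subst tendsto_at_iff_sequentially, intro allI impI)
  note [measurable] = f g
  fix X :: "nat \<Rightarrow> real" assume X: "\<forall>i. X i \<in> UNIV - {0}" and "X \<longlonglongrightarrow> 0"
  obtain N where N: "\<And>n. N \<le> n \<Longrightarrow> \<bar>X n\<bar> < 1"
    using LIMSEQ_D[OF \<open>X \<longlonglongrightarrow> 0\<close>, of 1] by auto
  \<comment> \<open>Dropping finitely many terms gives |Y n| \<le> 1, which makes the majorant
    independent of n.\<close>
  define Y where "Y n = X (n + N)" for n
  have Y: "Y n \<noteq> 0" "\<bar>Y n\<bar> \<le> 1" for n using X N[of "n + N"] by (auto simp: Y_def)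
  have Y0: "Y \<longlonglongrightarrow> 0" unfolding Y_def by (rule LIMSEQ_ignore_initial_segment) fact
  define q where "q n x = (\<bar>f x + Y n * g x\<bar> powr p - \<bar>f x\<bar> powr p) / Y n" for n x
  have fY: "(\<lambda>x. f x + Y n * g x) \<in> Lp M p" for n
    using f g p by (intro Lp_add Lp_cmult) auto
  have "(\<lambda>n. \<integral>x. q n x \<partial>M) \<longlonglongrightarrow> (\<integral>x. p * (\<bar>f x\<bar> powr (p - 2) * f x) * g x \<partial>M)"
  proof (rule integral_dominated_convergence[where w = "\<lambda>x. p * (2 powr p * (\<bar>f x\<bar> powr p + \<bar>g x\<bar> powr p))"])
    show "integrable M (\<lambda>x. p * (2 powr p * (\<bar>f x\<bar> powr p + \<bar>g x\<bar> powr p)))"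
      using Lp_integrable[OF f] Lp_integrable[OF g] by auto
    show "AE x in M. (\<lambda>n. q n x) \<longlonglongrightarrow> p * (\<bar>f x\<bar> powr (p - 2) * f x) * g x"
    proof (rule AE_I2)
      fix x
      have "((\<lambda>t. \<bar>f x + t * g x\<bar> powr p) has_real_derivative
          (p * (\<bar>f x + 0 * g x\<bar> powr (p - 2) * (f x + 0 * g x))) * g x) (at 0)"
        by (rule DERIV_chain2[OF has_real_derivative_abs_powr[OF p]]) (auto intro!: derivative_eq_intros)
      then have "((\<lambda>h. (\<bar>f x + h * g x\<bar> powr p - \<bar>f x\<bar> powr p) / h)
          \<longlongrightarrow> p * (\<bar>f x\<bar> powr (p - 2) * f x) * g x) (at 0)"
        by (simp add: DERIV_def)
      then have "((\<lambda>h. (\<bar>f x + h * g x\<bar> powr p - \<bar>f x\<bar> powr p) / h) \<circ> Y)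
          \<longlonglongrightarrow> p * (\<bar>f x\<bar> powr (p - 2) * f x) * g x"
        using Y Y0 by (auto simp: tendsto_at_iff_sequentially)
      then show "(\<lambda>n. q n x) \<longlonglongrightarrow> p * (\<bar>f x\<bar> powr (p - 2) * f x) * g x"
        by (simp add: o_def q_def)
    qed
    show "AE x in M. norm (q n x) \<le> p * (2 powr p * (\<bar>f x\<bar> powr p + \<bar>g x\<bar> powr p))" for n
    proof (rule AE_I2)
      fix x
      let ?s = "\<bar>f x\<bar> + \<bar>g x\<bar>"
      have tg: "\<bar>Y n * g x\<bar> \<le> \<bar>g x\<bar>"
        using Y[of n] mult_right_mono[of "\<bar>Y n\<bar>" 1 "\<bar>g x\<bar>"] by (simp add: abs_mult)
      have "\<bar>\<bar>f x + Y n * g x\<bar> powr p - \<bar>f x\<bar> powr p\<bar>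
          \<le> p * max \<bar>f x + Y n * g x\<bar> \<bar>f x\<bar> powr (p - 1) * \<bar>Y n * g x\<bar>"
        using abs_powr_diff_le[OF p, of "f x + Y n * g x" "f x"] by simp
      also have "\<dots> \<le> p * ?s powr (p - 1) * \<bar>Y n * g x\<bar>"
        using p tg by (intro mult_right_mono mult_left_mono powr_mono2) auto
      also have "\<dots> = \<bar>Y n\<bar> * (p * ?s powr (p - 1) * \<bar>g x\<bar>)" by (simp add: abs_mult)
      finally have "norm (q n x) \<le> p * ?s powr (p - 1) * \<bar>g x\<bar>"
        using Y[of n] by (simp add: q_def field_simps)
      also have "\<dots> \<le> p * ?s powr (p - 1) * ?s"
        using p by (intro mult_left_mono) auto
      also have "\<dots> = p * ?s powr p"
        using powr_add[of ?s "p - 1" 1] by (cases "?s = 0") auto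
      also have "\<dots> \<le> p * (2 powr p * (\<bar>f x\<bar> powr p + \<bar>g x\<bar> powr p))"
        using p abs_powr_add_le[of p "\<bar>f x\<bar>" "\<bar>g x\<bar>"] by (intro mult_left_mono) auto
      finally show "norm (q n x) \<le> p * (2 powr p * (\<bar>f x\<bar> powr p + \<bar>g x\<bar> powr p))" .
    qed
  qed (simp_all add: q_def)
  moreover have "(\<integral>x. q n x \<partial>M) = (Lp_int M p (\<lambda>x. f x + Y n * g x) - Lp_int M p f) / Y n" for n
    using Lp_integrable[OF f] Lp_integrable[OF fY[of n]] by (simp add: q_def Lp_int_def)
  moreover have "(\<integral>x. p * (\<bar>f x\<bar> powr (p - 2) * f x) * g x \<partial>M) = p * (\<integral>x. \<bar>f x\<bar> powr (p - 2) * f x * g x \<partial>M)"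
    by (simp add: mult.assoc)
  ultimately have "(\<lambda>n. (Lp_int M p (\<lambda>x. f x + Y n * g x) - Lp_int M p f) / Y n)
      \<longlonglongrightarrow> p * (\<integral>x. \<bar>f x\<bar> powr (p - 2) * f x * g x \<partial>M)" by simp
  then show "((\<lambda>h. (Lp_int M p (\<lambda>x. f x + (0 + h) * g x) - Lp_int M p (\<lambda>x. f x + 0 * g x)) / h) \<circ> X)
      \<longlonglongrightarrow> p * (\<integral>x. \<bar>f x\<bar> powr (p - 2) * f x * g x \<partial>M)"
    unfolding Y_def by - (rule LIMSEQ_offset[where k = N], simp only: o_def add_0 mult_zero_left add_0_right)
qed

text \<open>The tangent inequality at the weighted mean m is integrated against w; as w has total
  mass one, the linear term integrates to zero.\<close>

lemma weighted_Jensen_abs_powr: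
  fixes w f :: "'a \<Rightarrow> real"
  assumes p: "1 < p" and w: "\<And>x. 0 \<le> w x" "integrable M w" "(\<integral>x. w x \<partial>M) = 1"
    and f: "integrable M (\<lambda>x. w x * f x)" "integrable M (\<lambda>x. w x * \<bar>f x\<bar> powr p)"
  shows "\<bar>\<integral>x. w x * f x \<partial>M\<bar> powr p \<le> (\<integral>x. w x * \<bar>f x\<bar> powr p \<partial>M)"
proof -
  define m where "m = (\<integral>x. w x * f x \<partial>M)"
  define d where "d = p * (\<bar>m\<bar> powr (p - 2) * m)"
  have "(\<integral>x. (\<bar>m\<bar> powr p - d * m) * w x + d * (w x * f x) \<partial>M) = (\<bar>m\<bar> powr p - d * m) * 1 + d * m"
    using w f by (subst Bochner_Integration.integral_add) (auto simp: m_def)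
  then have "\<bar>m\<bar> powr p = (\<integral>x. (\<bar>m\<bar> powr p - d * m) * w x + d * (w x * f x) \<partial>M)" by simp
  also have "\<dots> \<le> (\<integral>x. w x * \<bar>f x\<bar> powr p \<partial>M)"
  proof (rule integral_mono)
    fix x
    have "w x * (\<bar>m\<bar> powr p + d * (f x - m)) \<le> w x * \<bar>f x\<bar> powr p"
      unfolding d_def by (intro mult_left_mono abs_powr_tangent p w)
    then show "(\<bar>m\<bar> powr p - d * m) * w x + d * (w x * f x) \<le> w x * \<bar>f x\<bar> powr p"
      by (simp add: algebra_simps)
  qed (use w f in auto)
  finally show ?thesis by (simp add: m_def)
qed

section \<open>Smooth functions and test functions\<close>

text \<open>Allows an explicit derivative in place of the chosen \<open>frechet_derivative\<close>,
  so that inductions on the order can work with formulas.\<close>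

lemma Ck_SucI:
  assumes "\<And>x. (f has_derivative f' x) (at x)" "\<And>v. Ck n (\<lambda>x. f' x v)"
  shows "Ck (Suc n) f"
proof -
  have "frechet_derivative f (at x) = f' x" for x
    using frechet_derivative_at[OF assms(1)] by simp
  then show ?thesis using assms by (auto simp: differentiable_def)
qed

lemma Ck_Suc_has_derivative:
  "Ck (Suc n) f \<Longrightarrow> (f has_derivative frechet_derivative f (at x)) (at x)"
  by (simp add: frechet_derivative_works)

text \<open>Needed for products: the Leibniz rule leaves undifferentiated factors, whose regularity
  has to be lowered by one order for the induction hypothesis.\<close>

lemma Ck_Suc_imp_Ck: "Ck (Suc n) f \<Longrightarrow> Ck n f"
proof (induction n arbitrary: f)
  case 0
  then show ?case
    by (auto intro!: continuous_at_imp_continuous_on differentiable_imp_continuous_within)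
next
  case (Suc n)
  have "Ck n (\<lambda>x. frechet_derivative f (at x) v)" for v
    using Suc.prems unfolding Ck.simps(2)[of "Suc n" f] by (intro Suc.IH) blast
  then show ?case using Suc.prems by simp
qed

lemma Ck_const: "Ck n (\<lambda>x. c)"
  by (induction n arbitrary: c) (auto intro!: Ck_SucI[where f' = "\<lambda>x v. 0"] simp del: Ck.simps(2))

lemma Ck_add:
  fixes f g :: "'a::real_normed_vector \<Rightarrow> 'b::real_normed_vector"
  shows "Ck n f \<Longrightarrow> Ck n g \<Longrightarrow> Ck n (\<lambda>x. f x + g x)"
proof (induction n arbitrary: f g)
  case (Suc n)
  show ?case
  proof (rule Ck_SucI)
    show "((\<lambda>x. f x + g x) has_derivative
        (\<lambda>v. frechet_derivative f (at x) v + frechet_derivative g (at x) v)) (at x)" for x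
      using Suc.prems by (intro has_derivative_add Ck_Suc_has_derivative)
  qed (use Suc in auto)
qed (auto intro: continuous_intros)

lemma Ck_mult:
  fixes f g :: "'a::real_normed_vector \<Rightarrow> real"
  shows "Ck n f \<Longrightarrow> Ck n g \<Longrightarrow> Ck n (\<lambda>x. f x * g x)"
proof (induction n arbitrary: f g)
  case (Suc n)
  show ?case
  proof (rule Ck_SucI)
    show "((\<lambda>x. f x * g x) has_derivative
        (\<lambda>v. f x * frechet_derivative g (at x) v + frechet_derivative f (at x) v * g x)) (at x)" for x
      using Suc.prems by (intro has_derivative_mult Ck_Suc_has_derivative)
    fix v
    have "Ck n f" "Ck n g" using Suc.prems Ck_Suc_imp_Ck by blast+
    moreover have "Ck n (\<lambda>x. frechet_derivative f (at x) v)" "Ck n (\<lambda>x. frechet_derivative g (at x) v)"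
      using Suc.prems by simp_all
    ultimately show "Ck n (\<lambda>x. f x * frechet_derivative g (at x) v + frechet_derivative f (at x) v * g x)"
      by (intro Ck_add Suc.IH)
  qed
qed (auto intro: continuous_intros)

lemma smooth_const: "smooth (\<lambda>x. c)"
  by (simp add: smooth_def Ck_const)

lemma smooth_add:
  fixes f g :: "'a::real_normed_vector \<Rightarrow> 'b::real_normed_vector"
  shows "smooth f \<Longrightarrow> smooth g \<Longrightarrow> smooth (\<lambda>x. f x + g x)"
  by (simp add: smooth_def Ck_add)

lemma smooth_mult:
  fixes f g :: "'a::real_normed_vector \<Rightarrow> real"
  shows "smooth f \<Longrightarrow> smooth g \<Longrightarrow> smooth (\<lambda>x. f x * g x)"
  by (simp add: smooth_def Ck_mult)

lemma smooth_cmult: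
  fixes f :: "'a::real_normed_vector \<Rightarrow> real"
  shows "smooth f \<Longrightarrow> smooth (\<lambda>x. c * f x)"
  by (intro smooth_mult smooth_const)

lemma smooth_has_derivative:
  "smooth f \<Longrightarrow> (f has_derivative frechet_derivative f (at x)) (at x)"
  unfolding smooth_def using Ck_Suc_has_derivative by blast

lemma smooth_frechet_derivative:
  "smooth f \<Longrightarrow> smooth (\<lambda>x. frechet_derivative f (at x) v)"
  unfolding smooth_def by (metis Ck.simps(2))

lemma smooth_imp_continuous_on: "smooth f \<Longrightarrow> continuous_on S f"
  unfolding smooth_def by (metis Ck.simps(1) continuous_on_subset subset_UNIV)

text \<open>The reciprocal r of the square root satisfies r' = - f f' r^3, a polynomial in f, f' and
  r, so an induction on the order closes on r by the product rule. The root itself is (f^2 + e^2)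
  r.\<close>

lemma smooth_sqrt_square_add:
  fixes f :: "'a::real_normed_vector \<Rightarrow> real"
  assumes f: "smooth f" and "e \<noteq> 0"
  shows "smooth (\<lambda>x. sqrt ((f x)\<^sup>2 + e\<^sup>2))"
proof -
  define r where "r x = inverse (sqrt ((f x)\<^sup>2 + e\<^sup>2))" for x
  have pos: "0 < t\<^sup>2 + e\<^sup>2" for t :: real using \<open>e \<noteq> 0\<close> by (simp add: add_nonneg_pos)
  have der: "((\<lambda>t. inverse (sqrt (t\<^sup>2 + e\<^sup>2))) has_real_derivative - (t * inverse (sqrt (t\<^sup>2 + e\<^sup>2)) ^ 3)) (at t)" for t
  proof -
    have "sqrt (t\<^sup>2 + e\<^sup>2) > 0" using pos[of t] by simp
    then show ?thesis using pos[of t]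
      by (auto intro!: derivative_eq_intros simp: power2_eq_square power3_eq_cube field_simps)
  qed
  have r': "(r has_derivative (\<lambda>v. (frechet_derivative f (at x) v * (-1)) * (f x * (r x * (r x * r x))))) (at x)" for x
    using DERIV_compose_FDERIV[OF der smooth_has_derivative[OF f], of x]
    by (simp add: r_def[abs_def] power3_eq_cube mult_ac)
  have "Ck n r" for n
  proof (induction n)
    case 0
    have "sqrt ((f x)\<^sup>2 + e\<^sup>2) \<noteq> 0" for x using \<open>e \<noteq> 0\<close> by simp
    then show ?case unfolding Ck.simps r_def
      by (intro continuous_on_inverse continuous_intros smooth_imp_continuous_on f) blast
  next
    case (Suc n)
    show ?case
      by (rule Ck_SucI[OF r'], intro Ck_mult Ck_const Suc)
         (use f smooth_frechet_derivative[OF f] in \<open>auto simp: smooth_def\<close>)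
  qed
  then have "smooth (\<lambda>x. (f x * f x + e\<^sup>2) * r x)"
    using f by (intro smooth_mult smooth_add smooth_const) (auto simp: smooth_def)
  moreover have "(f x * f x + e\<^sup>2) * r x = sqrt ((f x)\<^sup>2 + e\<^sup>2)" for x
    using real_div_sqrt[OF less_imp_le[OF pos[of "f x"]]] by (simp add: r_def power2_eq_square divide_inverse)
  ultimately show ?thesis by simp
qed

text \<open>The functions t^-k exp(-1/t), with k free, form a family closed under differentiation up
  to linear combinations, so smoothness is an induction for all k at once. The bump function itself
  uses k = 0.\<close>

definition exp_flat :: "nat \<Rightarrow> real \<Rightarrow> real" where
  "exp_flat k t = (if 0 < t then inverse t ^ k * exp (- inverse t) else 0)"

text \<open>With y = 1/t this is the decay of y^k exp(-y) at infinity.\<close>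

lemma exp_flat_tendsto_0: "(exp_flat k \<longlongrightarrow> 0) (at 0)"
proof (rule filterlim_split_at)
  show "(exp_flat k \<longlongrightarrow> 0) (at_left 0)"
    by (rule tendsto_eventually) (auto simp: exp_flat_def eventually_at_filter)
  have "((\<lambda>y::real. y ^ k / exp y) \<longlongrightarrow> 0) at_top" by (rule tendsto_power_div_exp_0)
  then have "((\<lambda>t::real. inverse t ^ k / exp (inverse t)) \<longlongrightarrow> 0) (at_right 0)"
    by (rule filterlim_compose[OF _ filterlim_inverse_at_top_right])
  then show "(exp_flat k \<longlongrightarrow> 0) (at_right 0)"
    by (rule Lim_transform_eventually)
       (auto simp: exp_flat_def eventually_at_filter exp_minus divide_inverse)
qed

lemma has_real_derivative_exp_flat:
  "(exp_flat k has_real_derivative (- real k) * exp_flat (Suc k) t + exp_flat (Suc (Suc k)) t) (at t)"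
proof -
  consider "t = 0" | "0 < t" | "t < 0" by linarith
  then show ?thesis
  proof cases
    case 1
    \<comment> \<open>At the origin the difference quotient of one member is the next member of the
      family, which tends to zero.\<close>
    have "exp_flat k h / h = exp_flat (Suc k) h" for h
      by (simp add: exp_flat_def divide_inverse)
    then show ?thesis using exp_flat_tendsto_0[of "Suc k"] 1
      by (simp add: DERIV_def exp_flat_def[of _ 0])
  next
    case 2
    have "((\<lambda>t. inverse t ^ k * exp (- inverse t)) has_real_derivative
        (- real k) * exp_flat (Suc k) t + exp_flat (Suc (Suc k)) t) (at t)"
    proof (rule DERIV_cong)
      show "((\<lambda>t. inverse t ^ k * exp (- inverse t)) has_real_derivative
          real k * inverse t ^ (k - 1) * (- (inverse t * inverse t)) * exp (- inverse t)
          + inverse t ^ k * (exp (- inverse t) * (inverse t * inverse t))) (at t)"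
        using 2 by (auto intro!: derivative_eq_intros)
    qed (use 2 in \<open>cases k; simp add: exp_flat_def algebra_simps\<close>)
    then show ?thesis
      by (rule DERIV_cong_ev[OF refl _ refl, THEN iffD1, rotated])
         (use 2 eventually_nhds_in_open[of "{0<..}" t] in \<open>auto elim: eventually_mono simp: exp_flat_def\<close>)
  next
    case 3
    have "((\<lambda>t. 0) has_real_derivative (- real k) * exp_flat (Suc k) t + exp_flat (Suc (Suc k)) t) (at t)"
      using 3 by (simp add: exp_flat_def)
    then show ?thesis
      by (rule DERIV_cong_ev[OF refl _ refl, THEN iffD1, rotated])
         (use 3 eventually_nhds_in_open[of "{..<0}" t] in \<open>auto elim: eventually_mono simp: exp_flat_def\<close>)
  qed
qed

lemma smooth_exp_flat:
  fixes q :: "'a::real_normed_vector \<Rightarrow> real"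
  assumes q: "smooth q"
  shows "smooth (\<lambda>x. exp_flat k (q x))"
proof -
  have "Ck n (\<lambda>x. exp_flat k (q x))" for n
  proof (induction n arbitrary: k)
    case 0
    have "continuous_on UNIV (exp_flat k)"
      using has_real_derivative_exp_flat by (intro DERIV_continuous_on) (auto intro: has_field_derivative_at_within)
    then show ?case using smooth_imp_continuous_on[OF q]
      by (auto intro: continuous_on_compose2)
  next
    case (Suc n)
    show ?case
    proof (rule Ck_SucI)
      show "((\<lambda>x. exp_flat k (q x)) has_derivative (\<lambda>v. frechet_derivative q (at x) v *
          ((- real k) * exp_flat (Suc k) (q x) + exp_flat (Suc (Suc k)) (q x)))) (at x)" for x
        using DERIV_compose_FDERIV[OF has_real_derivative_exp_flat smooth_has_derivative[OF q]] .
      show "Ck n (\<lambda>x. frechet_derivative q (at x) v *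
          ((- real k) * exp_flat (Suc k) (q x) + exp_flat (Suc (Suc k)) (q x)))" for v
        using smooth_frechet_derivative[OF q] by (intro Ck_mult Ck_add Ck_const Suc) (simp add: smooth_def)
    qed
  qed
  then show ?thesis by (simp add: smooth_def)
qed

lemma smooth_inner_diff:
  fixes a :: "'a::real_inner"
  shows "smooth (\<lambda>x. (x - a) \<bullet> (x - a))"
proof -
  have lin: "Ck n (\<lambda>x. (x - a) \<bullet> v)" for n and v :: 'a
  proof (cases n)
    case (Suc m)
    show ?thesis unfolding Suc
      by (rule Ck_SucI[where f' = "\<lambda>x w. w \<bullet> v"]) (auto intro!: derivative_eq_intros Ck_const)
  qed (auto intro!: continuous_intros)
  have "Ck n (\<lambda>x. (x - a) \<bullet> (x - a))" for n
  proof (cases n)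
    case (Suc m)
    show ?thesis unfolding Suc
    proof (rule Ck_SucI)
      show "((\<lambda>x. (x - a) \<bullet> (x - a)) has_derivative (\<lambda>w. 2 * ((x - a) \<bullet> w))) (at x)" for x
        by (auto intro!: derivative_eq_intros simp: inner_commute)
    qed (intro Ck_mult Ck_const lin)
  qed (auto intro!: continuous_intros)
  then show ?thesis by (simp add: smooth_def)
qed

lemma test_functions_smooth: "f \<in> test_functions \<Omega> \<Longrightarrow> smooth f"
  by (simp add: test_functions_def)

lemma test_functions_zero_outside: "f \<in> test_functions \<Omega> \<Longrightarrow> x \<notin> \<Omega> \<Longrightarrow> f x = 0"
  unfolding test_functions_def using closure_subset[of "{x. f x \<noteq> 0}"] by auto

text \<open>One criterion for sums, multiples and compositions with functions vanishing at zero: the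
  support lies in the union of two compact supports. For a single function, f and h
  coincide.\<close>

lemma test_functions_support:
  fixes g :: "'a::real_normed_vector \<Rightarrow> real"
  assumes f: "f \<in> test_functions \<Omega>" "h \<in> test_functions \<Omega>" and g: "smooth g"
    and z: "\<And>x. f x = 0 \<Longrightarrow> h x = 0 \<Longrightarrow> g x = 0"
  shows "g \<in> test_functions \<Omega>"
proof -
  have sub: "closure {x. g x \<noteq> 0} \<subseteq> closure {x. f x \<noteq> 0} \<union> closure {x. h x \<noteq> 0}"
    unfolding closure_Un[symmetric] using z by (intro closure_mono) auto
  have "compact (closure {x. f x \<noteq> 0} \<union> closure {x. h x \<noteq> 0})"
    using f by (intro compact_Un) (auto simp: test_functions_def)
  then have "compact (closure {x. g x \<noteq> 0})"
    using sub compact_Int_closed[of _ "closure {x. g x \<noteq> 0}"] by (metis closed_closure inf.absorb2)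
  then show ?thesis using sub f g by (auto simp: test_functions_def)
qed

lemma test_functions_add:
  "f \<in> test_functions \<Omega> \<Longrightarrow> g \<in> test_functions \<Omega> \<Longrightarrow> (\<lambda>x. f x + g x) \<in> test_functions \<Omega>"
  by (rule test_functions_support[of f \<Omega> g]) (auto intro: smooth_add test_functions_smooth)

lemma test_functions_cmult:
  "f \<in> test_functions \<Omega> \<Longrightarrow> (\<lambda>x. c * f x) \<in> test_functions \<Omega>"
  by (rule test_functions_support[of f \<Omega> f]) (auto intro: smooth_cmult test_functions_smooth)

text \<open>The bump exp(-1/q) with q = r^2 - |x - a|^2, extended by zero. That it is nonzero on a
  nonempty open set later gives it a positive p-th mean, so the unit sphere is not empty.\<close>

lemma ex_test_function:
  fixes \<Omega> :: "'a::euclidean_space set"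
  assumes "open \<Omega>" "\<Omega> \<noteq> {}"
  obtains f where "f \<in> test_functions \<Omega>" "\<And>x. 0 \<le> f x" "open {x. f x \<noteq> 0}" "{x. f x \<noteq> 0} \<noteq> {}"
proof -
  obtain a where "a \<in> \<Omega>" using assms by blast
  then obtain r where r: "0 < r" "cball a r \<subseteq> \<Omega>" using assms open_contains_cball by blast
  define q where "q x = r\<^sup>2 + (-1) * ((x - a) \<bullet> (x - a))" for x
  have q: "smooth q" unfolding q_def by (intro smooth_add smooth_const smooth_cmult smooth_inner_diff)
  define f where "f x = exp_flat 0 (q x)" for x
  have pos: "0 < q x \<longleftrightarrow> x \<in> ball a r" for x
  proof -
    have "0 < q x \<longleftrightarrow> (norm (x - a))\<^sup>2 < r\<^sup>2" by (simp add: q_def power2_norm_eq_inner)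
    also have "\<dots> \<longleftrightarrow> norm (x - a) < r" using r power_mono_iff[of r "norm (x - a)" 2] by (simp flip: not_le)
    finally show ?thesis by (simp add: dist_norm norm_minus_commute)
  qed
  have "f x \<noteq> 0 \<longleftrightarrow> 0 < q x" for x by (simp add: f_def exp_flat_def)
  then have supp: "{x. f x \<noteq> 0} = ball a r" unfolding pos by blast
  show ?thesis
  proof (rule that[of f])
    have "smooth f" unfolding f_def by (rule smooth_exp_flat[OF q])
    then show "f \<in> test_functions \<Omega>" using r by (simp add: test_functions_def supp)
    show "0 \<le> f x" for x by (simp add: f_def exp_flat_def)
  qed (use r in \<open>auto simp: supp\<close>)
qed

section \<open>Invariance of Lebesgue measure under left translations\<close>

text \<open>The change of variables theorems of the library require a well-ordered index type. A copy of
  the given finite index type carries such an order.\<close>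

typedef 'a wo = "UNIV :: 'a set" by simp

instance wo :: (finite) finite
proof
  have "(UNIV :: 'a wo set) = Abs_wo ` UNIV" by (metis Abs_wo_cases surjI)
  then show "finite (UNIV :: 'a wo set)" by (metis finite finite_imageI)
qed

definition wo_code :: "'a::finite wo \<Rightarrow> nat" where
  "wo_code x = (SOME f :: 'a \<Rightarrow> nat. inj f) (Rep_wo x)"

lemma inj_wo_code: "inj wo_code"
proof -
  have "\<exists>f :: 'a \<Rightarrow> nat. inj f" using finite_imp_inj_to_nat_seg[OF finite[of "UNIV :: 'a set"]] by blast
  then have "inj (SOME f :: 'a \<Rightarrow> nat. inj f)" by (rule someI_ex)
  then show ?thesis by (intro injI) (simp only: wo_code_def inj_eq Rep_wo_inject)
qed

instantiation wo :: (finite) wellorder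
begin

definition less_eq_wo :: "'a wo \<Rightarrow> 'a wo \<Rightarrow> bool" where
  "less_eq_wo x y \<longleftrightarrow> wo_code x \<le> wo_code y"

definition less_wo :: "'a wo \<Rightarrow> 'a wo \<Rightarrow> bool" where
  "less_wo x y \<longleftrightarrow> wo_code x < wo_code y"

instance
proof
  fix P :: "'a wo \<Rightarrow> bool" and a
  assume step: "\<And>x. (\<And>y. y < x \<Longrightarrow> P y) \<Longrightarrow> P x"
  show "P a"
    by (induction a rule: measure_induct_rule[of wo_code]) (auto intro: step simp: less_wo_def)
qed (auto simp: less_eq_wo_def less_wo_def dest: injD[OF inj_wo_code])

end

lemma prod_Basis_vec:
  fixes x :: "real^'n"
  shows "(\<Prod>b\<in>Basis. x \<bullet> b) = (\<Prod>i\<in>UNIV. x $ i)"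
proof -
  have B: "(Basis :: (real^'n) set) = (\<lambda>i. axis i 1) ` UNIV"
    by (auto simp: Basis_vec_def)
  have "inj (\<lambda>i. axis i 1 :: real^'n)" by (simp add: inj_def axis_eq_axis)
  then show ?thesis unfolding B by (subst prod.reindex) (simp_all add: inner_axis)
qed

lemma ball_Basis_vec_le:
  fixes l u :: "real^'n"
  shows "(\<forall>b\<in>Basis. l \<bullet> b \<le> u \<bullet> b) \<longleftrightarrow> (\<forall>i. l $ i \<le> u $ i)"
  by (auto simp: Basis_vec_def inner_axis)

lemma emeasure_lborel_box_vec:
  fixes l u :: "real^'n"
  assumes "\<And>i. l $ i \<le> u $ i"
  shows "emeasure lborel (box l u) = ennreal (\<Prod>i\<in>UNIV. u $ i - l $ i)"
  using assms ball_Basis_vec_le[of l u]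
  by (subst emeasure_lborel_box) (auto simp: prod_Basis_vec)

lemma lborel_vec_eqI:
  fixes M :: "(real^'n) measure"
  assumes "\<And>l u. (\<And>i. l $ i \<le> u $ i) \<Longrightarrow> emeasure M (box l u) = ennreal (\<Prod>i\<in>UNIV. u $ i - l $ i)"
    and "sets M = sets borel"
  shows "lborel = M"
proof (rule lborel_eqI)
  fix l u :: "real^'n" assume "\<And>b. b \<in> Basis \<Longrightarrow> l \<bullet> b \<le> u \<bullet> b"
  then have "l $ i \<le> u $ i" for i using ball_Basis_vec_le[of l u] by blast
  then show "emeasure M (box l u) = ennreal (\<Prod>b\<in>Basis. (u - l) \<bullet> b)"
    unfolding prod_Basis_vec by (simp add: assms(1))
qed (rule assms)

definition reindex :: "('m \<Rightarrow> 'n) \<Rightarrow> real^'n \<Rightarrow> real^'m" where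
  "reindex \<sigma> x = (\<chi> i. x $ \<sigma> i)"

lemma bounded_linear_reindex: "bounded_linear (reindex \<sigma> :: real^'n \<Rightarrow> real^'m)"
  by (intro linear_conv_bounded_linear[THEN iffD1] linearI) (simp_all add: reindex_def vec_eq_iff)

text \<open>A bijection of the indices only permutes the side lengths of a box, and boxes determine
  the measure.\<close>

lemma distr_lborel_reindex:
  fixes \<sigma> :: "'m::finite \<Rightarrow> 'n::finite"
  assumes "bij \<sigma>"
  shows "distr lborel borel (reindex \<sigma>) = lborel"
proof (rule lborel_vec_eqI[symmetric])
  fix l u :: "real^'m" assume le: "\<And>i. l $ i \<le> u $ i"
  have [measurable]: "reindex \<sigma> \<in> borel_measurable borel"
    using bounded_linear_reindex by (intro borel_measurable_continuous_onI linear_continuous_on)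
  have inv: "inv \<sigma> (\<sigma> i) = i" "\<sigma> (inv \<sigma> j) = j" for i j
    using assms by (auto simp: bij_is_inj bij_is_surj surj_f_inv_f)
  have "reindex \<sigma> -` box l u = box (reindex (inv \<sigma>) l) (reindex (inv \<sigma>) u)"
    by (auto simp: mem_box_cart reindex_def) (metis inv)+
  then have "emeasure (distr lborel borel (reindex \<sigma>)) (box l u)
      = emeasure lborel (box (reindex (inv \<sigma>) l) (reindex (inv \<sigma>) u))"
    by (simp add: emeasure_distr)
  also have "\<dots> = ennreal (\<Prod>j\<in>UNIV. u $ inv \<sigma> j - l $ inv \<sigma> j)"
    by (subst emeasure_lborel_box_vec) (simp_all add: reindex_def le)
  also have "(\<Prod>j\<in>UNIV. u $ inv \<sigma> j - l $ inv \<sigma> j) = (\<Prod>i\<in>UNIV. u $ i - l $ i)"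
    using prod.reindex_bij_betw[OF bij_imp_bij_inv[OF assms], of "\<lambda>i. u $ i - l $ i"] by simp
  finally show "emeasure (distr lborel borel (reindex \<sigma>)) (box l u) = ennreal (\<Prod>i\<in>UNIV. u $ i - l $ i)" .
qed simp

text \<open>The preimage of a box under f is its image under g, and the change of variables formula
  with Jacobian of modulus one gives this image the volume of the box.\<close>

lemma lborel_eq_distr_volume_preserving:
  fixes f g :: "real^'n::{finite,wellorder} \<Rightarrow> real^'n::_"
  assumes df: "\<And>x. (f has_derivative f' x) (at x)" and dg: "\<And>x. (g has_derivative g' x) (at x)"
    and det: "\<And>x. \<bar>det (matrix (g' x))\<bar> = 1"
    and fg: "\<And>x. f (g x) = x" "\<And>x. g (f x) = x"
  shows "distr lborel borel f = lborel"
proof (rule lborel_eqI[symmetric])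
  fix l u :: "real^'n::_" assume le: "\<And>b. b \<in> Basis \<Longrightarrow> l \<bullet> b \<le> u \<bullet> b"
  have cont: "continuous_on S f" "continuous_on S g" for S
    using df dg by (auto intro!: continuous_at_imp_continuous_on has_derivative_continuous)
  have [measurable]: "f \<in> borel_measurable borel"
    using cont by (intro borel_measurable_continuous_onI)
  have im: "f -` box l u = g ` box l u"
    using fg by (auto simp: image_iff) (metis fg(2))
  have "f -` box l u \<in> sets borel"
    using measurable_sets[OF \<open>f \<in> borel_measurable borel\<close>, of "box l u"] by simp
  have fin: "emeasure lborel (box l u) < top"
    using emeasure_lborel_box_finite[of l u] by simp
  have inj: "inj_on g (box l u)" by (metis fg(1) inj_on_inverseI)
  have "((\<lambda>x. \<bar>det (matrix (g' x))\<bar>) has_integral measure lborel (box l u)) (box l u)"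
    unfolding det by (rule has_integral_measure_lborel) (use fin in simp_all)
  then have "g ` box l u \<in> lmeasurable \<and> measure lebesgue (g ` box l u) = measure lborel (box l u)"
    by (intro has_measure_differentiable_image[where f' = g', THEN iffD2] inj has_derivative_at_withinI[OF dg])
       simp
  then have "emeasure lborel (f -` box l u) = emeasure lborel (box l u)"
    using \<open>f -` box l u \<in> sets borel\<close>
      fin
    by (simp add: im[symmetric] fmeasurable_def emeasure_eq_ennreal_measure less_top)
  then show "emeasure (distr lborel borel f) (box l u) = ennreal (\<Prod>b\<in>Basis. (u - l) \<bullet> b)"
    using le im by (simp add: emeasure_distr)
qed simp

lemma dilation_tendsto_0:
  fixes x :: "real^'n" and k :: "'n \<Rightarrow> nat"
  assumes "\<And>j. 1 \<le> k j"
  shows "(\<lambda>i. \<chi> j. inverse (real (Suc i)) ^ k j * x $ j) \<longlonglongrightarrow> 0"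
proof (rule vec_tendstoI)
  fix j
  have "(\<lambda>i. inverse (real (Suc i)) ^ k j * x $ j) \<longlonglongrightarrow> 0 ^ k j * x $ j"
    by (intro tendsto_intros LIMSEQ_inverse_real_of_nat)
  then show "(\<lambda>i. (\<chi> j. inverse (real (Suc i)) ^ k j * x $ j) $ j) \<longlonglongrightarrow> 0 $ j"
    using assms[of j] by (simp add: power_0_left)
qed

text \<open>The Jacobian of the left translation by a at x is unchanged when a and x are both dilated.
  Letting the dilation parameter tend to zero shows that it equals its value at the identity.\<close>

lemma left_translation_det_1:
  fixes m :: "real^'n \<Rightarrow> real^'n \<Rightarrow> real^'n" and k :: "'n \<Rightarrow> nat"
  defines "\<delta> \<equiv> (\<lambda>r x. \<chi> j. r ^ k j * x $ j)"
  assumes der: "\<And>a x. (m a has_derivative D a x) (at x)"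
    and cont: "\<And>v. continuous_on UNIV (\<lambda>(a, x). D a x v)"
    and m0: "\<And>x. m 0 x = x"
    and dil: "\<And>r a x. 0 < r \<Longrightarrow> \<delta> r (m a x) = m (\<delta> r a) (\<delta> r x)"
    and k: "\<And>j. 1 \<le> k j"
  shows "det (matrix (D a x)) = 1"
proof -
  define J where "J z = det (matrix (D (fst z) (snd z)))" for z
  have linD: "linear (D a x)" for a x using der has_derivative_linear by blast
  have lin\<delta>: "bounded_linear (\<delta> r)" for r
    unfolding \<delta>_def
    by (intro linear_conv_bounded_linear[THEN iffD1] linearI) (simp_all add: vec_eq_iff algebra_simps)
  have contJ: "continuous_on UNIV J"
  proof -
    have "continuous_on UNIV (\<lambda>z. D (fst z) (snd z) (axis j 1) $ i)" for i j
      using cont[of "axis j 1"] by (intro continuous_intros) (simp add: case_prod_beta)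
    then show ?thesis
      unfolding J_def det_def matrix_def vec_lambda_beta
      by (intro continuous_on_sum continuous_on_mult continuous_on_const continuous_on_prod)
  qed
  have J\<delta>: "J (\<delta> r a, \<delta> r x) = J (a, x)" if "0 < r" for r a x
  proof -
    \<comment> \<open>The chain rule is applied to both sides of the identity expressing that
      dilations are automorphisms. The determinant of the dilation then stands on both sides and
      cancels, being a product of powers of r.\<close>
    have "(\<delta> r \<circ> m a has_derivative \<delta> r \<circ> D a x) (at x)"
      by (rule diff_chain_at[OF der bounded_linear_imp_has_derivative[OF lin\<delta>]])
    moreover have "(m (\<delta> r a) \<circ> \<delta> r has_derivative D (\<delta> r a) (\<delta> r x) \<circ> \<delta> r) (at x)"
      by (rule diff_chain_at[OF bounded_linear_imp_has_derivative[OF lin\<delta>] der])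
    moreover have "\<delta> r \<circ> m a = m (\<delta> r a) \<circ> \<delta> r" using dil[OF that] by auto
    ultimately have "\<delta> r \<circ> D a x = D (\<delta> r a) (\<delta> r x) \<circ> \<delta> r"
      by (metis has_derivative_unique)
    then have "det (matrix (\<delta> r)) * J (a, x) = J (\<delta> r a, \<delta> r x) * det (matrix (\<delta> r))"
      unfolding J_def using linD lin\<delta>
      by (metis fst_conv snd_conv det_mul matrix_compose bounded_linear.linear)
    moreover have "det (matrix (\<delta> r)) \<noteq> 0"
    proof -
      have "det (matrix (\<delta> r)) = (\<Prod>i\<in>UNIV. matrix (\<delta> r) $ i $ i)"
        by (intro det_diagonal) (auto simp: matrix_def \<delta>_def axis_def)
      then show ?thesis using that by (simp add: matrix_def \<delta>_def axis_def)
    qed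
    ultimately show ?thesis by simp
  qed
  have lim: "(\<lambda>i. (\<delta> (inverse (real (Suc i))) a, \<delta> (inverse (real (Suc i))) x)) \<longlonglongrightarrow> (0, 0)"
    unfolding \<delta>_def by (intro tendsto_Pair dilation_tendsto_0 k)
  have "(\<lambda>i. J (\<delta> (inverse (real (Suc i))) a, \<delta> (inverse (real (Suc i))) x)) \<longlonglongrightarrow> J (0, 0)"
    using contJ lim by (auto simp: continuous_on_eq_continuous_at isCont_def intro: isCont_tendsto_compose)
  then have "(\<lambda>i. J (a, x)) \<longlonglongrightarrow> J (0, 0)" by (simp add: J\<delta>)
  then have "J (a, x) = J (0, 0)" by (rule LIMSEQ_unique[OF tendsto_const])
  moreover have "D 0 0 = id"
    using has_derivative_unique[OF der[of 0 0]] m0 by (metis eq_id_iff has_derivative_id)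
  ultimately show ?thesis by (simp add: J_def matrix_id_mat_1)
qed

text \<open>Everything is transported along the relabelling \<Phi> of coordinates to the
  well-ordered index type, under which the two Lebesgue measures correspond. There determinant one
  makes the translation measure preserving, its inverse being the translation by the inverse
  element.\<close>

lemma left_translation_distr_lborel:
  fixes m :: "real^'n::finite \<Rightarrow> real^'n \<Rightarrow> real^'n" and k :: "'n \<Rightarrow> nat"
  defines "\<delta> \<equiv> (\<lambda>r x. \<chi> j. r ^ k j * x $ j)"
  assumes der: "\<And>a x. (m a has_derivative D a x) (at x)"
    and cont: "\<And>v. continuous_on UNIV (\<lambda>(a, x). D a x v)"
    and m0: "\<And>x. m 0 x = x"
    and inv: "\<And>a x. m (i a) (m a x) = x" "\<And>a x. m a (m (i a) x) = x"
    and dil: "\<And>r a x. 0 < r \<Longrightarrow> \<delta> r (m a x) = m (\<delta> r a) (\<delta> r x)"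
    and k: "\<And>j. 1 \<le> k j"
  shows "distr lborel borel (m a) = lborel"
proof -
  define \<Phi> :: "real^'n \<Rightarrow> real^'n wo" where "\<Phi> = reindex Rep_wo"
  define \<Psi> :: "real^'n wo \<Rightarrow> real^'n" where "\<Psi> = reindex Abs_wo"
  have bij: "bij (Rep_wo :: 'n wo \<Rightarrow> 'n)" "bij (Abs_wo :: 'n \<Rightarrow> 'n wo)"
    by (rule bij_betwI[of _ _ _ Abs_wo]; simp add: Rep_wo_inverse Abs_wo_inverse)
       (rule bij_betwI[of _ _ _ Rep_wo]; simp add: Rep_wo_inverse Abs_wo_inverse)
  have [simp]: "\<Phi> (\<Psi> y) = y" "\<Psi> (\<Phi> x) = x" for x y
    by (simp_all add: \<Phi>_def \<Psi>_def reindex_def vec_eq_iff Rep_wo_inverse Abs_wo_inverse)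
  have bl: "bounded_linear \<Phi>" "bounded_linear \<Psi>"
    unfolding \<Phi>_def \<Psi>_def by (rule bounded_linear_reindex)+
  have d: "distr lborel borel \<Phi> = lborel" "distr lborel borel \<Psi> = lborel"
    unfolding \<Phi>_def \<Psi>_def by (rule distr_lborel_reindex[OF bij(1)] distr_lborel_reindex[OF bij(2)])+
  define m' where "m' a x = \<Phi> (m (\<Psi> a) (\<Psi> x))" for a x
  define D' where "D' a x v = \<Phi> (D (\<Psi> a) (\<Psi> x) (\<Psi> v))" for a x v
  define k' where "k' j = k (Rep_wo j)" for j
  have der': "(m' a has_derivative D' a x) (at x)" for a x
    unfolding m'_def[abs_def] D'_def[abs_def]
    by (rule has_derivative_compose[OF has_derivative_compose[OF
          bounded_linear_imp_has_derivative[OF bl(2)] der] bounded_linear_imp_has_derivative[OF bl(1)]])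
  have det: "det (matrix (D' a x)) = 1" for a x
  proof (rule left_translation_det_1[where m = m' and k = k'])
    show "continuous_on UNIV (\<lambda>(a, x). D' a x v)" for v
    proof -
      have "continuous_on UNIV (\<lambda>z. (\<Psi> (fst z), \<Psi> (snd z)))"
        by (intro continuous_on_Pair bounded_linear.continuous_on[OF bl(2)] continuous_on_fst
            continuous_on_snd continuous_on_id)
      then have "continuous_on UNIV (\<lambda>z. (\<lambda>(a, x). D a x (\<Psi> v)) (\<Psi> (fst z), \<Psi> (snd z)))"
        by (rule continuous_on_compose2[OF cont]) simp
      then have "continuous_on UNIV (\<lambda>z. \<Phi> (D (\<Psi> (fst z)) (\<Psi> (snd z)) (\<Psi> v)))"
        by (intro bounded_linear.continuous_on[OF bl(1)]) simp
      then show ?thesis by (simp add: D'_def case_prod_beta)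
    qed
    show "m' 0 x = x" for x
      using bl by (simp add: m'_def linear_0[OF bounded_linear.linear[OF bl(2)]] m0)
    fix r :: real and a x assume "0 < r"
    have \<delta>\<Psi>: "\<Psi> (\<chi> j. r ^ k' j * x $ j) = \<delta> r (\<Psi> x)" for x
      by (simp add: \<Psi>_def \<delta>_def reindex_def k'_def vec_eq_iff Abs_wo_inverse)
    have \<delta>\<Phi>: "\<Phi> (\<delta> r x) = (\<chi> j. r ^ k' j * \<Phi> x $ j)" for x
      by (simp add: \<Phi>_def \<delta>_def reindex_def k'_def vec_eq_iff)
    show "(\<chi> j. r ^ k' j * m' a x $ j) = m' (\<chi> j. r ^ k' j * a $ j) (\<chi> j. r ^ k' j * x $ j)"
      unfolding m'_def \<delta>\<Psi> dil[OF \<open>0 < r\<close>, symmetric] \<delta>\<Phi> ..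
  qed (use der' k in \<open>auto simp: k'_def\<close>)
  have d': "distr lborel borel (m' a) = lborel" for a
    by (rule lborel_eq_distr_volume_preserving[where g = "m' (\<Phi> (i (\<Psi> a)))", OF der' der'])
       (simp_all add: det, simp_all add: m'_def inv)
  have meas: "\<Phi> \<in> borel_measurable borel" "\<Psi> \<in> borel_measurable borel"
    by (intro borel_measurable_continuous_onI bounded_linear.continuous_on[OF bl(1)]
        bounded_linear.continuous_on[OF bl(2)] continuous_on_id)+
  have meas': "m' a \<in> borel_measurable borel" for a
    using der' by (intro borel_measurable_continuous_onI continuous_at_imp_continuous_on)
      (auto intro: has_derivative_continuous)
  have "m a = \<Psi> \<circ> (m' (\<Phi> a) \<circ> \<Phi>)" by (auto simp: m'_def)
  then have "distr lborel borel (m a) = distr (distr (distr lborel borel \<Phi>) borel (m' (\<Phi> a))) borel \<Psi>"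
    using meas meas' by (simp add: distr_distr)
  then show ?thesis by (simp add: d d')
qed

section \<open>Homogeneous quasi-norms\<close>

lemma emeasure_lborel_open_nonempty:
  fixes S :: "'a::euclidean_space set"
  assumes "open S" "S \<noteq> {}"
  shows "emeasure lborel S \<noteq> 0"
proof
  assume "emeasure lborel S = 0"
  then have "S \<in> null_sets lborel" using assms by auto
  then have "negligible S" by (simp add: negligible_iff_null_sets null_sets_completionI)
  then show False using open_not_negligible assms by blast
qed

locale quasi_normed_group =
  fixes G :: "'n::finite stratified" and N :: "real^'n \<Rightarrow> real"
  assumes stratified: "stratified_Lie_group G" and quasi_norm: "homogeneous_quasi_norm G N"
begin

abbreviation (input) Q :: real where "Q \<equiv> real (homogeneous_dim G)"

section \<open>Group laws and left translations\<close>

lemma group_G: "Groups.group (mul G) 0 (inv_el G)"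
  using stratified by (simp add: stratified_Lie_group_def)

lemma mul_assoc: "mul G (mul G x y) z = mul G x (mul G y z)"
  using group_G by (simp add: group_def semigroup_def)

lemma mul_left_inv [simp]: "mul G (inv_el G x) x = 0"
  using group_G by (simp add: group_def group_axioms_def)

lemma mul_left_0 [simp]: "mul G 0 x = x"
  using group_G by (simp add: group_def group_axioms_def)

lemma mul_right_inv [simp]: "mul G x (inv_el G x) = 0"
  using group.right_inverse[OF group_G] .

lemma mul_right_0 [simp]: "mul G x 0 = x"
  by (metis mul_assoc mul_left_inv mul_right_inv mul_left_0)

lemma mul_inv_mul [simp]: "mul G (inv_el G a) (mul G a x) = x" "mul G a (mul G (inv_el G a) x) = x"
  by (simp_all flip: mul_assoc)

lemma inv_eqI: "mul G a b = 0 \<Longrightarrow> inv_el G a = b"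
  by (metis mul_inv_mul(1) mul_right_0)

lemma inv_mul_inv: "inv_el G (mul G (inv_el G y) x) = mul G (inv_el G x) y"
  by (rule inv_eqI) (simp add: mul_assoc)

lemma layer_ge_1: "1 \<le> layer G j"
  using stratified unfolding stratified_Lie_group_def image_subset_iff by (meson UNIV_I atLeastAtMost_iff)

lemma layer_le_step: "layer G j \<le> step G"
  using stratified unfolding stratified_Lie_group_def image_subset_iff by (meson UNIV_I atLeastAtMost_iff)

lemma dilation_mul: "0 < r \<Longrightarrow> dilation G r (mul G x y) = mul G (dilation G r x) (dilation G r y)"
  using stratified by (simp add: stratified_Lie_group_def)

lemma smooth_mul: "smooth (\<lambda>(x, y). mul G x y)"
  using stratified by (simp add: stratified_Lie_group_def)

lemma continuous_on_mul: "continuous_on UNIV (\<lambda>(x, y). mul G x y)"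
  using smooth_mul by (rule smooth_imp_continuous_on)

lemma continuous_on_inv: "continuous_on UNIV (inv_el G)"
  using stratified by (intro smooth_imp_continuous_on) (simp add: stratified_Lie_group_def)

text \<open>The partial derivative in the second argument, read off from the total derivative of the
  multiplication. This form makes it jointly continuous in a and x, as the limit under dilations
  requires.\<close>

definition mul_deriv :: "real^'n \<Rightarrow> real^'n \<Rightarrow> real^'n \<Rightarrow> real^'n" where
  "mul_deriv a x v = frechet_derivative (\<lambda>(x, y). mul G x y) (at (a, x)) (0, v)"

lemma has_derivative_mul: "(mul G a has_derivative mul_deriv a x) (at x)"
proof -
  have "((\<lambda>(x, y). mul G x y) \<circ> Pair a has_derivative
      frechet_derivative (\<lambda>(x, y). mul G x y) (at (a, x)) \<circ> (\<lambda>v. (0, v))) (at x)"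
    by (rule diff_chain_at[OF _ smooth_has_derivative[OF smooth_mul]])
       (auto intro!: derivative_eq_intros)
  then show ?thesis by (simp add: o_def mul_deriv_def[abs_def])
qed

lemma continuous_on_mul_deriv: "continuous_on UNIV (\<lambda>(a, x). mul_deriv a x v)"
  using smooth_imp_continuous_on[OF smooth_frechet_derivative[OF smooth_mul], of UNIV "(0, v)"]
  by (simp add: mul_deriv_def case_prod_beta)

lemma distr_mul: "distr lborel borel (mul G a) = lborel"
  by (rule left_translation_distr_lborel[where i = "inv_el G" and k = "layer G",
        OF has_derivative_mul continuous_on_mul_deriv])
     (use dilation_mul layer_ge_1 in \<open>auto simp: dilation_def\<close>)

lemma measurable_mul [measurable]: "mul G a \<in> borel_measurable borel"
  using has_derivative_mul
  by (intro borel_measurable_continuous_onI continuous_at_imp_continuous_on) (auto intro: has_derivative_continuous)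

lemma nn_integral_mul:
  assumes "f \<in> borel_measurable borel"
  shows "(\<integral>\<^sup>+y. f (mul G a y) \<partial>lborel) = (\<integral>\<^sup>+y. f y \<partial>lborel)"
  using nn_integral_distr[of "mul G a" lborel borel f] assms by (simp add: distr_mul)

section \<open>Dilations and the homogeneous dimension\<close>

lemma homogeneous_dim_eq: "homogeneous_dim G = (\<Sum>j\<in>UNIV. layer G j)"
proof -
  have "(\<Sum>j\<in>UNIV. layer G j) = (\<Sum>i\<in>{1..step G}. \<Sum>j | j \<in> UNIV \<and> layer G j = i. layer G j)"
    using layer_ge_1 layer_le_step by (intro sum.group[symmetric]) auto
  also have "\<dots> = homogeneous_dim G"
    unfolding homogeneous_dim_def by (intro sum.cong refl) (simp add: mult.commute)
  finally show ?thesis by simp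
qed

lemma bounded_linear_dilation: "bounded_linear (dilation G r)"
  unfolding dilation_def
  by (intro linear_conv_bounded_linear[THEN iffD1] linearI) (simp_all add: vec_eq_iff algebra_simps)

lemma continuous_on_dilation: "continuous_on S (dilation G r)"
  using bounded_linear_dilation by (rule linear_continuous_on)

lemma dilation_dilation: "dilation G r (dilation G t x) = dilation G (r * t) x"
  by (simp add: dilation_def power_mult_distrib mult_ac)

lemma dilation_1 [simp]: "dilation G 1 x = x"
  by (simp add: dilation_def)

text \<open>The side of a box in direction j scales by the power of r given by the layer of j, and
  the layers of all coordinates add up to the homogeneous dimension.\<close>

lemma distr_dilation:
  assumes "0 < r"
  shows "lborel = density (distr lborel borel (dilation G r)) (\<lambda>_. ennreal (r ^ homogeneous_dim G))"
proof (rule lborel_vec_eqI)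
  fix l u :: "real^'n" assume le: "\<And>i. l $ i \<le> u $ i"
  have [measurable]: "dilation G r \<in> borel_measurable borel"
    using continuous_on_dilation by (intro borel_measurable_continuous_onI)
  have "dilation G r -` box l u = box (dilation G (1 / r) l) (dilation G (1 / r) u)"
    using assms by (auto simp: dilation_def mem_box_cart power_one_over field_simps)
  then have "emeasure (distr lborel borel (dilation G r)) (box l u)
      = emeasure lborel (box (dilation G (1 / r) l) (dilation G (1 / r) u))"
    by (simp add: emeasure_distr)
  also have "\<dots> = ennreal (\<Prod>i\<in>UNIV. (1 / r) ^ layer G i * (u $ i - l $ i))"
    using le assms by (subst emeasure_lborel_box_vec)
      (auto simp: dilation_def algebra_simps intro!: mult_left_mono)
  finally have "emeasure (density (distr lborel borel (dilation G r)) (\<lambda>_. ennreal (r ^ homogeneous_dim G))) (box l u)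
      = ennreal (r ^ homogeneous_dim G) * ennreal (\<Prod>i\<in>UNIV. (1 / r) ^ layer G i * (u $ i - l $ i))"
    by (simp add: emeasure_density_const)
  also have "\<dots> = ennreal (r ^ homogeneous_dim G * (\<Prod>i\<in>UNIV. (1 / r) ^ layer G i * (u $ i - l $ i)))"
    using assms by (simp add: ennreal_mult')
  also have "r ^ homogeneous_dim G * (\<Prod>i\<in>UNIV. (1 / r) ^ layer G i * (u $ i - l $ i))
      = (\<Prod>i\<in>UNIV. u $ i - l $ i)"
    using assms by (simp add: homogeneous_dim_eq prod.distrib power_one_over prod_dividef flip: power_sum)
  finally show "emeasure (density (distr lborel borel (dilation G r)) (\<lambda>_. ennreal (r ^ homogeneous_dim G))) (box l u)
      = ennreal (\<Prod>i\<in>UNIV. u $ i - l $ i)" .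
qed simp

lemma nn_integral_dilation:
  assumes "0 < r" and [measurable]: "f \<in> borel_measurable borel"
  shows "(\<integral>\<^sup>+x. f x \<partial>lborel) = ennreal (r powr Q) * (\<integral>\<^sup>+x. f (dilation G r x) \<partial>lborel)"
proof -
  have [measurable]: "dilation G r \<in> borel_measurable borel"
    using continuous_on_dilation by (intro borel_measurable_continuous_onI)
  have "(\<integral>\<^sup>+x. f x \<partial>lborel) = (\<integral>\<^sup>+x. f x \<partial>density (distr lborel borel (dilation G r)) (\<lambda>_. ennreal (r ^ homogeneous_dim G)))"
    using distr_dilation[OF assms(1)] by simp
  also have "\<dots> = ennreal (r ^ homogeneous_dim G) * (\<integral>\<^sup>+x. f (dilation G r x) \<partial>lborel)"
    by (simp add: nn_integral_density nn_integral_cmult nn_integral_distr)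
  finally show ?thesis using assms by (simp add: powr_realpow)
qed

section \<open>The quasi-norm and the volumes of its balls\<close>

lemma continuous_on_N: "continuous_on S N"
  using quasi_norm continuous_on_subset by (auto simp: homogeneous_quasi_norm_def)

lemma measurable_N [measurable]: "N \<in> borel_measurable borel"
  by (intro borel_measurable_continuous_onI continuous_on_N)

lemma N_nonneg [simp]: "0 \<le> N x"
  using quasi_norm by (simp add: homogeneous_quasi_norm_def)

lemma N_eq_0_iff [simp]: "N x = 0 \<longleftrightarrow> x = 0"
  using quasi_norm by (simp add: homogeneous_quasi_norm_def)

lemma N_0 [simp]: "N 0 = 0"
  by simp

lemma N_pos_iff [simp]: "0 < N x \<longleftrightarrow> x \<noteq> 0"
  using N_nonneg[of x] N_eq_0_iff[of x] by linarith

lemma N_dilation: "0 < r \<Longrightarrow> N (dilation G r x) = r * N x"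
  using quasi_norm by (simp add: homogeneous_quasi_norm_def)

lemma N_inv: "N (inv_el G x) = N x"
  using quasi_norm by (simp add: homogeneous_quasi_norm_def)

lemma N_commute: "N (mul G (inv_el G y) x) = N (mul G (inv_el G x) y)"
  using N_inv[of "mul G (inv_el G y) x"] by (simp add: inv_mul_inv)

lemma dilation_norm_le:
  assumes "0 \<le> r" "r \<le> 1"
  shows "norm (dilation G r x) \<le> r * (CARD('n) * norm x)"
proof -
  have "norm (dilation G r x) \<le> (\<Sum>j\<in>UNIV. \<bar>dilation G r x $ j\<bar>)" by (rule norm_le_l1_cart)
  also have "\<dots> \<le> (\<Sum>j\<in>(UNIV :: 'n set). r * norm x)"
  proof (rule sum_mono)
    fix j
    have "r ^ layer G j \<le> r ^ 1" using layer_ge_1[of j] assms by (intro power_decreasing) auto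
    then show "\<bar>dilation G r x $ j\<bar> \<le> r * norm x"
      using assms component_le_norm_cart[of x j] by (auto simp: dilation_def abs_mult intro!: mult_mono)
  qed
  finally show ?thesis by (simp add: mult_ac)
qed

text \<open>The quasi-norm has a positive minimum on the Euclidean unit sphere. A point outside the
  unit ball reaches the sphere after a contraction by some r, and the bound on its quasi-norm keeps
  r away from zero; undoing the contraction bounds the coordinates.\<close>

lemma bounded_N_le: "bounded {x. N x \<le> R}"
proof -
  have "sphere (0 :: real^'n) 1 \<noteq> {}" by (simp add: sphere_empty)
  then obtain z where z: "norm z = 1" "\<And>y. norm y = 1 \<Longrightarrow> N z \<le> N y"
    using continuous_attains_inf[OF compact_sphere _ continuous_on_N, of "0 :: real^'n" 1] by auto
  have "0 < N z" using z by auto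
  \<comment> \<open>The maximum with 1 allows every power \<open>c ^ layer G j\<close> to be raised
    to \<open>c ^ step G\<close>.\<close>
  define c where "c = max 1 (R / N z)"
  have "norm x \<le> CARD('n) * c ^ step G" if x: "N x \<le> R" for x
  proof (cases "norm x \<le> 1")
    case True
    have "1 \<le> real CARD('n)" by (simp add: Suc_leI)
    moreover have "1 \<le> c ^ step G" by (intro one_le_power) (simp add: c_def)
    ultimately have "1 * 1 \<le> CARD('n) * c ^ step G" by (intro mult_mono) auto
    then show ?thesis using True by simp
  next
    case False
    have "continuous_on {0..1} (\<lambda>r. norm (dilation G r x))"
      unfolding dilation_def by (intro continuous_intros)
    moreover have "dilation G 0 x = 0"
      by (simp add: dilation_def vec_eq_iff power_0_left) (metis layer_ge_1 not_one_le_zero)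
    \<comment> \<open>The curve of dilates of x runs from 0 to x, so its Euclidean norm takes the
      value one.\<close>
    ultimately obtain r where r: "0 \<le> r" "r \<le> 1" "norm (dilation G r x) = 1"
      using IVT'[of "\<lambda>r. norm (dilation G r x)" 0 1 1] False by auto
    have "r \<noteq> 0" using r \<open>dilation G 0 x = 0\<close> by auto
    then have "0 < r" using r by simp
    have "N z \<le> r * N x" using z(2)[OF r(3)] N_dilation[OF \<open>0 < r\<close>] by simp
    also have "\<dots> \<le> r * R" using x r by (intro mult_left_mono) auto
    finally have "1 / r \<le> R / N z" using \<open>0 < r\<close> \<open>0 < N z\<close> by (simp add: field_simps)
    then have rc: "1 / r \<le> c" by (simp add: c_def)
    have "1 \<le> c" by (simp add: c_def)
    have comp: "\<bar>x $ j\<bar> \<le> c ^ step G" for j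
    proof -
      have "x = dilation G (1 / r) (dilation G r x)"
        using \<open>0 < r\<close> by (simp add: dilation_dilation)
      then have "\<bar>x $ j\<bar> = (1 / r) ^ layer G j * \<bar>dilation G r x $ j\<bar>"
        using \<open>0 < r\<close> by (metis (no_types, lifting) abs_mult abs_of_nonneg dilation_def vec_lambda_beta
            zero_le_divide_1_iff less_imp_le zero_le_power)
      also have "\<dots> \<le> c ^ layer G j * 1"
        using rc \<open>0 < r\<close> component_le_norm_cart[of "dilation G r x" j] r
          \<open>1 \<le> c\<close> by (intro mult_mono power_mono) auto
      also have "\<dots> \<le> c ^ step G"
        using layer_le_step[of j] \<open>1 \<le> c\<close> by (simp add: power_increasing)
      finally show ?thesis .
    qed
    have "norm x \<le> (\<Sum>j\<in>UNIV. \<bar>x $ j\<bar>)" by (rule norm_le_l1_cart)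
    also have "\<dots> \<le> (\<Sum>j\<in>(UNIV :: 'n set). c ^ step G)" by (intro sum_mono comp)
    finally show ?thesis by simp
  qed
  then show ?thesis unfolding bounded_iff by blast
qed

text \<open>All dilation exponents are at least one, so contracting a point of quasi-norm one by the
  factor N h \<le> 1 shrinks its Euclidean norm at least linearly. This turns Euclidean derivative
  bounds into Lipschitz bounds in the quasi-norm.\<close>

lemma norm_le_N:
  obtains C where "0 < C" "\<And>h. N h \<le> 1 \<Longrightarrow> norm h \<le> C * N h"
proof -
  obtain M where M: "0 < M" "\<And>x. N x \<le> 1 \<Longrightarrow> norm x \<le> M"
    using bounded_N_le[of 1] unfolding bounded_pos by auto
  have "norm h \<le> (CARD('n) * M) * N h" if h: "N h \<le> 1" for h
  proof (cases "h = 0")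
    case False
    define y where "y = dilation G (1 / N h) h"
    have "0 < N h" using False by simp
    have h_eq: "h = dilation G (N h) y" using \<open>0 < N h\<close> by (simp add: y_def dilation_dilation)
    have "N y = 1" using \<open>0 < N h\<close> by (simp add: y_def N_dilation)
    have "norm h \<le> N h * (CARD('n) * norm y)"
      using dilation_norm_le[of "N h" y] h h_eq by simp
    also have "\<dots> \<le> N h * (CARD('n) * M)"
      using M(2)[of y] \<open>N y = 1\<close> by (intro mult_left_mono) auto
    finally show ?thesis by (simp add: mult_ac)
  qed simp
  then show ?thesis using that[of "CARD('n) * M"] M by simp
qed

definition unit_ball_volume :: real where
  "unit_ball_volume = measure lborel {x. N x < 1}"

lemma open_N_less: "open {x. N x < r}"
  by (intro open_Collect_less continuous_on_N continuous_on_const)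

lemma N_less_sets [measurable]: "{x. N x < r} \<in> sets borel"
  by (intro borel_open open_N_less)

lemma emeasure_N_less_finite: "emeasure lborel {x. N x < r} < \<infinity>"
  by (rule emeasure_bounded_finite) (rule bounded_subset[OF bounded_N_le[of r]], auto)

lemma unit_ball_volume_pos: "0 < unit_ball_volume"
proof -
  have "0 \<in> {x. N x < 1}" by simp
  then have "{x. N x < 1} \<noteq> {}" by blast
  then have "emeasure lborel {x. N x < 1} \<noteq> 0"
    by (rule emeasure_lborel_open_nonempty[OF open_N_less])
  then show ?thesis
    using emeasure_N_less_finite[of 1] unfolding unit_ball_volume_def
    by (simp add: emeasure_eq_ennreal_measure zero_less_measure_iff less_top)
qed

lemma emeasure_N_less:
  assumes "0 < r"
  shows "emeasure lborel {x. N x < r} = ennreal (r powr Q * unit_ball_volume)"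
proof -
  have "emeasure lborel {x. N x < r} = (\<integral>\<^sup>+x. indicator {x. N x < r} x \<partial>lborel)" by simp
  also have "\<dots> = ennreal (r powr Q) * (\<integral>\<^sup>+x. indicator {x. N x < r} (dilation G r x) \<partial>lborel)"
    by (rule nn_integral_dilation[OF assms]) measurable
  also have "(\<integral>\<^sup>+x. indicator {x. N x < r} (dilation G r x) \<partial>lborel) = (\<integral>\<^sup>+x. indicator {x. N x < 1} x \<partial>lborel)"
    using assms by (intro nn_integral_cong) (auto simp: indicator_def N_dilation)
  also have "\<dots> = emeasure lborel {x. N x < 1}" by simp
  also have "\<dots> = ennreal unit_ball_volume"
    using emeasure_N_less_finite[of 1] by (simp add: unit_ball_volume_def emeasure_eq_ennreal_measure less_top)
  finally show ?thesis using unit_ball_volume_pos by (simp add: ennreal_mult')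
qed

section \<open>Integrals of powers of the quasi-norm\<close>

lemma nn_integral_N_powr_annulus:
  assumes "0 < r"
  shows "(\<integral>\<^sup>+h. ennreal (N h powr a) * indicator {h. r \<le> N h \<and> N h < 2 * r} h \<partial>lborel)
     \<le> ennreal (r powr (Q + a) * (max 1 (2 powr a) * (2 powr Q * unit_ball_volume)))"
proof -
  have "(\<integral>\<^sup>+h. ennreal (N h powr a) * indicator {h. r \<le> N h \<and> N h < 2 * r} h \<partial>lborel)
      \<le> (\<integral>\<^sup>+h. ennreal (r powr a * max 1 (2 powr a)) * indicator {h. N h < 2 * r} h \<partial>lborel)"
  proof (rule nn_integral_mono)
    fix h
    show "ennreal (N h powr a) * indicator {h. r \<le> N h \<and> N h < 2 * r} h
        \<le> ennreal (r powr a * max 1 (2 powr a)) * indicator {h. N h < 2 * r} h"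
    proof (cases "r \<le> N h \<and> N h < 2 * r")
      case True
      \<comment> \<open>The maximum covers both signs of a: the power is largest at the outer radius
        for nonnegative a and at the inner radius otherwise.\<close>
      have "N h powr a \<le> r powr a * max 1 (2 powr a)"
      proof (cases "0 \<le> a")
        case True
        then have "N h powr a \<le> (2 * r) powr a"
          using \<open>r \<le> N h \<and> N h < 2 * r\<close> by (intro powr_mono2) auto
        also have "\<dots> \<le> r powr a * max 1 (2 powr a)"
          using assms by (simp add: powr_mult mult.commute mult_left_mono)
        finally show ?thesis .
      next
        case False
        then have "N h powr a \<le> r powr a"
          using \<open>r \<le> N h \<and> N h < 2 * r\<close> assms by (intro powr_mono2') auto
        also have "\<dots> \<le> r powr a * max 1 (2 powr a)"
          using mult_left_mono[of 1 "max 1 (2 powr a)" "r powr a"] by simp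
        finally show ?thesis .
      qed
      then show ?thesis using True by (simp add: ennreal_leI)
    qed simp
  qed
  also have "\<dots> = ennreal (r powr a * max 1 (2 powr a)) * emeasure lborel {h. N h < 2 * r}"
    by (rule nn_integral_cmult_indicator) simp
  also have "\<dots> = ennreal (r powr (Q + a) * (max 1 (2 powr a) * (2 powr Q * unit_ball_volume)))"
    using assms by (simp add: emeasure_N_less powr_mult powr_add mult_ac flip: ennreal_mult')
  finally show ?thesis .
qed

text \<open>The annulus of radius q^j contributes at most a constant times the j-th power of
  q^(Q+a), which leaves a geometric series. The base q is 2 for integrals at infinity and 1/2 for
  integrals near the identity.\<close>

lemma nn_integral_N_powr_annuli:
  assumes "0 < q" "q powr (Q + a) < 1" and [measurable]: "S \<in> sets borel"
    and cover: "\<And>h. h \<in> S \<Longrightarrow> \<exists>j. q ^ j \<le> N h \<and> N h < 2 * q ^ j"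
  shows "(\<integral>\<^sup>+h. ennreal (N h powr a) * indicator S h \<partial>lborel) < \<infinity>"
proof -
  define K where "K = max 1 (2 powr a) * (2 powr Q * unit_ball_volume)"
  have "0 \<le> K" using unit_ball_volume_pos by (simp add: K_def)
  let ?A = "\<lambda>j. {h. q ^ j \<le> N h \<and> N h < 2 * q ^ j}"
  have "(\<integral>\<^sup>+h. ennreal (N h powr a) * indicator S h \<partial>lborel)
      \<le> (\<integral>\<^sup>+h. (\<Sum>j. ennreal (N h powr a) * indicator (?A j) h) \<partial>lborel)"
  proof (rule nn_integral_mono)
    fix h
    show "ennreal (N h powr a) * indicator S h \<le> (\<Sum>j. ennreal (N h powr a) * indicator (?A j) h)"
    proof (cases "h \<in> S")
      case True
      then obtain j where "h \<in> ?A j" using cover by blast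
      then have "ennreal (N h powr a) * indicator S h = (\<Sum>j\<in>{j}. ennreal (N h powr a) * indicator (?A j) h)"
        using True by simp
      also have "\<dots> \<le> (\<Sum>j. ennreal (N h powr a) * indicator (?A j) h)"
        by (rule sum_le_suminf) (auto intro: summableI)
      finally show ?thesis .
    qed simp
  qed
  also have "\<dots> = (\<Sum>j. \<integral>\<^sup>+h. ennreal (N h powr a) * indicator (?A j) h \<partial>lborel)"
    by (rule nn_integral_suminf) measurable
  also have "\<dots> \<le> (\<Sum>j. ennreal ((q powr (Q + a)) ^ j * K))"
  proof (intro suminf_le summableI)
    fix j
    have "(q ^ j) powr (Q + a) = (q powr (Q + a)) ^ j"
      using assms by (simp add: powr_realpow[symmetric] powr_powr mult.commute)
    then show "(\<integral>\<^sup>+h. ennreal (N h powr a) * indicator (?A j) h \<partial>lborel) \<le> ennreal ((q powr (Q + a)) ^ j * K)"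
      using nn_integral_N_powr_annulus[of "q ^ j" a] assms by (simp add: K_def)
  qed
  also have "\<dots> = ennreal (\<Sum>j. (q powr (Q + a)) ^ j * K)"
    using assms \<open>0 \<le> K\<close> by (intro suminf_ennreal2 summable_mult2 summable_geometric) auto
  finally show ?thesis by (simp add: le_less_trans)
qed

lemma nn_integral_N_powr_large:
  assumes "Q + a < 0"
  shows "(\<integral>\<^sup>+h. ennreal (N h powr a) * indicator {h. 1 \<le> N h} h \<partial>lborel) < \<infinity>"
proof (rule nn_integral_N_powr_annuli[where q = 2])
  show "2 powr (Q + a) < 1" using assms powr_less_cancel_iff[of 2 "Q + a" 0] by simp
  show "\<exists>j. 2 ^ j \<le> N h \<and> N h < 2 * 2 ^ j" if "h \<in> {h. 1 \<le> N h}" for h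
  proof -
    have "1 \<le> N h" using that by simp
    obtain n where "N h < 2 ^ n" using real_arch_pow[of 2 "N h"] by auto
    \<comment> \<open>The least power of two exceeding \<open>N h\<close> is not the zeroth one,
      since \<open>N h\<close> is at least 1; its predecessor indexes the annulus.\<close>
    define j where "j = (LEAST n. N h < 2 ^ n)"
    have "N h < 2 ^ j" unfolding j_def using \<open>N h < 2 ^ n\<close> by (rule LeastI)
    then obtain i where i: "j = Suc i" using \<open>1 \<le> N h\<close> by (cases j) auto
    have "\<not> N h < 2 ^ i" using not_less_Least[of i "\<lambda>n. N h < 2 ^ n"] i by (simp add: j_def)
    then show ?thesis using \<open>N h < 2 ^ j\<close> i by (intro exI[of _ i]) auto
  qed
qed auto

lemma nn_integral_N_powr_small:
  assumes "0 < Q + a"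
  shows "(\<integral>\<^sup>+h. ennreal (N h powr a) * indicator {h. 0 < N h \<and> N h < 1} h \<partial>lborel) < \<infinity>"
proof (rule nn_integral_N_powr_annuli[where q = "1/2"])
  show "(1/2) powr (Q + a) < 1"
    using assms powr_less_mono2[of "Q + a" "1/2" 1] by simp
  show "\<exists>j. (1/2) ^ j \<le> N h \<and> N h < 2 * (1/2) ^ j" if "h \<in> {h. 0 < N h \<and> N h < 1}" for h
  proof -
    have h: "0 < N h" "N h < 1" using that by auto
    obtain n where n: "(1/2) ^ n < N h" using real_arch_pow_inv[OF h(1), of "1/2"] by auto
    define j where "j = (LEAST n. (1/2) ^ n \<le> N h)"
    have j: "(1/2) ^ j \<le> N h" unfolding j_def by (rule LeastI[of _ n]) (use n in simp)
    then obtain i where i: "j = Suc i" using h by (cases j) auto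
    have "\<not> (1/2) ^ i \<le> N h" using not_less_Least[of i "\<lambda>n. (1/2) ^ n \<le> N h"] i by (simp add: j_def)
    then show ?thesis using j i by (intro exI[of _ j]) auto
  qed
qed auto

end

section \<open>The fractional energy\<close>

locale fractional_energy = quasi_normed_group G N
  for G :: "'n::finite stratified" and N :: "real^'n \<Rightarrow> real" +
  fixes s p :: real
  assumes s: "0 < s" "s < 1" and p: "1 < p" and Q_gt: "p * s < Q"
begin

lemma ps_pos: "0 < p * s" using s p by simp

lemma Q_pos: "0 < Q" using Q_gt ps_pos by linarith

abbreviation M2 :: "((real^'n) \<times> (real^'n)) measure" where
  "M2 \<equiv> lborel \<Otimes>\<^sub>M lborel"

text \<open>The kernel enters with the exponent 1/p so that \<open>quot\<close> is linear in u while
  its p-th power is the energy density. The energy thus becomes a p-th mean on the product space. On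
  the diagonal numerator and denominator both vanish, and the quotient is 0.\<close>

definition quot :: "(real^'n \<Rightarrow> real) \<Rightarrow> (real^'n) \<times> (real^'n) \<Rightarrow> real" where
  "quot u z = (u (fst z) - u (snd z)) / kernel G N s p (fst z) (snd z) powr (1 / p)"

abbreviation P :: "(real^'n \<Rightarrow> real) \<Rightarrow> real" where "P u \<equiv> Lp_int lborel p u"
abbreviation E :: "(real^'n \<Rightarrow> real) \<Rightarrow> real" where "E u \<equiv> Lp_int M2 p (quot u)"

lemma kernel_nonneg [simp]: "0 \<le> kernel G N s p x y"
  by (simp add: kernel_def)

lemma kernel_commute: "kernel G N s p x y = kernel G N s p y x"
  by (simp add: kernel_def N_commute[of y x])

lemma kernel_mul: "kernel G N s p x (mul G x h) = N h powr (Q + p * s)"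
  unfolding kernel_commute[of x] by (simp add: kernel_def)

lemma abs_quot_powr: "\<bar>quot u z\<bar> powr p = \<bar>u (fst z) - u (snd z)\<bar> powr p / kernel G N s p (fst z) (snd z)"
  using p by (simp add: quot_def powr_divide powr_powr)

lemma energy_eq: "energy G N s p u = E u"
  by (simp add: energy_def Lp_int_def abs_quot_powr case_prod_beta')

lemma quot_add: "quot (\<lambda>x. u x + v x) z = quot u z + quot v z"
  by (simp add: quot_def add_divide_distrib diff_divide_distrib)

lemma quot_diff: "quot (\<lambda>x. u x - v x) z = quot u z - quot v z"
  by (simp add: quot_def diff_divide_distrib)

lemma quot_cmult: "quot (\<lambda>x. c * u x) z = c * quot u z"
  by (simp add: quot_def algebra_simps diff_divide_distrib)

lemma continuous_on_inv_mul: "continuous_on UNIV (\<lambda>z. mul G (inv_el G (snd z)) (fst z))"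
proof -
  have "continuous_on UNIV (\<lambda>z. (inv_el G (snd z), fst z))"
    by (intro continuous_on_Pair continuous_on_compose2[OF continuous_on_inv] continuous_on_snd
        continuous_on_fst continuous_on_id) auto
  from continuous_on_compose2[OF continuous_on_mul this] show ?thesis by simp
qed

lemma measurable_kernel [measurable]:
  "(\<lambda>z. kernel G N s p (fst z) (snd z)) \<in> borel_measurable M2"
proof -
  have "(\<lambda>z. mul G (inv_el G (snd z)) (fst z)) \<in> borel_measurable M2"
    unfolding lborel_prod measurable_lborel2 using continuous_on_inv_mul
    by (rule borel_measurable_continuous_onI)
  then show ?thesis unfolding kernel_def by measurable
qed

lemma measurable_quot [measurable]:
  assumes [measurable]: "u \<in> borel_measurable borel"
  shows "quot u \<in> borel_measurable M2"
  unfolding quot_def by measurable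

definition finite_energy :: "(real^'n) set \<Rightarrow> (real^'n \<Rightarrow> real) set" where
  "finite_energy \<Omega> = {u. u \<in> Lp lborel p \<and> quot u \<in> Lp M2 p \<and> (\<forall>x. x \<notin> \<Omega> \<longrightarrow> u x = 0)}"

lemma finite_energyD:
  assumes "u \<in> finite_energy \<Omega>"
  shows "u \<in> Lp lborel p" "quot u \<in> Lp M2 p" "x \<notin> \<Omega> \<Longrightarrow> u x = 0" "u \<in> borel_measurable borel"
  using assms Lp_measurable[of u lborel p] by (auto simp: finite_energy_def)

lemma set_integral_zero_outside:
  fixes u :: "real^'n \<Rightarrow> real"
  assumes "\<And>x. x \<notin> \<Omega> \<Longrightarrow> u x = 0"
  shows "(LINT x:\<Omega>|lborel. \<bar>u x\<bar> powr p) = P u"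
    "set_integrable lborel \<Omega> (\<lambda>x. \<bar>u x\<bar> powr p) \<longleftrightarrow> integrable lborel (\<lambda>x. \<bar>u x\<bar> powr p)"
proof -
  have "indicator \<Omega> x *\<^sub>R \<bar>u x\<bar> powr p = \<bar>u x\<bar> powr p" for x
    using assms[of x] by (cases "x \<in> \<Omega>") auto
  then show "(LINT x:\<Omega>|lborel. \<bar>u x\<bar> powr p) = P u"
    "set_integrable lborel \<Omega> (\<lambda>x. \<bar>u x\<bar> powr p) \<longleftrightarrow> integrable lborel (\<lambda>x. \<bar>u x\<bar> powr p)"
    by (simp_all only: set_lebesgue_integral_def set_integrable_def Lp_int_def)
qed

lemma finite_norm_functions_eq: "finite_norm_functions G N s p \<Omega> = finite_energy \<Omega>"
proof -
  have "u \<in> finite_norm_functions G N s p \<Omega> \<longleftrightarrow> u \<in> finite_energy \<Omega>" for u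
  proof (cases "\<forall>x. x \<notin> \<Omega> \<longrightarrow> u x = 0")
    case True
    then have zero: "\<And>x. x \<notin> \<Omega> \<Longrightarrow> u x = 0" by blast
    show ?thesis
      using True measurable_quot[of u] set_integral_zero_outside(2)[OF zero]
      unfolding finite_norm_functions_def finite_energy_def
      by (auto simp: Lp_def abs_quot_powr case_prod_beta')
  qed (auto simp: finite_norm_functions_def finite_energy_def)
  then show ?thesis by blast
qed

lemma Lp_norm_zero_outside:
  fixes u :: "real^'n \<Rightarrow> real"
  assumes "\<And>x. x \<notin> \<Omega> \<Longrightarrow> u x = 0"
  shows "Lp_norm p \<Omega> u = P u powr (1 / p)"
  by (simp add: Lp_norm_def set_integral_zero_outside(1)[OF assms])

lemma finite_energy_lincomb:
  assumes "u \<in> finite_energy \<Omega>" "v \<in> finite_energy \<Omega>"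
  shows "(\<lambda>x. u x + c * v x) \<in> finite_energy \<Omega>"
  using assms p unfolding finite_energy_def quot_add[abs_def] quot_cmult
  by (auto intro!: Lp_add Lp_cmult simp: quot_add[abs_def] quot_cmult)

text \<open>A sum of two nonnegative roots is small exactly when both p-th powers are, so the norms
  can be traded for \<open>P\<close> and \<open>E\<close>, and the condition for all e for a
  sequence.\<close>

lemma X0_iff:
  "u \<in> X0 G N s p \<Omega> \<longleftrightarrow> u \<in> finite_energy \<Omega> \<and>
    (\<exists>f. (\<forall>n. f n \<in> test_functions \<Omega>) \<and>
       (\<lambda>n. P (\<lambda>x. u x - f n x)) \<longlonglongrightarrow> 0 \<and>
       (\<lambda>n. E (\<lambda>x. u x - f n x)) \<longlonglongrightarrow> 0)" (is "?L \<longleftrightarrow> ?R")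
proof
  have norms: "Lp_norm p \<Omega> (\<lambda>x. u x - f x) + Gagliardo_seminorm G N s p (\<lambda>x. u x - f x)
      = P (\<lambda>x. u x - f x) powr (1/p) + E (\<lambda>x. u x - f x) powr (1/p)"
    if "u \<in> finite_energy \<Omega>" "f \<in> test_functions \<Omega>" for f
    using that test_functions_zero_outside[of f \<Omega>] finite_energyD(3)[OF that(1)]
    by (simp add: Gagliardo_seminorm_def energy_eq Lp_norm_zero_outside[of \<Omega> "\<lambda>x. u x - f x"])
  {
    assume L: ?L
    then have u: "u \<in> finite_energy \<Omega>" by (simp add: X0_def finite_norm_functions_eq)
    define R where "R n f \<longleftrightarrow> f \<in> test_functions \<Omega> \<and> P (\<lambda>x. u x - f x) powr (1/p)
        + E (\<lambda>x. u x - f x) powr (1/p) < inverse (real (Suc n))" for n f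
    have "\<forall>n. \<exists>f. R n f"
    proof
      fix n
      have "0 < inverse (real (Suc n))" by simp
      then obtain f where "f \<in> test_functions \<Omega>"
        "Lp_norm p \<Omega> (\<lambda>x. u x - f x) + Gagliardo_seminorm G N s p (\<lambda>x. u x - f x) < inverse (real (Suc n))"
        using L unfolding X0_def by blast
      then show "\<exists>f. R n f" using norms[OF u] by (auto simp: R_def)
    qed
    from choice[OF this] obtain f where "\<forall>n. R n (f n)" by blast
    then have f: "\<And>n. f n \<in> test_functions \<Omega>"
      "\<And>n. P (\<lambda>x. u x - f n x) powr (1/p)
        + E (\<lambda>x. u x - f n x) powr (1/p) < inverse (real (Suc n))"
      by (simp_all only: R_def)
    have small: "a \<le> inverse (real (Suc n)) powr p"
      if "0 \<le> a" "a powr (1/p) < inverse (real (Suc n))" for a n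
    proof -
      have "(a powr (1/p)) powr p \<le> inverse (real (Suc n)) powr p"
        using that p by (intro powr_mono2) auto
      then show ?thesis using that p by (simp add: powr_powr)
    qed
    have lim: "(\<lambda>n. inverse (real (Suc n)) powr p) \<longlonglongrightarrow> 0"
      using p tendsto_powr'[OF LIMSEQ_inverse_real_of_nat tendsto_const[of p]] by simp
    have "(\<lambda>n. P (\<lambda>x. u x - f n x)) \<longlonglongrightarrow> 0"
    proof (rule tendsto_sandwich[OF _ _ tendsto_const lim])
      have "P (\<lambda>x. u x - f n x) powr (1/p) < inverse (real (Suc n))" for n
        using f(2)[of n] powr_ge_zero[of "E (\<lambda>x. u x - f n x)" "1/p"] by linarith
      then show "\<forall>\<^sub>F n in sequentially. P (\<lambda>x. u x - f n x) \<le> inverse (real (Suc n)) powr p"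
        by (intro always_eventually allI small) auto
    qed auto
    moreover have "(\<lambda>n. E (\<lambda>x. u x - f n x)) \<longlonglongrightarrow> 0"
    proof (rule tendsto_sandwich[OF _ _ tendsto_const lim])
      have "E (\<lambda>x. u x - f n x) powr (1/p) < inverse (real (Suc n))" for n
        using f(2)[of n] powr_ge_zero[of "P (\<lambda>x. u x - f n x)" "1/p"] by linarith
      then show "\<forall>\<^sub>F n in sequentially. E (\<lambda>x. u x - f n x) \<le> inverse (real (Suc n)) powr p"
        by (intro always_eventually allI small) auto
    qed auto
    ultimately show ?R using u f(1) by blast
  }
  assume R: ?R
  then obtain f where u: "u \<in> finite_energy \<Omega>" and f: "\<And>n. f n \<in> test_functions \<Omega>"
    and l1: "(\<lambda>n. P (\<lambda>x. u x - f n x)) \<longlonglongrightarrow> 0"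
    and l2: "(\<lambda>n. E (\<lambda>x. u x - f n x)) \<longlonglongrightarrow> 0" by blast
  have "(\<lambda>n. P (\<lambda>x. u x - f n x) powr (1/p)
      + E (\<lambda>x. u x - f n x) powr (1/p)) \<longlonglongrightarrow> 0 powr (1/p) + 0 powr (1/p)"
    using p by (intro tendsto_add tendsto_powr' l1 l2 tendsto_const) auto
  then have lim: "(\<lambda>n. P (\<lambda>x. u x - f n x) powr (1/p)
      + E (\<lambda>x. u x - f n x) powr (1/p)) \<longlonglongrightarrow> 0" by simp
  have "\<exists>f\<in>test_functions \<Omega>. Lp_norm p \<Omega> (\<lambda>x. u x - f x) + Gagliardo_seminorm G N s p (\<lambda>x. u x - f x) < e"
    if e: "0 < e" for e
  proof -
    obtain n where "P (\<lambda>x. u x - f n x) powr (1/p)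
      + E (\<lambda>x. u x - f n x) powr (1/p) < e"
      using order_tendstoD(2)[OF lim e] by (auto simp: eventually_sequentially)
    then show ?thesis using norms[OF u f[of n]] f[of n] by (intro bexI[of _ "f n"]) auto
  qed
  then show ?L using u by (simp add: X0_def finite_norm_functions_eq)
qed

section \<open>A Faber-Krahn inequality\<close>

text \<open>If the ball of radius R has volume 2 V, then R^(Q+ps) / V equals
  \<open>FK * V powr (p * s / Q)\<close>. This is the reciprocal of the bound \<open>c * V\<close>
  obtained in the proof of the inequality.\<close>

definition FK :: real where
  "FK = (2 / unit_ball_volume) powr (1 + p * s / Q)"

lemma FK_pos: "0 < FK"
  using unit_ball_volume_pos by (simp add: FK_def)

text \<open>Choose the radius so that the ball has twice the volume of the set A carrying u. Then for
  every x the ball around x contains a set of points y outside A with at least the volume of A, where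
  the difference u(x) - u(y) is just u(x).\<close>

lemma Faber_Krahn_nn:
  assumes A[measurable]: "A \<in> sets borel" and V: "emeasure lborel A \<le> ennreal V" "0 < V"
    and u[measurable]: "u \<in> borel_measurable borel" and zero: "\<And>x. x \<notin> A \<Longrightarrow> u x = 0"
  shows "(\<integral>\<^sup>+x. ennreal (\<bar>u x\<bar> powr p) \<partial>lborel)
     \<le> ennreal (FK * V powr (p * s / Q)) * (\<integral>\<^sup>+z. ennreal (\<bar>quot u z\<bar> powr p) \<partial>M2)"
proof -
  let ?\<omega> = unit_ball_volume
  define R where "R = (2 * V / ?\<omega>) powr (1 / Q)"
  have R: "0 < R" using V unit_ball_volume_pos by (simp add: R_def)
  have RQ: "R powr Q = 2 * V / ?\<omega>"
    using V unit_ball_volume_pos Q_pos by (simp add: R_def powr_powr)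
  define c where "c = R powr (- (Q + p * s))"
  have c_eq: "c = inverse (R powr (Q + p * s))" unfolding c_def by (rule powr_minus)
  have "0 < c" using R by (simp add: c_def)
  have vol: "ennreal V \<le> (\<integral>\<^sup>+y. indicator {y. N (mul G (inv_el G x) y) < R \<and> y \<notin> A} y \<partial>lborel)" for x
  proof -
    let ?B = "{y. N (mul G (inv_el G x) y) < R}"
    have [measurable]: "?B \<in> sets borel" by measurable
    have "emeasure lborel ?B = (\<integral>\<^sup>+y. indicator ?B y \<partial>lborel)" by simp
    also have "\<dots> = (\<integral>\<^sup>+y. indicator {y. N y < R} (mul G (inv_el G x) y) \<partial>lborel)"
      by (intro nn_integral_cong) (simp add: indicator_def)
    also have "\<dots> = emeasure lborel {y. N y < R}"
      by (subst nn_integral_mul) auto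
    also have "\<dots> = ennreal (2 * V)"
      using R unit_ball_volume_pos by (simp add: emeasure_N_less RQ)
    finally have B: "emeasure lborel ?B = ennreal (2 * V)" .
    have "emeasure lborel ?B \<le> emeasure lborel (?B - A) + emeasure lborel A"
      by (rule order_trans[OF _ emeasure_subadditive]) (auto intro!: emeasure_mono)
    then have "ennreal (2 * V) \<le> emeasure lborel (?B - A) + emeasure lborel A" unfolding B .
    also have "\<dots> \<le> emeasure lborel (?B - A) + ennreal V" by (intro add_left_mono V(1))
    also have "ennreal (2 * V) = ennreal V + ennreal V" using V by (simp flip: ennreal_plus)
    finally have "ennreal V + ennreal V \<le> emeasure lborel (?B - A) + ennreal V" .
    then have "ennreal V + ennreal V \<le> ennreal V + emeasure lborel (?B - A)"
      by (subst (asm) (2) add.commute)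
    \<comment> \<open>The cancellation is legitimate because \<open>ennreal V\<close> is
      finite.\<close>
    then have "ennreal V \<le> emeasure lborel (?B - A)"
      unfolding ennreal_add_left_cancel_le by simp
    also have "?B - A = {y. N (mul G (inv_el G x) y) < R \<and> y \<notin> A}" by auto
    finally show ?thesis by (subst nn_integral_indicator) (auto simp: set_diff_eq)
  qed
  have "ennreal (c * V) * (\<integral>\<^sup>+x. ennreal (\<bar>u x\<bar> powr p) \<partial>lborel)
      = (\<integral>\<^sup>+x. ennreal (c * \<bar>u x\<bar> powr p) * ennreal V \<partial>lborel)"
    using \<open>0 < c\<close> V by (subst nn_integral_cmult[symmetric]) (auto simp: ennreal_mult' mult_ac)
  also have "\<dots> \<le> (\<integral>\<^sup>+x. ennreal (c * \<bar>u x\<bar> powr p) *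
      (\<integral>\<^sup>+y. indicator {y. N (mul G (inv_el G x) y) < R \<and> y \<notin> A} y \<partial>lborel) \<partial>lborel)"
    by (intro nn_integral_mono mult_left_mono vol) auto
  also have "\<dots> \<le> (\<integral>\<^sup>+x. \<integral>\<^sup>+y. ennreal (\<bar>quot u (x, y)\<bar> powr p) \<partial>lborel \<partial>lborel)"
  proof (rule nn_integral_mono)
    fix x
    have [measurable]: "{y. N (mul G (inv_el G x) y) < R \<and> y \<notin> A} \<in> sets borel" by measurable
    have "ennreal (c * \<bar>u x\<bar> powr p) * (\<integral>\<^sup>+y. indicator {y. N (mul G (inv_el G x) y) < R \<and> y \<notin> A} y \<partial>lborel)
      = (\<integral>\<^sup>+y. ennreal (c * \<bar>u x\<bar> powr p) * indicator {y. N (mul G (inv_el G x) y) < R \<and> y \<notin> A} y \<partial>lborel)"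
      by (rule nn_integral_cmult[symmetric]) simp
    also have "\<dots> \<le> (\<integral>\<^sup>+y. ennreal (\<bar>quot u (x, y)\<bar> powr p) \<partial>lborel)"
    proof (rule nn_integral_mono)
      fix y
      show "ennreal (c * \<bar>u x\<bar> powr p) * indicator {y. N (mul G (inv_el G x) y) < R \<and> y \<notin> A} y
          \<le> ennreal (\<bar>quot u (x, y)\<bar> powr p)"
      proof (cases "N (mul G (inv_el G x) y) < R \<and> y \<notin> A")
        case True
        then have uy: "u y = 0" using zero by blast
        have "c * \<bar>u x\<bar> powr p \<le> \<bar>quot u (x, y)\<bar> powr p"
        \<comment> \<open>On the diagonal the kernel is zero and gives no lower bound, but there
          u(x) = u(y) = 0.\<close>
        proof (cases "N (mul G (inv_el G x) y) = 0")
          case eq: True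
          then have "mul G (inv_el G x) y = 0" by simp
          then have "x = y" by (metis mul_inv_mul(2) mul_right_0)
          then show ?thesis using uy by simp
        next
          case False
          then have pos: "0 < N (mul G (inv_el G x) y)" using N_nonneg[of "mul G (inv_el G x) y"] by linarith
          have "N (mul G (inv_el G x) y) powr (Q + p * s) \<le> R powr (Q + p * s)"
            using True Q_pos ps_pos by (intro powr_mono2) auto
          then have "\<bar>u x\<bar> powr p / R powr (Q + p * s) \<le> \<bar>u x\<bar> powr p / N (mul G (inv_el G x) y) powr (Q + p * s)"
            using pos R by (intro divide_left_mono mult_pos_pos) auto
          then show ?thesis
            using uy by (simp add: abs_quot_powr kernel_commute[of x] c_eq divide_inverse mult.commute)
              (simp add: kernel_def)
        qed
        then show ?thesis using True by (simp add: ennreal_leI)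
      qed auto
    qed
    finally show "ennreal (c * \<bar>u x\<bar> powr p) * (\<integral>\<^sup>+y. indicator {y. N (mul G (inv_el G x) y) < R \<and> y \<notin> A} y \<partial>lborel)
        \<le> (\<integral>\<^sup>+y. ennreal (\<bar>quot u (x, y)\<bar> powr p) \<partial>lborel)" .
  qed
  also have "\<dots> = (\<integral>\<^sup>+z. ennreal (\<bar>quot u z\<bar> powr p) \<partial>M2)"
    by (rule lborel.nn_integral_fst) measurable
  finally have main: "ennreal (c * V) * (\<integral>\<^sup>+x. ennreal (\<bar>u x\<bar> powr p) \<partial>lborel)
      \<le> (\<integral>\<^sup>+z. ennreal (\<bar>quot u z\<bar> powr p) \<partial>M2)" .
  have cV: "FK * V powr (p * s / Q) * (c * V) = 1"
  proof -
    have "Q * (- (1 + p * s / Q)) = - (Q + p * s)"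
      using Q_pos by (simp add: right_diff_distrib)
    then have "c = (R powr Q) powr (- (1 + p * s / Q))"
      unfolding powr_powr c_def by simp
    also have "\<dots> = (2 / ?\<omega>) powr (- (1 + p * s / Q)) * V powr (- (1 + p * s / Q))"
      unfolding RQ using V unit_ball_volume_pos by (simp flip: powr_mult)
    finally have "FK * V powr (p * s / Q) * (c * V)
        = ((2 / ?\<omega>) powr (1 + p * s / Q) * (2 / ?\<omega>) powr (- (1 + p * s / Q)))
          * (V powr (p * s / Q) * V powr (- (1 + p * s / Q)) * V powr 1)"
      using V by (simp add: FK_def)
    also have "\<dots> = 1"
      using V unit_ball_volume_pos by (simp flip: powr_add)
    finally show ?thesis .
  qed
  have "(\<integral>\<^sup>+x. ennreal (\<bar>u x\<bar> powr p) \<partial>lborel)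
      = ennreal (FK * V powr (p * s / Q)) * (ennreal (c * V) * (\<integral>\<^sup>+x. ennreal (\<bar>u x\<bar> powr p) \<partial>lborel))"
    using cV FK_pos \<open>0 < c\<close> V by (simp add: mult.assoc[symmetric] flip: ennreal_mult')
  also have "\<dots> \<le> ennreal (FK * V powr (p * s / Q)) * (\<integral>\<^sup>+z. ennreal (\<bar>quot u z\<bar> powr p) \<partial>M2)"
    by (intro mult_left_mono main) auto
  finally show ?thesis .
qed

lemma nn_integral_Lp_int:
  "f \<in> Lp M p \<Longrightarrow> (\<integral>\<^sup>+x. ennreal (\<bar>f x\<bar> powr p) \<partial>M) = ennreal (Lp_int M p f)"
  unfolding Lp_int_def by (intro nn_integral_eq_integral Lp_integrable) auto

text \<open>Integrability of |u|^p is a conclusion: an integrable energy density and a support of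
  finite measure force it. Test functions obtain their integrability in this way.\<close>

lemma Faber_Krahn:
  assumes A: "A \<in> sets borel" and V: "emeasure lborel A \<le> ennreal V" "0 < V"
    and u[measurable]: "u \<in> borel_measurable borel" and zero: "\<And>x. x \<notin> A \<Longrightarrow> u x = 0"
    and E: "quot u \<in> Lp M2 p"
  shows "u \<in> Lp lborel p" "P u \<le> FK * V powr (p * s / Q) * E u"
proof -
  have le: "(\<integral>\<^sup>+x. ennreal (\<bar>u x\<bar> powr p) \<partial>lborel) \<le> ennreal (FK * V powr (p * s / Q) * E u)"
    using Faber_Krahn_nn[OF A V u zero] FK_pos by (simp add: nn_integral_Lp_int[OF E] ennreal_mult')
  have "integrable lborel (\<lambda>x. \<bar>u x\<bar> powr p)"
    using le by (intro integrableI_bounded) (auto simp: less_top[symmetric] top_unique)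
  then show uL: "u \<in> Lp lborel p" by (simp add: Lp_def)
  show "P u \<le> FK * V powr (p * s / Q) * E u"
    using le FK_pos unfolding nn_integral_Lp_int[OF uL] by simp
qed

end

section \<open>Test functions have finite energy\<close>

lemma frechet_derivative_basis_expansion:
  fixes f :: "real^'n::finite \<Rightarrow> real"
  assumes "smooth f"
  shows "frechet_derivative f (at z) w = (\<Sum>j\<in>UNIV. w $ j * frechet_derivative f (at z) (axis j 1))"
proof -
  have lin: "linear (frechet_derivative f (at z))"
    using smooth_has_derivative[OF assms] has_derivative_linear by blast
  have "frechet_derivative f (at z) w = frechet_derivative f (at z) (\<Sum>j\<in>UNIV. w $ j *\<^sub>R axis j 1)"
    using basis_expansion[of w] by (simp add: scalar_mult_eq_scaleR)
  also have "\<dots> = (\<Sum>j\<in>UNIV. w $ j * frechet_derivative f (at z) (axis j 1))"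
    by (simp add: linear_sum[OF lin] linear_cmul[OF lin])
  finally show ?thesis .
qed

context quasi_normed_group
begin

text \<open>The map h \<mapsto> f(xh) has a derivative bounded uniformly for x in K and h in a
  Euclidean ball; that ball contains all h with N h \<le> 1, and |h| is at most a multiple of N
  h.\<close>

lemma smooth_right_translation_Lipschitz:
  assumes f: "smooth f" and K: "compact K"
  obtains L where "0 < L" "\<And>x h. x \<in> K \<Longrightarrow> N h \<le> 1 \<Longrightarrow> \<bar>f (mul G x h) - f x\<bar> \<le> L * N h"
proof -
  obtain C where C: "0 < C" "\<And>h. N h \<le> 1 \<Longrightarrow> norm h \<le> C * N h" using norm_le_N by blast
  \<comment> \<open>The partial derivatives of h \<mapsto> f(xh), as functions of the pair (x, h).
    Their joint continuity bounds them on the compact product of K and a ball.\<close>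
  define g where "g i z = frechet_derivative f (at (mul G (fst z) (snd z))) (mul_deriv (fst z) (snd z) (axis i 1))" for i z
  have cont: "continuous_on UNIV (g i)" for i
  proof -
    have m: "continuous_on UNIV (\<lambda>z. mul G (fst z) (snd z))"
      using continuous_on_mul by (simp add: case_prod_beta')
    have d: "continuous_on UNIV (\<lambda>z. mul_deriv (fst z) (snd z) (axis i 1))"
      using continuous_on_mul_deriv[of "axis i 1"] by (simp add: case_prod_beta')
    have "continuous_on UNIV (\<lambda>z. frechet_derivative f (at (mul G (fst z) (snd z))) (axis j 1))" for j
      by (rule continuous_on_compose2[OF smooth_imp_continuous_on[OF smooth_frechet_derivative[OF f], of UNIV] m]) auto
    then have "continuous_on UNIV (\<lambda>z. \<Sum>j\<in>UNIV. mul_deriv (fst z) (snd z) (axis i 1) $ j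
        * frechet_derivative f (at (mul G (fst z) (snd z))) (axis j 1))"
      using d by (intro continuous_on_sum continuous_on_mult continuous_on_component)
    then show ?thesis unfolding g_def frechet_derivative_basis_expansion[OF f, of _ "mul_deriv _ _ _"] .
  qed
  have "\<exists>b. \<forall>z\<in>K \<times> cball 0 C. \<bar>g i z\<bar> \<le> b" for i
  proof -
    have "compact (g i ` (K \<times> cball 0 C))"
      using K by (intro compact_continuous_image continuous_on_subset[OF cont] compact_Times) auto
    from compact_imp_bounded[OF this] show ?thesis unfolding bounded_iff by auto
  qed
  then obtain b where b: "\<And>i z. z \<in> K \<times> cball 0 C \<Longrightarrow> \<bar>g i z\<bar> \<le> b i" by metis
  define B where "B = (\<Sum>i\<in>UNIV. \<bar>b i\<bar>) + 1"
  have "0 < B" by (simp add: B_def sum_nonneg add_nonneg_pos)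
  have der: "((\<lambda>h. f (mul G x h)) has_derivative
      (\<lambda>v. frechet_derivative f (at (mul G x h)) (mul_deriv x h v))) (at h)" for x h
    by (rule has_derivative_compose[OF has_derivative_mul smooth_has_derivative[OF f]])
  have "\<bar>f (mul G x h) - f x\<bar> \<le> B * C * N h" if x: "x \<in> K" and h: "N h \<le> 1" for x h
  proof -
    have hC: "norm h \<le> C * N h" "norm h \<le> C"
      using C(2)[OF h] mult_left_mono[OF h less_imp_le[OF C(1)]] by auto
    have "norm (f (mul G x h) - f (mul G x 0)) \<le> B * norm (h - 0)"
    proof (rule differentiable_bound[where S = "cball 0 C" and
          f' = "\<lambda>h v. frechet_derivative f (at (mul G x h)) (mul_deriv x h v)"])
      fix k :: "real^'n" assume k: "k \<in> cball 0 C"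
      show "((\<lambda>h. f (mul G x h)) has_derivative
          (\<lambda>v. frechet_derivative f (at (mul G x k)) (mul_deriv x k v))) (at k within cball 0 C)"
        using der by (rule has_derivative_at_withinI)
      have lin: "linear (\<lambda>v. frechet_derivative f (at (mul G x k)) (mul_deriv x k v))"
        using der has_derivative_linear by blast
      show "onorm (\<lambda>v. frechet_derivative f (at (mul G x k)) (mul_deriv x k v)) \<le> B"
      proof (rule onorm_le)
        fix v :: "real^'n"
        have "frechet_derivative f (at (mul G x k)) (mul_deriv x k v)
            = frechet_derivative f (at (mul G x k)) (mul_deriv x k (\<Sum>j\<in>UNIV. v $ j *\<^sub>R axis j 1))"
          using basis_expansion[of v] by (simp add: scalar_mult_eq_scaleR)
        also have "\<dots> = (\<Sum>j\<in>UNIV. v $ j * g j (x, k))"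
          by (simp add: linear_sum[OF lin] linear_cmul[OF lin] g_def)
        finally have "\<bar>frechet_derivative f (at (mul G x k)) (mul_deriv x k v)\<bar>
            \<le> (\<Sum>j\<in>UNIV. \<bar>v $ j * g j (x, k)\<bar>)" by simp
        also have "\<dots> \<le> (\<Sum>j\<in>UNIV. norm v * \<bar>b j\<bar>)"
        proof (rule sum_mono)
          fix j
          have "\<bar>g j (x, k)\<bar> \<le> \<bar>b j\<bar>" using b[of "(x, k)" j] x k by auto
          then show "\<bar>v $ j * g j (x, k)\<bar> \<le> norm v * \<bar>b j\<bar>"
            using component_le_norm_cart[of v j] by (simp add: abs_mult mult_mono)
        qed
        also have "\<dots> \<le> B * norm v" by (simp add: B_def algebra_simps flip: sum_distrib_left)
        finally show "norm (frechet_derivative f (at (mul G x k)) (mul_deriv x k v)) \<le> B * norm v" by simp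
      qed
    qed (use C hC in auto)
    also have "\<dots> \<le> B * (C * N h)" using hC \<open>0 < B\<close> by simp
    finally show ?thesis by (simp add: mult_ac)
  qed
  then show ?thesis using that[of "B * C"] \<open>0 < B\<close> C by simp
qed

end

context fractional_energy
begin

text \<open>Substituting y = xh makes the kernel depend on N h only. Near the identity the Lipschitz
  bound improves the exponent by p, far away boundedness suffices; the result does not depend on x
  beyond the Lipschitz hypothesis.\<close>

lemma nn_integral_quot_near:
  assumes "0 \<le> L" "0 \<le> b" and [measurable]: "f \<in> borel_measurable borel"
    and lip: "\<And>h. N h \<le> 1 \<Longrightarrow> \<bar>f (mul G x h) - f x\<bar> \<le> L * N h"
    and bd: "\<And>y. \<bar>f y\<bar> \<le> b"
  shows "(\<integral>\<^sup>+y. ennreal (\<bar>quot f (x, y)\<bar> powr p) \<partial>lborel)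
    \<le> ennreal (L powr p) * (\<integral>\<^sup>+h. ennreal (N h powr (p - (Q + p * s))) * indicator {h. 0 < N h \<and> N h < 1} h \<partial>lborel)
      + ennreal ((2 * b) powr p) * (\<integral>\<^sup>+h. ennreal (N h powr (- (Q + p * s))) * indicator {h. 1 \<le> N h} h \<partial>lborel)"
proof -
  have meas: "(\<lambda>y. quot f (x, y)) \<in> borel_measurable borel"
    using measurable_quot[OF assms(3)] by simp
  have [measurable]: "(\<lambda>y. ennreal (\<bar>quot f (x, y)\<bar> powr p)) \<in> borel_measurable borel"
    using meas by measurable
  have "(\<integral>\<^sup>+y. ennreal (\<bar>quot f (x, y)\<bar> powr p) \<partial>lborel)
      = (\<integral>\<^sup>+h. ennreal (\<bar>quot f (x, mul G x h)\<bar> powr p) \<partial>lborel)"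
    by (rule nn_integral_mul[symmetric]) measurable
  also have "\<dots> \<le> (\<integral>\<^sup>+h. ennreal (L powr p) * (ennreal (N h powr (p - (Q + p * s))) * indicator {h. 0 < N h \<and> N h < 1} h)
      + ennreal ((2 * b) powr p) * (ennreal (N h powr (- (Q + p * s))) * indicator {h. 1 \<le> N h} h) \<partial>lborel)"
  proof (rule nn_integral_mono)
    fix h
    have q: "\<bar>quot f (x, mul G x h)\<bar> powr p = \<bar>f (mul G x h) - f x\<bar> powr p * N h powr (- (Q + p * s))"
      by (simp add: abs_quot_powr kernel_mul abs_minus_commute divide_inverse powr_minus[symmetric])
    consider "h = 0" | "0 < N h" "N h < 1" | "1 \<le> N h" by fastforce
    then show "ennreal (\<bar>quot f (x, mul G x h)\<bar> powr p)
      \<le> ennreal (L powr p) * (ennreal (N h powr (p - (Q + p * s))) * indicator {h. 0 < N h \<and> N h < 1} h)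
      + ennreal ((2 * b) powr p) * (ennreal (N h powr (- (Q + p * s))) * indicator {h. 1 \<le> N h} h)"
    proof cases
      case 1 then show ?thesis by (simp add: quot_def)
    next
      case 2
      have "\<bar>f (mul G x h) - f x\<bar> powr p \<le> (L * N h) powr p"
        using lip[of h] 2 p by (intro powr_mono2) auto
      then have "\<bar>f (mul G x h) - f x\<bar> powr p * N h powr (- (Q + p * s)) \<le> (L * N h) powr p * N h powr (- (Q + p * s))"
        by (intro mult_right_mono) auto
      also have "\<dots> = L powr p * (N h powr p * N h powr (- (Q + p * s)))"
        using assms by (simp add: powr_mult mult.assoc)
      also have "\<dots> = L powr p * N h powr (p - (Q + p * s))"
        by (simp only: powr_add[symmetric] diff_conv_add_uminus)
      finally have "ennreal (\<bar>quot f (x, mul G x h)\<bar> powr p) \<le> ennreal (L powr p) * ennreal (N h powr (p - (Q + p * s)))"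
        unfolding q by (subst ennreal_mult'[symmetric]) (auto intro: ennreal_leI)
      then show ?thesis using 2 by simp
    next
      case 3
      have "\<bar>f (mul G x h) - f x\<bar> \<le> 2 * b" using bd[of "mul G x h"] bd[of x] by linarith
      then have "\<bar>f (mul G x h) - f x\<bar> powr p \<le> (2 * b) powr p"
        using p by (intro powr_mono2) auto
      then have "\<bar>f (mul G x h) - f x\<bar> powr p * N h powr (- (Q + p * s)) \<le> (2 * b) powr p * N h powr (- (Q + p * s))"
        by (intro mult_right_mono) auto
      then have "ennreal (\<bar>quot f (x, mul G x h)\<bar> powr p) \<le> ennreal ((2 * b) powr p) * ennreal (N h powr (- (Q + p * s)))"
        unfolding q by (subst ennreal_mult'[symmetric]) (auto intro: ennreal_leI)
      then show ?thesis using 3 by simp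
    qed
  qed
  also have "\<dots> = ennreal (L powr p) * (\<integral>\<^sup>+h. ennreal (N h powr (p - (Q + p * s))) * indicator {h. 0 < N h \<and> N h < 1} h \<partial>lborel)
      + ennreal ((2 * b) powr p) * (\<integral>\<^sup>+h. ennreal (N h powr (- (Q + p * s))) * indicator {h. 1 \<le> N h} h \<partial>lborel)"
    by (subst nn_integral_add) (auto simp: nn_integral_cmult)
  finally show ?thesis .
qed

lemma quot_swap: "\<bar>quot u (y, x)\<bar> = \<bar>quot u (x, y)\<bar>"
  by (simp add: quot_def kernel_commute[of y x] abs_minus_commute)

text \<open>Only pairs with a point in the compact support contribute, and the density is symmetric,
  so it is enough to integrate over x in the support, where the inner integral is uniformly
  bounded.\<close>

lemma test_functions_finite_energy:
  assumes f: "f \<in> test_functions \<Omega>"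
  shows "f \<in> finite_energy \<Omega>"
proof -
  define K where "K = closure {x. f x \<noteq> 0}"
  have K: "compact K" using f by (simp add: test_functions_def K_def)
  have zero: "f x = 0" if "x \<notin> K" for x
    using that closure_subset[of "{x. f x \<noteq> 0}"] by (auto simp: K_def)
  have sm: "smooth f" by (rule test_functions_smooth[OF f])
  have [measurable]: "f \<in> borel_measurable borel"
    by (intro borel_measurable_continuous_onI smooth_imp_continuous_on sm)
  have [measurable]: "K \<in> sets borel" by (simp add: K_def)
  obtain b where b: "0 \<le> b" "\<And>y. \<bar>f y\<bar> \<le> b"
  proof -
    have "compact (f ` K)" by (intro compact_continuous_image smooth_imp_continuous_on sm K)
    then obtain b where "\<And>y. y \<in> K \<Longrightarrow> \<bar>f y\<bar> \<le> b"
      using compact_imp_bounded[of "f ` K"] unfolding bounded_iff by auto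
    then have "\<bar>f y\<bar> \<le> max b 0" for y using zero[of y] by (cases "y \<in> K") (auto simp: le_max_iff_disj)
    then show ?thesis using that[of "max b 0"] by simp
  qed
  have finK: "emeasure lborel K < \<infinity>" using emeasure_compact_finite[OF K] .
  obtain L where L: "0 < L" "\<And>x h. x \<in> K \<Longrightarrow> N h \<le> 1 \<Longrightarrow> \<bar>f (mul G x h) - f x\<bar> \<le> L * N h"
    using smooth_right_translation_Lipschitz[OF sm K] by blast
  define D where "D = ennreal (L powr p) * (\<integral>\<^sup>+h. ennreal (N h powr (p - (Q + p * s))) * indicator {h. 0 < N h \<and> N h < 1} h \<partial>lborel)
      + ennreal ((2 * b) powr p) * (\<integral>\<^sup>+h. ennreal (N h powr (- (Q + p * s))) * indicator {h. 1 \<le> N h} h \<partial>lborel)"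
  \<comment> \<open>Here s < 1 enters: near the identity the critical exponent is Q + p - (Q + ps) =
    p (1 - s) > 0, and at infinity it is -ps < 0.\<close>
  have "0 < p * (1 - s)" using s p by simp
  then have "0 < Q + (p - (Q + p * s))" by (simp add: right_diff_distrib)
  moreover have "Q + (- (Q + p * s)) < 0" using ps_pos by simp
  ultimately have "D < \<infinity>"
    unfolding D_def using nn_integral_N_powr_small nn_integral_N_powr_large
    by (simp add: ennreal_mult_less_top)
  define H where "H z = ennreal (\<bar>quot f z\<bar> powr p)" for z
  have [measurable]: "H \<in> borel_measurable M2" unfolding H_def by measurable
  have half: "(\<integral>\<^sup>+z. H z * indicator (K \<times> UNIV) z \<partial>M2) \<le> D * emeasure lborel K"
  proof -
    have "(\<integral>\<^sup>+z. H z * indicator (K \<times> UNIV) z \<partial>M2) = (\<integral>\<^sup>+x. \<integral>\<^sup>+y. H (x, y) * indicator (K \<times> UNIV) (x, y) \<partial>lborel \<partial>lborel)"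
      by (rule lborel.nn_integral_fst[symmetric]) measurable
    also have "\<dots> \<le> (\<integral>\<^sup>+x. D * indicator K x \<partial>lborel)"
    proof (rule nn_integral_mono)
      fix x
      show "(\<integral>\<^sup>+y. H (x, y) * indicator (K \<times> UNIV) (x, y) \<partial>lborel) \<le> D * indicator K x"
      proof (cases "x \<in> K")
        case True
        then show ?thesis
          using nn_integral_quot_near[of L b f x] L b by (simp add: D_def H_def)
      qed simp
    qed
    also have "\<dots> = D * emeasure lborel K" by (rule nn_integral_cmult_indicator) simp
    finally show ?thesis .
  qed
  have swap: "(\<integral>\<^sup>+z. H z * indicator (UNIV \<times> K) z \<partial>M2) = (\<integral>\<^sup>+z. H z * indicator (K \<times> UNIV) z \<partial>M2)"
  proof -
    have "(\<integral>\<^sup>+z. H z * indicator (UNIV \<times> K) z \<partial>M2) = (\<integral>\<^sup>+y. \<integral>\<^sup>+x. H (x, y) * indicator (UNIV \<times> K) (x, y) \<partial>lborel \<partial>lborel)"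
      by (rule lborel_pair.nn_integral_snd[symmetric]) measurable
    also have "\<dots> = (\<integral>\<^sup>+y. \<integral>\<^sup>+x. H (y, x) * indicator (K \<times> UNIV) (y, x) \<partial>lborel \<partial>lborel)"
      by (intro nn_integral_cong) (simp add: H_def quot_swap indicator_def)
    also have "\<dots> = (\<integral>\<^sup>+z. H z * indicator (K \<times> UNIV) z \<partial>M2)"
      by (rule lborel.nn_integral_fst) measurable
    finally show ?thesis .
  qed
  have "(\<integral>\<^sup>+z. H z \<partial>M2) \<le> (\<integral>\<^sup>+z. H z * indicator (K \<times> UNIV) z + H z * indicator (UNIV \<times> K) z \<partial>M2)"
  proof (rule nn_integral_mono)
    fix z :: "(real^'n) \<times> (real^'n)"
    show "H z \<le> H z * indicator (K \<times> UNIV) z + H z * indicator (UNIV \<times> K) z"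
      using zero[of "fst z"] zero[of "snd z"] by (cases z) (auto simp: H_def quot_def indicator_def)
  qed
  also have "\<dots> = (\<integral>\<^sup>+z. H z * indicator (K \<times> UNIV) z \<partial>M2) + (\<integral>\<^sup>+z. H z * indicator (UNIV \<times> K) z \<partial>M2)"
    by (rule nn_integral_add) measurable
  also have "\<dots> \<le> D * emeasure lborel K + D * emeasure lborel K"
    unfolding swap by (intro add_mono half)
  also have "\<dots> < \<infinity>" using \<open>D < \<infinity>\<close> finK by (simp add: ennreal_mult_less_top)
  finally have fin: "(\<integral>\<^sup>+z. H z \<partial>M2) < \<infinity>" .
  have "integrable M2 (\<lambda>z. \<bar>quot f z\<bar> powr p)"
    using fin by (intro integrableI_bounded) (auto simp: H_def)
  then have quotL: "quot f \<in> Lp M2 p" by (simp add: Lp_def)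
  have "f \<in> Lp lborel p"
  proof (rule Faber_Krahn(1)[OF \<open>K \<in> sets borel\<close> _ _ _ zero quotL])
    show "emeasure lborel K \<le> ennreal (measure lborel K + 1)"
      using finK by (simp add: emeasure_eq_ennreal_measure less_top ennreal_leI)
    show "0 < measure lborel K + 1" by (simp add: add_nonneg_pos)
  qed simp
  then show ?thesis using quotL test_functions_zero_outside[OF f] by (simp add: finite_energy_def)
qed

end

section \<open>The closure of the test functions\<close>

lemma Lp_int_tendsto_AE_subseq:
  fixes f :: "nat \<Rightarrow> 'a \<Rightarrow> real"
  assumes f: "\<And>n. f n \<in> Lp M p" and p: "0 < p"
    and lim: "(\<lambda>n. Lp_int M p (f n)) \<longlonglongrightarrow> 0"
  obtains r where "strict_mono r" "AE x in M. (\<lambda>n. f (r n) x) \<longlonglongrightarrow> 0"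
proof -
  have "\<exists>r::nat\<Rightarrow>nat. strict_mono r \<and> (AE x in M. (\<lambda>n. \<bar>f (r n) x\<bar> powr p) \<longlonglongrightarrow> 0)"
    using lim by (intro tendsto_L1_AE_subseq Lp_integrable f) (simp add: Lp_int_def)
  then obtain r where r: "strict_mono r" "AE x in M. (\<lambda>n. \<bar>f (r n) x\<bar> powr p) \<longlonglongrightarrow> 0" by blast
  have "AE x in M. (\<lambda>n. f (r n) x) \<longlonglongrightarrow> 0"
    using r(2)
  proof eventually_elim
    fix x assume "(\<lambda>n. \<bar>f (r n) x\<bar> powr p) \<longlonglongrightarrow> 0"
    then have "(\<lambda>n. (\<bar>f (r n) x\<bar> powr p) powr (1/p)) \<longlonglongrightarrow> 0 powr (1/p)"
      using p by (intro tendsto_powr' tendsto_const) auto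
    then have "(\<lambda>n. \<bar>f (r n) x\<bar>) \<longlonglongrightarrow> 0" using p by (simp add: powr_powr)
    then show "(\<lambda>n. f (r n) x) \<longlonglongrightarrow> 0" by (rule tendsto_rabs_zero_cancel)
  qed
  with r(1) that show ?thesis by blast
qed

text \<open>A null set times the whole space is null in the product. This carries almost everywhere
  convergence of functions over to their difference quotients.\<close>

lemma AE_lborel_pair:
  fixes A :: "'a::euclidean_space \<Rightarrow> bool"
  assumes "AE x in lborel. A x"
  shows "AE z in lborel \<Otimes>\<^sub>M lborel. A (fst z) \<and> A (snd z)"
proof -
  obtain Z where Z: "{x. \<not> A x} \<subseteq> Z" "emeasure lborel Z = 0" "Z \<in> sets lborel"
    using AE_E[OF assms] by auto
  have "Z \<times> UNIV \<in> null_sets (lborel \<Otimes>\<^sub>M (lborel :: 'a measure))"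
    "UNIV \<times> Z \<in> null_sets ((lborel :: 'a measure) \<Otimes>\<^sub>M lborel)"
    using Z by (auto simp: null_sets_def lborel.emeasure_pair_measure_Times)
  then have "(Z \<times> UNIV) \<union> (UNIV \<times> Z) \<in> null_sets (lborel \<Otimes>\<^sub>M lborel)" by (rule null_sets.Un)
  then show ?thesis by (rule AE_I') (use Z(1) in auto)
qed

context fractional_energy
begin

abbreviation X :: "(real^'n) set \<Rightarrow> (real^'n \<Rightarrow> real) set" where "X \<Omega> \<equiv> X0 G N s p \<Omega>"

lemma X_finite_energy: "u \<in> X \<Omega> \<Longrightarrow> u \<in> finite_energy \<Omega>"
  by (simp add: X0_iff)

lemma finite_energy_diff:
  "u \<in> finite_energy \<Omega> \<Longrightarrow> v \<in> finite_energy \<Omega> \<Longrightarrow> (\<lambda>x. u x - v x) \<in> finite_energy \<Omega>"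
  using finite_energy_lincomb[of u \<Omega> v "-1"] by simp

lemma P_lincomb_le:
  assumes "u \<in> finite_energy \<Omega>" "v \<in> finite_energy \<Omega>"
  shows "P (\<lambda>x. u x + c * v x) \<le> 2 powr p * (P u + \<bar>c\<bar> powr p * P v)"
  using Lp_int_add_le[OF finite_energyD(1)[OF assms(1)] Lp_cmult[OF finite_energyD(1)[OF assms(2)]], of c] p
  by (simp add: Lp_int_cmult)

lemma E_lincomb_le:
  assumes "u \<in> finite_energy \<Omega>" "v \<in> finite_energy \<Omega>"
  shows "E (\<lambda>x. u x + c * v x) \<le> 2 powr p * (E u + \<bar>c\<bar> powr p * E v)"
  using Lp_int_add_le[OF finite_energyD(2)[OF assms(1)] Lp_cmult[OF finite_energyD(2)[OF assms(2)]], of c] p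
  by (simp add: Lp_int_cmult quot_add[abs_def] quot_cmult)

lemma
  assumes u: "\<And>n. u n \<in> finite_energy \<Omega>" and v: "\<And>n. v n \<in> finite_energy \<Omega>"
  shows P_lincomb_tendsto_0: "(\<lambda>n. P (u n)) \<longlonglongrightarrow> 0 \<Longrightarrow> (\<lambda>n. P (v n)) \<longlonglongrightarrow> 0 \<Longrightarrow>
      (\<lambda>n. P (\<lambda>x. u n x + c * v n x)) \<longlonglongrightarrow> 0"
    and E_lincomb_tendsto_0: "(\<lambda>n. E (u n)) \<longlonglongrightarrow> 0 \<Longrightarrow> (\<lambda>n. E (v n)) \<longlonglongrightarrow> 0 \<Longrightarrow>
      (\<lambda>n. E (\<lambda>x. u n x + c * v n x)) \<longlonglongrightarrow> 0"
proof -
  have lim: "(\<lambda>n. 2 powr p * (a n + \<bar>c\<bar> powr p * b n)) \<longlonglongrightarrow> 0" if "a \<longlonglongrightarrow> 0" "b \<longlonglongrightarrow> 0" for a b :: "nat \<Rightarrow> real"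
    using tendsto_mult_left[OF tendsto_add[OF that(1) tendsto_mult_left[OF that(2)]]] by simp
  show "(\<lambda>n. P (\<lambda>x. u n x + c * v n x)) \<longlonglongrightarrow> 0" if "(\<lambda>n. P (u n)) \<longlonglongrightarrow> 0" "(\<lambda>n. P (v n)) \<longlonglongrightarrow> 0"
    by (rule tendsto_sandwich[OF _ _ tendsto_const lim[OF that]]) (use P_lincomb_le[OF u v] in auto)
  show "(\<lambda>n. E (\<lambda>x. u n x + c * v n x)) \<longlonglongrightarrow> 0" if "(\<lambda>n. E (u n)) \<longlonglongrightarrow> 0" "(\<lambda>n. E (v n)) \<longlonglongrightarrow> 0"
    by (rule tendsto_sandwich[OF _ _ tendsto_const lim[OF that]]) (use E_lincomb_le[OF u v] in auto)
qed

lemma E_cmult: "E (\<lambda>x. c * u x) = \<bar>c\<bar> powr p * E u"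
  by (simp add: Lp_int_cmult quot_cmult[abs_def])

lemma test_functions_X: "f \<in> test_functions \<Omega> \<Longrightarrow> f \<in> X \<Omega>"
  using p test_functions_finite_energy
  by (auto simp: X0_iff Lp_int_def quot_def[abs_def] intro!: exI[of _ "\<lambda>_. f"])

lemma X_lincomb:
  assumes "u \<in> X \<Omega>" "v \<in> X \<Omega>"
  shows "(\<lambda>x. u x + c * v x) \<in> X \<Omega>"
proof -
  obtain f where f: "\<And>n. f n \<in> test_functions \<Omega>"
    "(\<lambda>n. P (\<lambda>x. u x - f n x)) \<longlonglongrightarrow> 0" "(\<lambda>n. E (\<lambda>x. u x - f n x)) \<longlonglongrightarrow> 0"
    using assms(1) unfolding X0_iff by blast
  obtain g where g: "\<And>n. g n \<in> test_functions \<Omega>"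
    "(\<lambda>n. P (\<lambda>x. v x - g n x)) \<longlonglongrightarrow> 0" "(\<lambda>n. E (\<lambda>x. v x - g n x)) \<longlonglongrightarrow> 0"
    using assms(2) unfolding X0_iff by blast
  have uv: "u \<in> finite_energy \<Omega>" "v \<in> finite_energy \<Omega>" using assms by (auto intro: X_finite_energy)
  note fe = finite_energy_diff[OF uv(1) test_functions_finite_energy[OF f(1)]]
    finite_energy_diff[OF uv(2) test_functions_finite_energy[OF g(1)]]
  have eq: "(\<lambda>x. u x + c * v x - (f n x + c * g n x)) = (\<lambda>x. (u x - f n x) + c * (v x - g n x))" for n
    by (simp add: algebra_simps)
  have "(\<lambda>n. P (\<lambda>x. u x + c * v x - (f n x + c * g n x))) \<longlonglongrightarrow> 0"
    unfolding eq by (rule P_lincomb_tendsto_0[OF fe f(2) g(2)])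
  moreover have "(\<lambda>n. E (\<lambda>x. u x + c * v x - (f n x + c * g n x))) \<longlonglongrightarrow> 0"
    unfolding eq by (rule E_lincomb_tendsto_0[OF fe f(3) g(3)])
  moreover have "(\<lambda>x. f n x + c * g n x) \<in> test_functions \<Omega>" for n
    using f(1) g(1) by (intro test_functions_add test_functions_cmult)
  ultimately show ?thesis
    unfolding X0_iff using finite_energy_lincomb[OF uv]
    by (intro conjI exI[of _ "\<lambda>n x. f n x + c * g n x"]) auto
qed

lemma X_cmult: "u \<in> X \<Omega> \<Longrightarrow> (\<lambda>x. c * u x) \<in> X \<Omega>"
  using X_lincomb[of "u" \<Omega> u "c - 1"] by (simp add: algebra_simps)

text \<open>A contraction of a test function need not be smooth, so \<psi> is replaced by smooth
  contractions \<psi>n along the approximating test functions. The errors tend to zero almost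
  everywhere and are dominated by |f n| + |u|, and likewise for the quotients, so both the p-th
  means and the energies converge.\<close>

lemma X_contraction:
  fixes \<psi> :: "real \<Rightarrow> real" and \<psi>n :: "nat \<Rightarrow> real \<Rightarrow> real"
  assumes u: "u \<in> X \<Omega>"
    and sm: "\<And>n f. smooth f \<Longrightarrow> smooth (\<lambda>x :: real^'n. \<psi>n n (f x))"
    and zero: "\<And>n. \<psi>n n 0 = 0"
    and lip: "\<And>n a b. \<bar>\<psi>n n a - \<psi>n n b\<bar> \<le> \<bar>a - b\<bar>"
    and approx: "\<And>n a. \<bar>\<psi>n n a - \<psi> a\<bar> \<le> inverse (real (Suc n))"
  shows "(\<lambda>x. \<psi> (u x)) \<in> X \<Omega>" "E (\<lambda>x. \<psi> (u x)) \<le> E u"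
proof -
  have conv: "(\<lambda>n. \<psi>n n a) \<longlonglongrightarrow> \<psi> a" for a
  proof (rule Lim_transform_bound[OF _ _, THEN LIM_zero_cancel])
    show "(\<lambda>n. inverse (real (Suc n))) \<longlonglongrightarrow> 0" by (rule LIMSEQ_inverse_real_of_nat)
  qed (use approx in auto)
  have \<psi>0: "\<psi> 0 = 0" using LIMSEQ_unique[OF conv[of 0]] by (simp add: zero)
  have \<psi>lip: "\<bar>\<psi> a - \<psi> b\<bar> \<le> \<bar>a - b\<bar>" for a b
    by (rule LIMSEQ_le_const2[OF tendsto_rabs[OF tendsto_diff[OF conv conv]]]) (use lip in auto)
  have "continuous_on UNIV \<psi>"
    using \<psi>lip by (intro lipschitz_on_continuous_on[of 1] lipschitz_onI) (auto simp: dist_real_def)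
  then have [measurable]: "\<psi> \<in> borel_measurable borel" by (rule borel_measurable_continuous_onI)
  have uF: "u \<in> finite_energy \<Omega>" using u by (rule X_finite_energy)
  note [measurable] = finite_energyD(4)[OF uF]
  have quot_le: "\<bar>quot (\<lambda>x. \<psi> (u x)) z\<bar> \<le> \<bar>quot u z\<bar>" for z
    using \<psi>lip by (simp add: quot_def divide_right_mono)
  have \<psi>u: "(\<lambda>x. \<psi> (u x)) \<in> finite_energy \<Omega>"
  proof -
    have "(\<lambda>x. \<psi> (u x)) \<in> Lp lborel p"
      by (rule Lp_dominated(1)[OF _ finite_energyD(1)[OF uF]]) (use p \<psi>lip[of _ 0] \<psi>0 in auto)
    moreover have "quot (\<lambda>x. \<psi> (u x)) \<in> Lp M2 p"
      by (rule Lp_dominated(1)[OF _ finite_energyD(2)[OF uF]]) (use p quot_le in auto)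
    ultimately show ?thesis using finite_energyD(3)[OF uF] \<psi>0 by (simp add: finite_energy_def)
  qed
  show "E (\<lambda>x. \<psi> (u x)) \<le> E u"
    by (rule Lp_dominated(2)[OF _ finite_energyD(2)[OF uF]]) (use p quot_le in auto)
  obtain f0 where f0: "\<And>n. f0 n \<in> test_functions \<Omega>"
    "(\<lambda>n. P (\<lambda>x. u x - f0 n x)) \<longlonglongrightarrow> 0" "(\<lambda>n. E (\<lambda>x. u x - f0 n x)) \<longlonglongrightarrow> 0"
    using u unfolding X0_iff by blast
  note f0F = test_functions_finite_energy[OF f0(1)]
  \<comment> \<open>Convergence in the p-th mean gives almost everywhere convergence only along a
    subsequence, which still approximates u in both means.\<close>
  obtain r where r: "strict_mono r" "AE x in lborel. (\<lambda>n. u x - f0 (r n) x) \<longlonglongrightarrow> 0"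
    using Lp_int_tendsto_AE_subseq[OF finite_energyD(1)[OF finite_energy_diff[OF uF f0F]] _ f0(2)] p by auto
  define f where "f n = f0 (r n)" for n
  have f: "\<And>n. f n \<in> test_functions \<Omega>" "(\<lambda>n. P (\<lambda>x. f n x - u x)) \<longlonglongrightarrow> 0"
    "(\<lambda>n. E (\<lambda>x. f n x - u x)) \<longlonglongrightarrow> 0"
    using f0(1) LIMSEQ_subseq_LIMSEQ[OF f0(2) r(1)] LIMSEQ_subseq_LIMSEQ[OF f0(3) r(1)]
    by (auto simp: f_def o_def Lp_int_minus_commute[of lborel p u] quot_diff[abs_def] Lp_int_minus_commute[of M2 p "quot u"])
  note fF = test_functions_finite_energy[OF f(1)]
  note [measurable] = finite_energyD(4)[OF fF]
  have gT: "(\<lambda>x. \<psi>n n (f n x)) \<in> test_functions \<Omega>" for n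
    by (rule test_functions_support[OF f(1)[of n] f(1)[of n]])
       (use sm[OF test_functions_smooth[OF f(1)[of n]]] zero in auto)
  note gF = test_functions_finite_energy[OF gT]
  note [measurable] = finite_energyD(4)[OF gF]
  define h where "h n x = \<psi> (u x) - \<psi>n n (f n x)" for n x
  have [measurable]: "h n \<in> borel_measurable borel" for n unfolding h_def by measurable
  have h0: "AE x in lborel. (\<lambda>n. h n x) \<longlonglongrightarrow> 0"
    using r(2)
  proof eventually_elim
    fix x assume lim: "(\<lambda>n. u x - f0 (r n) x) \<longlonglongrightarrow> 0"
    show "(\<lambda>n. h n x) \<longlonglongrightarrow> 0"
    proof (rule Lim_null_comparison)
      show "(\<lambda>n. \<bar>u x - f0 (r n) x\<bar> + inverse (real (Suc n))) \<longlonglongrightarrow> 0"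
        using tendsto_add[OF tendsto_rabs_zero[OF lim] LIMSEQ_inverse_real_of_nat] by simp
      have "\<bar>h n x\<bar> \<le> \<bar>u x - f n x\<bar> + inverse (real (Suc n))" for n
        using \<psi>lip[of "u x" "f n x"] approx[of n "f n x"] unfolding h_def by linarith
      then show "\<forall>\<^sub>F n in sequentially. norm (h n x) \<le> \<bar>u x - f0 (r n) x\<bar> + inverse (real (Suc n))"
        by (simp add: f_def)
    qed
  qed
  have "(\<lambda>n. P (h n)) \<longlonglongrightarrow> 0"
  proof (rule Lp_dominated_convergence[OF _ finite_energyD(1)[OF fF] finite_energyD(1)[OF uF] f(2) _ _ h0])
    show "\<bar>h n x\<bar> \<le> \<bar>f n x\<bar> + \<bar>u x\<bar>" for n x
      using \<psi>lip[of "u x" 0] lip[of n "f n x" 0] unfolding h_def \<psi>0 zero by linarith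
  qed (use p in auto)
  moreover have "(\<lambda>n. E (h n)) \<longlonglongrightarrow> 0"
  proof (rule Lp_dominated_convergence[OF _ finite_energyD(2)[OF fF] finite_energyD(2)[OF uF]])
    show "(\<lambda>n. Lp_int M2 p (\<lambda>z. quot (f n) z - quot u z)) \<longlonglongrightarrow> 0"
      using f(3) by (simp add: quot_diff[abs_def])
    show "quot (h n) \<in> borel_measurable M2" for n by (rule measurable_quot) simp
    show "\<bar>quot (h n) z\<bar> \<le> \<bar>quot (f n) z\<bar> + \<bar>quot u z\<bar>" for n z
    proof -
      have "\<bar>h n (fst z) - h n (snd z)\<bar> \<le> \<bar>f n (fst z) - f n (snd z)\<bar> + \<bar>u (fst z) - u (snd z)\<bar>"
        using \<psi>lip[of "u (fst z)" "u (snd z)"] lip[of n "f n (fst z)" "f n (snd z)"] unfolding h_def by linarith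
      then show ?thesis by (simp add: quot_def divide_right_mono flip: add_divide_distrib)
    qed
    show "AE z in M2. (\<lambda>n. quot (h n) z) \<longlonglongrightarrow> 0"
      using AE_lborel_pair[OF h0]
    proof eventually_elim
      fix z assume "(\<lambda>n. h n (fst z)) \<longlonglongrightarrow> 0 \<and> (\<lambda>n. h n (snd z)) \<longlonglongrightarrow> 0"
      then have "(\<lambda>n. (h n (fst z) - h n (snd z)) * inverse (kernel G N s p (fst z) (snd z) powr (1 / p)))
          \<longlonglongrightarrow> (0 - 0) * inverse (kernel G N s p (fst z) (snd z) powr (1 / p))"
        by (intro tendsto_mult tendsto_diff tendsto_const) auto
      then show "(\<lambda>n. quot (h n) z) \<longlonglongrightarrow> 0" by (simp add: quot_def divide_inverse)
    qed
  qed (use p in auto)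
  ultimately show "(\<lambda>x. \<psi> (u x)) \<in> X \<Omega>"
    unfolding X0_iff using \<psi>u gT
    by (intro conjI exI[of _ "\<lambda>n x. \<psi>n n (f n x)"]) (auto simp: h_def[abs_def])
qed

text \<open>The root is the Euclidean norm of the point (a, e) of the plane, so this is the reverse
  triangle inequality.\<close>

lemma sqrt_square_add_Lipschitz:
  fixes a b e :: real
  shows "\<bar>sqrt (a\<^sup>2 + e\<^sup>2) - sqrt (b\<^sup>2 + e\<^sup>2)\<bar> \<le> \<bar>a - b\<bar>"
proof -
  have "\<bar>norm (a, e) - norm (b, e)\<bar> \<le> norm ((a, e) - (b, e))" by (rule norm_triangle_ineq3)
  then show ?thesis by (simp add: norm_Pair)
qed

lemma sqrt_square_add_abs:
  fixes a e :: real
  assumes "0 \<le> e"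
  shows "\<bar>a\<bar> \<le> sqrt (a\<^sup>2 + e\<^sup>2)" "sqrt (a\<^sup>2 + e\<^sup>2) \<le> \<bar>a\<bar> + e"
proof -
  show "\<bar>a\<bar> \<le> sqrt (a\<^sup>2 + e\<^sup>2)" by (rule real_le_rsqrt) simp
  show "sqrt (a\<^sup>2 + e\<^sup>2) \<le> \<bar>a\<bar> + e"
    using assms by (intro real_le_lsqrt) (auto simp: power2_sum)
qed

text \<open>The modulus is approximated by sqrt(a^2 + e^2) - e. Subtracting e makes the
  approximation vanish at zero, so that compositions keep compact support.\<close>

lemma X_abs:
  assumes "u \<in> X \<Omega>"
  shows "(\<lambda>x. \<bar>u x\<bar>) \<in> X \<Omega>" "E (\<lambda>x. \<bar>u x\<bar>) \<le> E u"
proof -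
  let ?e = "\<lambda>n. inverse (real (Suc n))"
  let ?\<psi> = "\<lambda>n a. sqrt (a\<^sup>2 + (?e n)\<^sup>2) + (- ?e n)"
  have sm: "smooth (\<lambda>x. ?\<psi> n (f x))" if "smooth f" for f :: "real^'n \<Rightarrow> real" and n
    using that by (intro smooth_add smooth_sqrt_square_add smooth_const) auto
  have zero: "?\<psi> n 0 = 0" for n by simp
  have lip: "\<bar>?\<psi> n a - ?\<psi> n b\<bar> \<le> \<bar>a - b\<bar>" for n a b
    using sqrt_square_add_Lipschitz[of a "?e n" b] by simp
  have approx: "\<bar>?\<psi> n a - \<bar>a\<bar>\<bar> \<le> ?e n" for n a
    using sqrt_square_add_abs[of "?e n" a] by simp
  note * = X_contraction[of u \<Omega> ?\<psi> abs, OF assms sm zero lip approx]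
  show "(\<lambda>x. \<bar>u x\<bar>) \<in> X \<Omega>" "E (\<lambda>x. \<bar>u x\<bar>) \<le> E u" using * by auto
qed

lemma X_min:
  assumes "u \<in> X \<Omega>" "0 \<le> k"
  shows "(\<lambda>x. min (u x) k) \<in> X \<Omega>"
proof -
  let ?e = "\<lambda>n. inverse (real (Suc n))"
  let ?S = "\<lambda>n a. sqrt ((a + (-k))\<^sup>2 + (?e n)\<^sup>2)"
  \<comment> \<open>min a k = (a + k - |a - k|) / 2, with the modulus regularized. The constant
    \<open>?c n\<close> restores the value 0 at a = 0 and is at most half of
    \<open>?e n\<close>.\<close>
  let ?c = "\<lambda>n. (sqrt (k\<^sup>2 + (?e n)\<^sup>2) - k) / 2"
  let ?\<psi> = "\<lambda>n a. (1/2) * ((a + k) + (-1) * ?S n a) + ?c n"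
  have sm: "smooth (\<lambda>x. ?\<psi> n (f x))" if "smooth f" for f :: "real^'n \<Rightarrow> real" and n
    using that by (intro smooth_add smooth_cmult smooth_sqrt_square_add smooth_const) auto
  have zero: "?\<psi> n 0 = 0" for n by (simp add: field_simps)
  have lip: "\<bar>?\<psi> n a - ?\<psi> n b\<bar> \<le> \<bar>a - b\<bar>" for n a b
    using sqrt_square_add_Lipschitz[of "a + (-k)" "?e n" "b + (-k)"] by argo
  have approx: "\<bar>?\<psi> n a - min a k\<bar> \<le> ?e n" for n a
  proof -
    have "\<bar>a + (-k)\<bar> \<le> ?S n a" "?S n a \<le> \<bar>a + (-k)\<bar> + ?e n"
      "\<bar>k\<bar> \<le> sqrt (k\<^sup>2 + (?e n)\<^sup>2)" "sqrt (k\<^sup>2 + (?e n)\<^sup>2) \<le> \<bar>k\<bar> + ?e n"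
      by (rule sqrt_square_add_abs; simp)+
    then show ?thesis using \<open>0 \<le> k\<close> unfolding min_def by argo
  qed
  show ?thesis using X_contraction(1)[of u \<Omega> ?\<psi> "\<lambda>a. min a k", OF assms(1) sm zero lip approx] .
qed

end

section \<open>Compact embedding\<close>

context quasi_normed_group
begin

text \<open>A tent on the ball of radius r. A continuous profile, unlike the indicator of the ball,
  makes the averaging kernel uniformly continuous on compact sets and hence the averages
  equicontinuous.\<close>

definition cut :: "real \<Rightarrow> real^'n \<Rightarrow> real" where
  "cut r h = max 0 (1 - N h / r)"

definition cut_int :: "real \<Rightarrow> real" where
  "cut_int r = (\<integral>h. cut r h \<partial>lborel)"

definition weight :: "real \<Rightarrow> real^'n \<Rightarrow> real^'n \<Rightarrow> real" where
  "weight r x y = cut r (mul G (inv_el G x) y) / cut_int r"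

lemma cut_nonneg [simp]: "0 \<le> cut r h"
  by (simp add: cut_def)

lemma cut_le: "0 < r \<Longrightarrow> cut r h \<le> indicator {h. N h < r} h"
  by (auto simp: cut_def indicator_def field_simps)

lemma cut_le_1: "0 < r \<Longrightarrow> cut r h \<le> 1"
  by (simp add: cut_def)

lemma continuous_on_cut: "continuous_on S (cut r)"
  unfolding cut_def divide_inverse by (intro continuous_intros continuous_on_N)

lemma measurable_cut [measurable]: "cut r \<in> borel_measurable borel"
  by (intro borel_measurable_continuous_onI continuous_on_cut)

lemma integrable_N_less: "integrable lborel (indicator {h. N h < r} :: _ \<Rightarrow> real)"
  using emeasure_N_less_finite[of r] by (intro integrable_real_indicator) auto

lemma integrable_cut:
  assumes "0 < r"
  shows "integrable lborel (cut r)"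
  by (rule Bochner_Integration.integrable_bound[OF integrable_N_less[of r]])
     (use cut_le[OF assms] in auto)

text \<open>The tent is at least 1/2 on the ball of half the radius, so its integral is at least of
  order r^Q.\<close>

lemma cut_int_ge:
  assumes "0 < r"
  shows "(1/2) * ((r / 2) powr Q * unit_ball_volume) \<le> cut_int r"
proof -
  have m: "measure lborel {h. N h < r / 2} = (r / 2) powr Q * unit_ball_volume"
    using emeasure_N_less[of "r / 2"] assms unit_ball_volume_pos by (simp add: measure_def)
  have "(1/2) * measure lborel {h. N h < r / 2} = (\<integral>h. (1/2) * indicator {h. N h < r / 2} h \<partial>lborel)"
    by simp
  also have "\<dots> \<le> (\<integral>h. cut r h \<partial>lborel)"
  proof (rule integral_mono)
    show "integrable lborel (\<lambda>h. (1/2) * indicator {h. N h < r / 2} h :: real)"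
      by (intro integrable_mult_right integrable_N_less)
    show "(1/2) * indicator {h. N h < r / 2} h \<le> cut r h" for h
      using assms by (auto simp: cut_def indicator_def field_simps)
  qed (rule integrable_cut[OF assms])
  finally show ?thesis by (simp only: cut_int_def m)
qed

lemma cut_int_pos: "0 < r \<Longrightarrow> 0 < cut_int r"
  using unit_ball_volume_pos by (intro less_le_trans[OF _ cut_int_ge]) auto

lemma weight_nonneg: "0 < r \<Longrightarrow> 0 \<le> weight r x y"
  using cut_int_pos[of r] by (simp add: weight_def)

lemma weight_le: "0 < r \<Longrightarrow> weight r x y \<le> 1 / cut_int r"
  using cut_int_pos[of r] cut_le_1[of r] by (simp add: weight_def divide_right_mono)

lemma integrable_weight:
  assumes "0 < r"
  shows "integrable lborel (weight r x)" "(\<integral>y. weight r x y \<partial>lborel) = 1"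
proof -
  have "integrable lborel (\<lambda>y. cut r (mul G (inv_el G x) y))"
    using integrable_distr_eq[of "mul G (inv_el G x)" lborel borel "cut r"] integrable_cut[OF assms]
    by (simp add: distr_mul)
  then show "integrable lborel (weight r x)" by (simp add: weight_def[abs_def])
  have "(\<integral>y. cut r (mul G (inv_el G x) y) \<partial>lborel) = cut_int r"
    using integral_distr[of "mul G (inv_el G x)" lborel borel "cut r"]
    by (simp add: distr_mul cut_int_def)
  then show "(\<integral>y. weight r x y \<partial>lborel) = 1"
    using cut_int_pos[OF assms] by (simp add: weight_def[abs_def])
qed

lemma continuous_on_weight: "continuous_on S (\<lambda>z. weight r (fst z) (snd z))"
proof -
  have "continuous_on S (\<lambda>z. (inv_el G (fst z), snd z))"
    by (intro continuous_on_Pair continuous_on_compose2[OF continuous_on_inv] continuous_on_snd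
        continuous_on_fst continuous_on_id) auto
  from continuous_on_compose2[OF continuous_on_mul this]
  have "continuous_on S (\<lambda>z. mul G (inv_el G (fst z)) (snd z))" by simp
  from continuous_on_compose2[OF continuous_on_cut this, of UNIV r] show ?thesis
    unfolding weight_def divide_inverse by (intro continuous_on_mult continuous_on_const) auto
qed

lemma measurable_weight [measurable]:
  "(\<lambda>z. weight r (fst z) (snd z)) \<in> borel_measurable (lborel \<Otimes>\<^sub>M lborel)"
  unfolding lborel_prod measurable_lborel2
  by (intro borel_measurable_continuous_onI continuous_on_weight)

lemma measurable_weight2 [measurable]: "weight r x \<in> borel_measurable borel"
  unfolding weight_def[abs_def] by measurable

end

context fractional_energy
begin

definition avg :: "real \<Rightarrow> (real^'n \<Rightarrow> real) \<Rightarrow> real^'n \<Rightarrow> real" where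
  "avg r u x = (\<integral>y. weight r x y * u y \<partial>lborel)"

lemma measurable_avg [measurable]:
  assumes [measurable]: "u \<in> borel_measurable borel"
  shows "avg r u \<in> borel_measurable borel"
proof -
  have "(\<lambda>x. \<integral>y. weight r x y * u y \<partial>lborel) \<in> borel_measurable lborel"
    by (rule lborel.borel_measurable_lebesgue_integral) (simp add: case_prod_beta')
  then show ?thesis by (simp add: avg_def[abs_def])
qed

lemma abs_le_1_powr: "\<bar>t\<bar> \<le> 1 + \<bar>t\<bar> powr p" for t :: real
proof (cases "\<bar>t\<bar> \<le> 1")
  case False
  then have "\<bar>t\<bar> powr 1 \<le> \<bar>t\<bar> powr p" using p by (intro powr_mono) auto
  then show ?thesis using False by simp
qed (simp add: add_increasing2)

lemma integrable_weight_Lp: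
  assumes r: "0 < r" and u: "u \<in> Lp lborel p"
  shows "integrable lborel (\<lambda>y. weight r x y * u y)"
    "integrable lborel (\<lambda>y. weight r x y * \<bar>u y\<bar> powr p)"
proof -
  have [measurable]: "u \<in> borel_measurable borel" using u by (simp add: Lp_def)
  show int: "integrable lborel (\<lambda>y. weight r x y * \<bar>u y\<bar> powr p)"
  proof (rule Bochner_Integration.integrable_bound)
    show "integrable lborel (\<lambda>y. 1 / cut_int r * \<bar>u y\<bar> powr p)"
      using Lp_integrable[OF u] by (rule integrable_mult_right)
    show "AE y in lborel. norm (weight r x y * \<bar>u y\<bar> powr p) \<le> norm (1 / cut_int r * \<bar>u y\<bar> powr p)"
      using weight_nonneg[OF r] weight_le[OF r] cut_int_pos[OF r]
      by (intro AE_I2) (simp add: abs_mult mult_right_mono del: times_divide_eq_left)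
  qed simp
  show "integrable lborel (\<lambda>y. weight r x y * u y)"
  proof (rule Bochner_Integration.integrable_bound)
    show "integrable lborel (\<lambda>y. weight r x y + weight r x y * \<bar>u y\<bar> powr p)"
      using integrable_weight(1)[OF r] int by (rule Bochner_Integration.integrable_add)
    show "AE y in lborel. norm (weight r x y * u y) \<le> norm (weight r x y + weight r x y * \<bar>u y\<bar> powr p)"
    proof (rule AE_I2)
      fix y
      have "weight r x y * \<bar>u y\<bar> \<le> weight r x y * (1 + \<bar>u y\<bar> powr p)"
        using weight_nonneg[OF r] by (intro mult_left_mono abs_le_1_powr)
      then show "norm (weight r x y * u y) \<le> norm (weight r x y + weight r x y * \<bar>u y\<bar> powr p)"
        using weight_nonneg[OF r, of x y] by (simp add: abs_mult distrib_left)
    qed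
  qed simp
qed

text \<open>Jensen's inequality moves the p-th power inside the average of u(x) - u(y). The weight
  is at most \<open>1 / cut_int r\<close> and vanishes at distance r or more; at smaller positive
  distances the kernel is at most r^(Q+ps), so the difference is controlled by the quotient.\<close>

lemma avg_error_pointwise:
  assumes r: "0 < r" and u: "u \<in> Lp lborel p"
  shows "ennreal (\<bar>u x - avg r u x\<bar> powr p)
    \<le> ennreal (r powr (Q + p * s) / cut_int r) * (\<integral>\<^sup>+y. ennreal (\<bar>quot u (x, y)\<bar> powr p) \<partial>lborel)"
proof -
  note [measurable] = u
  have um[measurable]: "u \<in> borel_measurable borel" using u by (simp add: Lp_def)
  have qm[measurable]: "(\<lambda>y. quot u (x, y)) \<in> borel_measurable borel"
    using measurable_quot[OF um] by simp
  have int1: "integrable lborel (\<lambda>y. weight r x y * (u x - u y))"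
    using integrable_weight(1)[OF r] integrable_weight_Lp(1)[OF r u]
    by (simp add: right_diff_distrib)
  have int2: "integrable lborel (\<lambda>y. weight r x y * \<bar>u x - u y\<bar> powr p)"
  proof (rule Bochner_Integration.integrable_bound)
    show "integrable lborel (\<lambda>y. 2 powr p * (weight r x y * \<bar>u x\<bar> powr p + weight r x y * \<bar>u y\<bar> powr p))"
      using integrable_weight(1)[OF r] integrable_weight_Lp(2)[OF r u] by auto
    show "AE y in lborel. norm (weight r x y * \<bar>u x - u y\<bar> powr p)
        \<le> norm (2 powr p * (weight r x y * \<bar>u x\<bar> powr p + weight r x y * \<bar>u y\<bar> powr p))"
    proof (rule AE_I2)
      fix y
      have "weight r x y * \<bar>u x - u y\<bar> powr p \<le> weight r x y * (2 powr p * (\<bar>u x\<bar> powr p + \<bar>u y\<bar> powr p))"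
        using weight_nonneg[OF r] abs_powr_add_le[of p "u x" "- u y"] p by (intro mult_left_mono) auto
      then show "norm (weight r x y * \<bar>u x - u y\<bar> powr p)
        \<le> norm (2 powr p * (weight r x y * \<bar>u x\<bar> powr p + weight r x y * \<bar>u y\<bar> powr p))"
        using weight_nonneg[OF r, of x y] by (simp add: abs_mult algebra_simps)
    qed
  qed simp
  have "(\<integral>y. weight r x y * (u x - u y) \<partial>lborel) = u x - avg r u x"
    using integrable_weight[OF r, of x] integrable_weight_Lp(1)[OF r u, of x]
    by (simp add: right_diff_distrib avg_def)
  then have "\<bar>u x - avg r u x\<bar> powr p \<le> (\<integral>y. weight r x y * \<bar>u x - u y\<bar> powr p \<partial>lborel)"
    using weighted_Jensen_abs_powr[OF p weight_nonneg[OF r] integrable_weight[OF r] int1 int2] by simp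
  then have "ennreal (\<bar>u x - avg r u x\<bar> powr p) \<le> ennreal (\<integral>y. weight r x y * \<bar>u x - u y\<bar> powr p \<partial>lborel)"
    by (rule ennreal_leI)
  also have "\<dots> = (\<integral>\<^sup>+y. ennreal (weight r x y * \<bar>u x - u y\<bar> powr p) \<partial>lborel)"
    using weight_nonneg[OF r] by (intro nn_integral_eq_integral[symmetric] int2) auto
  also have "\<dots> \<le> (\<integral>\<^sup>+y. ennreal (r powr (Q + p * s) / cut_int r) * ennreal (\<bar>quot u (x, y)\<bar> powr p) \<partial>lborel)"
  proof (rule nn_integral_mono)
    fix y
    let ?d = "N (mul G (inv_el G x) y)"
    have "weight r x y * \<bar>u x - u y\<bar> powr p \<le> r powr (Q + p * s) / cut_int r * \<bar>quot u (x, y)\<bar> powr p"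
    proof (cases "?d = 0 \<or> r \<le> ?d")
      case True
      then have "weight r x y * \<bar>u x - u y\<bar> powr p = 0"
      proof
        assume "?d = 0"
        then have "mul G (inv_el G x) y = 0" by simp
        then have "x = y" by (metis mul_inv_mul(2) mul_right_0)
        then show ?thesis by simp
      next
        assume "r \<le> ?d"
        then show ?thesis using r by (simp add: weight_def cut_def)
      qed
      moreover have "0 \<le> r powr (Q + p * s) / cut_int r * \<bar>quot u (x, y)\<bar> powr p"
        using cut_int_pos[OF r] by simp
      ultimately show ?thesis by presburger
    next
      case False
      then have d: "0 < ?d" "?d < r" using N_nonneg[of "mul G (inv_el G x) y"] by linarith+
      have "?d powr (Q + p * s) \<le> r powr (Q + p * s)"
        using d Q_pos ps_pos by (intro powr_mono2) auto
      then have "1 \<le> r powr (Q + p * s) / ?d powr (Q + p * s)" using d by (simp add: pos_le_divide_eq)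
      then have "1 * \<bar>u x - u y\<bar> powr p \<le> r powr (Q + p * s) / ?d powr (Q + p * s) * \<bar>u x - u y\<bar> powr p"
        by (intro mult_right_mono) auto
      also have "\<dots> = r powr (Q + p * s) * \<bar>quot u (x, y)\<bar> powr p"
        by (simp add: abs_quot_powr kernel_def N_commute[of y x])
      finally have *: "\<bar>u x - u y\<bar> powr p \<le> r powr (Q + p * s) * \<bar>quot u (x, y)\<bar> powr p" by simp
      have "weight r x y * \<bar>u x - u y\<bar> powr p \<le> 1 / cut_int r * (r powr (Q + p * s) * \<bar>quot u (x, y)\<bar> powr p)"
        using weight_le[OF r, of x y] * cut_int_pos[OF r] by (intro mult_mono) auto
      then show ?thesis by simp
    qed
    then show "ennreal (weight r x y * \<bar>u x - u y\<bar> powr p)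
        \<le> ennreal (r powr (Q + p * s) / cut_int r) * ennreal (\<bar>quot u (x, y)\<bar> powr p)"
      using cut_int_pos[OF r] by (subst ennreal_mult'[symmetric]) (auto intro: ennreal_leI)
  qed
  also have "\<dots> = ennreal (r powr (Q + p * s) / cut_int r) * (\<integral>\<^sup>+y. ennreal (\<bar>quot u (x, y)\<bar> powr p) \<partial>lborel)"
    by (rule nn_integral_cmult) measurable
  finally show ?thesis .
qed

lemma avg_error:
  assumes r: "0 < r" and u: "u \<in> finite_energy \<Omega>"
  shows "(\<lambda>x. u x - avg r u x) \<in> Lp lborel p"
    "P (\<lambda>x. u x - avg r u x) \<le> r powr (Q + p * s) / cut_int r * E u"
proof -
  have [measurable]: "u \<in> borel_measurable borel" using finite_energyD(4)[OF u] .
  have "(\<integral>\<^sup>+x. ennreal (\<bar>u x - avg r u x\<bar> powr p) \<partial>lborel)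
      \<le> (\<integral>\<^sup>+x. ennreal (r powr (Q + p * s) / cut_int r) * (\<integral>\<^sup>+y. ennreal (\<bar>quot u (x, y)\<bar> powr p) \<partial>lborel) \<partial>lborel)"
    by (intro nn_integral_mono avg_error_pointwise r finite_energyD(1)[OF u])
  also have "\<dots> = ennreal (r powr (Q + p * s) / cut_int r) * (\<integral>\<^sup>+x. \<integral>\<^sup>+y. ennreal (\<bar>quot u (x, y)\<bar> powr p) \<partial>lborel \<partial>lborel)"
    by (rule nn_integral_cmult) measurable
  also have "(\<integral>\<^sup>+x. \<integral>\<^sup>+y. ennreal (\<bar>quot u (x, y)\<bar> powr p) \<partial>lborel \<partial>lborel) = (\<integral>\<^sup>+z. ennreal (\<bar>quot u z\<bar> powr p) \<partial>M2)"
    by (rule lborel.nn_integral_fst) measurable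
  also have "\<dots> = ennreal (E u)" by (rule nn_integral_Lp_int[OF finite_energyD(2)[OF u]])
  also have "ennreal (r powr (Q + p * s) / cut_int r) * ennreal (E u) = ennreal (r powr (Q + p * s) / cut_int r * E u)"
    using cut_int_pos[OF r] by (intro ennreal_mult'[symmetric]) auto
  finally have le: "(\<integral>\<^sup>+x. ennreal (\<bar>u x - avg r u x\<bar> powr p) \<partial>lborel) \<le> ennreal (r powr (Q + p * s) / cut_int r * E u)" .
  have "integrable lborel (\<lambda>x. \<bar>u x - avg r u x\<bar> powr p)"
    using le by (intro integrableI_bounded) (auto simp: less_top[symmetric] top_unique)
  then show L: "(\<lambda>x. u x - avg r u x) \<in> Lp lborel p" by (simp add: Lp_def)
  show "P (\<lambda>x. u x - avg r u x) \<le> r powr (Q + p * s) / cut_int r * E u"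
    using le cut_int_pos[OF r] unfolding nn_integral_Lp_int[OF L] by simp
qed

lemma avg_error_small:
  assumes "0 < e" "0 \<le> B"
  obtains r where "0 < r"
    "\<And>u \<Omega>. u \<in> finite_energy \<Omega> \<Longrightarrow> E u \<le> B \<Longrightarrow> P (\<lambda>x. u x - avg r u x) \<le> e"
proof -
  \<comment> \<open>\<open>C\<close> expresses that \<open>cut_int r\<close> is at least r^Q / C.
    The error factor is then at most C r^(ps), and \<open>r\<close> makes this equal to e / (B +
    1).\<close>
  define C where "C = 2 * 2 powr Q / unit_ball_volume"
  have C: "0 < C" using unit_ball_volume_pos by (simp add: C_def)
  define r where "r = (e / (C * (B + 1))) powr (1 / (p * s))"
  have r: "0 < r" using assms C by (simp add: r_def)
  have rps: "r powr (p * s) = e / (C * (B + 1))"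
    using assms C s p by (simp add: r_def powr_powr)
  have "r powr (Q + p * s) / cut_int r \<le> C * r powr (p * s)"
  proof -
    have "r powr Q \<le> C * cut_int r"
      using cut_int_ge[OF r] r unit_ball_volume_pos by (simp add: C_def powr_divide field_simps)
    then have "r powr Q * r powr (p * s) \<le> C * cut_int r * r powr (p * s)"
      by (intro mult_right_mono) auto
    then show ?thesis using cut_int_pos[OF r] by (simp add: powr_add field_simps)
  qed
  then have fac: "r powr (Q + p * s) / cut_int r \<le> e / (B + 1)"
    using C assms by (simp add: rps)
  have "P (\<lambda>x. u x - avg r u x) \<le> e" if u: "u \<in> finite_energy \<Omega>" "E u \<le> B" for u \<Omega>
  proof -
    have "P (\<lambda>x. u x - avg r u x) \<le> e / (B + 1) * E u"
      using avg_error(2)[OF r u(1)] mult_right_mono[OF fac, of "E u"] by simp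
    also have "\<dots> \<le> e / (B + 1) * (B + 1)" using u assms by (intro mult_left_mono) auto
    finally show ?thesis using assms by simp
  qed
  with r that show ?thesis by blast
qed

text \<open>On the bounded set \<Omega> the estimate |t| \<le> 1 + |t|^p passes from p-th means to
  first means.\<close>

lemma integral_abs_le_P:
  assumes \<Omega>: "open \<Omega>" "bounded \<Omega>" and u: "u \<in> finite_energy \<Omega>"
  shows "integrable lborel u" "(\<integral>y. \<bar>u y\<bar> \<partial>lborel) \<le> measure lborel \<Omega> + P u"
proof -
  have [measurable]: "u \<in> borel_measurable borel" "\<Omega> \<in> sets borel" using finite_energyD(4)[OF u] \<Omega> by auto
  have int: "integrable lborel (\<lambda>y. indicator \<Omega> y + \<bar>u y\<bar> powr p)"
    using emeasure_bounded_finite[OF \<Omega>(2)] Lp_integrable[OF finite_energyD(1)[OF u]] by auto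
  have le: "\<bar>u y\<bar> \<le> indicator \<Omega> y + \<bar>u y\<bar> powr p" for y
    using abs_le_1_powr[of "u y"] finite_energyD(3)[OF u, of y] by (cases "y \<in> \<Omega>") auto
  show iu: "integrable lborel u"
    by (rule Bochner_Integration.integrable_bound[OF int]) (use le in auto)
  have "(\<integral>y. \<bar>u y\<bar> \<partial>lborel) \<le> (\<integral>y. indicator \<Omega> y + \<bar>u y\<bar> powr p \<partial>lborel)"
    using iu int le by (intro integral_mono) auto
  also have "\<dots> = measure lborel \<Omega> + P u"
    using emeasure_bounded_finite[OF \<Omega>(2)] Lp_integrable[OF finite_energyD(1)[OF u]]
    by (simp add: Lp_int_def)
  finally show "(\<integral>y. \<bar>u y\<bar> \<partial>lborel) \<le> measure lborel \<Omega> + P u" .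
qed

text \<open>Arzela-Ascoli on the closure of \<Omega>. The first means of u n are bounded, so a
  bounded weight bounds the averages, and uniform continuity of the weight on a compact product
  makes them equicontinuous; points outside \<Omega> do not contribute to the averages.\<close>

lemma avg_uniformly_convergent_subseq:
  assumes \<Omega>: "open \<Omega>" "bounded \<Omega>" and u: "\<And>n. u n \<in> finite_energy \<Omega>" and B: "\<And>n. P (u n) \<le> B"
    and r: "0 < r"
  obtains k g where "strict_mono (k :: nat \<Rightarrow> nat)"
    "\<And>e. 0 < e \<Longrightarrow> \<exists>n0. \<forall>n x. n0 \<le> n \<and> x \<in> closure \<Omega> \<longrightarrow> \<bar>avg r (u (k n)) x - g x\<bar> < e"
proof -
  define K where "K = closure \<Omega>"
  have K: "compact K" using \<Omega>(2) by (simp add: K_def compact_closure)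
  define m where "m = measure lborel \<Omega> + B"
  have um: "(\<integral>y. \<bar>u n y\<bar> \<partial>lborel) \<le> m" for n
    using integral_abs_le_P(2)[OF \<Omega> u[of n]] B[of n] by (simp add: m_def)
  have m0: "0 \<le> m" using um[of 0] by (rule order_trans[rotated]) simp
  have iu: "integrable lborel (u n)" for n using integral_abs_le_P(1)[OF \<Omega> u] .
  have iw: "integrable lborel (\<lambda>y. weight r x y * u n y)" for n x
    by (rule integrable_weight_Lp(1)[OF r finite_energyD(1)[OF u]])
  have bound: "norm (avg r (u n) x) \<le> 1 / cut_int r * m" for n x
  proof -
    have "norm (avg r (u n) x) \<le> (\<integral>y. norm (weight r x y * u n y) \<partial>lborel)"
      unfolding avg_def by (rule integral_norm_bound)
    also have "\<dots> \<le> (\<integral>y. 1 / cut_int r * \<bar>u n y\<bar> \<partial>lborel)"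
      using iw iu weight_le[OF r] weight_nonneg[OF r]
      by (intro integral_mono integrable_mult_right integrable_norm integrable_abs)
         (auto simp: abs_mult mult_right_mono simp del: times_divide_eq_left)
    also have "\<dots> = 1 / cut_int r * (\<integral>y. \<bar>u n y\<bar> \<partial>lborel)" by (rule integral_mult_right_zero)
    also have "\<dots> \<le> 1 / cut_int r * m" using um cut_int_pos[OF r] by (intro mult_left_mono) auto
    finally show ?thesis .
  qed
  have equi: "\<exists>d. 0 < d \<and> (\<forall>n y. y \<in> K \<and> norm (x - y) < d \<longrightarrow> norm (avg r (u n) x - avg r (u n) y) < e)"
    if x: "x \<in> K" and e: "0 < e" for x e
  proof -
    have "uniformly_continuous_on (K \<times> K) (\<lambda>z. weight r (fst z) (snd z))"
      using K by (intro compact_uniformly_continuous continuous_on_weight compact_Times)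
    moreover have "0 < e / (m + 1)" using e m0 by simp
    ultimately obtain d where d: "0 < d" "\<And>z z'. z \<in> K \<times> K \<Longrightarrow> z' \<in> K \<times> K \<Longrightarrow> dist z' z < d \<Longrightarrow>
        dist (weight r (fst z') (snd z')) (weight r (fst z) (snd z)) < e / (m + 1)"
      unfolding uniformly_continuous_on_def by blast
    have "norm (avg r (u n) x - avg r (u n) x') < e" if x': "x' \<in> K" "norm (x - x') < d" for n x'
    proof -
      have "norm (avg r (u n) x - avg r (u n) x') = norm (\<integral>y. weight r x y * u n y - weight r x' y * u n y \<partial>lborel)"
        using iw by (simp add: avg_def)
      also have "\<dots> \<le> (\<integral>y. norm (weight r x y * u n y - weight r x' y * u n y) \<partial>lborel)"
        by (rule integral_norm_bound)
      also have "\<dots> \<le> (\<integral>y. e / (m + 1) * \<bar>u n y\<bar> \<partial>lborel)"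
      proof (rule integral_mono)
        show "integrable lborel (\<lambda>y. norm (weight r x y * u n y - weight r x' y * u n y))"
          by (intro integrable_norm Bochner_Integration.integrable_diff iw)
        show "integrable lborel (\<lambda>y. e / (m + 1) * \<bar>u n y\<bar>)"
          by (intro integrable_mult_right integrable_abs iu)
        fix y
        show "norm (weight r x y * u n y - weight r x' y * u n y) \<le> e / (m + 1) * \<bar>u n y\<bar>"
        proof (cases "y \<in> \<Omega>")
          case True
          then have "y \<in> K" using closure_subset[of \<Omega>] by (auto simp: K_def)
          then have "\<bar>weight r x y - weight r x' y\<bar> \<le> e / (m + 1)"
            using d(2)[of "(x', y)" "(x, y)"] x x' by (simp add: dist_Pair_Pair dist_norm)
          then have "\<bar>weight r x y - weight r x' y\<bar> * \<bar>u n y\<bar> \<le> e / (m + 1) * \<bar>u n y\<bar>"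
            by (intro mult_right_mono) auto
          then show ?thesis by (simp add: left_diff_distrib[symmetric] abs_mult)
        next
          case False then show ?thesis using finite_energyD(3)[OF u] by simp
        qed
      qed
      also have "\<dots> = e / (m + 1) * (\<integral>y. \<bar>u n y\<bar> \<partial>lborel)" by (rule integral_mult_right_zero)
      also have "\<dots> \<le> e / (m + 1) * m" using um e m0 by (intro mult_left_mono) auto
      also have "\<dots> < e" using e m0 by (simp add: field_simps)
      finally show ?thesis .
    qed
    with d(1) show ?thesis by blast
  qed
  obtain g k where "continuous_on K g" "strict_mono (k :: nat \<Rightarrow> nat)"
    "\<And>e. 0 < e \<Longrightarrow> \<exists>n0. \<forall>n x. n \<ge> n0 \<and> x \<in> K \<longrightarrow> norm (avg r (u (k n)) x - g x) < e"
    using Arzela_Ascoli[of K "\<lambda>n. avg r (u n)", OF K bound equi] by blast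
  then show ?thesis using that[of k g] by (simp add: K_def)
qed

text \<open>A difference of two terms is split into two averaging errors, small by the energy bound
  for small r, and a difference of averages, uniformly small along a subsequence. The radius, and
  with it the subsequence, depends on the tolerance.\<close>

lemma Lp_Cauchy_step:
  assumes \<Omega>: "open \<Omega>" "bounded \<Omega>" and u: "\<And>n. u n \<in> finite_energy \<Omega>"
    and B: "\<And>n. P (u n) \<le> B" "\<And>n. E (u n) \<le> B" and e: "0 < e"
  shows "\<exists>k. strict_mono (k :: nat \<Rightarrow> nat) \<and> (\<exists>n0. \<forall>m\<ge>n0. \<forall>n\<ge>n0. P (\<lambda>x. u (k m) x - u (k n) x) < e)"
proof -
  define \<kappa> :: real where "\<kappa> = 2 powr p * 2 powr p"
  have \<kappa>: "0 < \<kappa>" by (simp add: \<kappa>_def)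
  have B0: "0 \<le> B" using B(1)[of 0] Lp_int_nonneg order_trans by blast
  \<comment> \<open>Combining the three pieces will cost 3 \<kappa> \<eta> = 3 e / 4 in
    total.\<close>
  define \<eta> where "\<eta> = e / (4 * \<kappa>)"
  have \<eta>: "0 < \<eta>" using e \<kappa> by (simp add: \<eta>_def)
  obtain r where r: "0 < r" "\<And>u \<Omega>. u \<in> finite_energy \<Omega> \<Longrightarrow> E u \<le> B \<Longrightarrow> P (\<lambda>x. u x - avg r u x) \<le> \<eta>"
    using avg_error_small[OF \<eta> B0] by metis
  obtain k g where k: "strict_mono (k :: nat \<Rightarrow> nat)"
    "\<And>e. 0 < e \<Longrightarrow> \<exists>n0. \<forall>n x. n0 \<le> n \<and> x \<in> closure \<Omega> \<longrightarrow> \<bar>avg r (u (k n)) x - g x\<bar> < e"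
    using avg_uniformly_convergent_subseq[of \<Omega> u B r, OF \<Omega> u B(1) r(1)] by blast
  define vol where "vol = measure lborel \<Omega>"
  \<comment> \<open>A function bounded by \<open>t\<close> on \<Omega> has p-th mean at most \<eta>;
    the added 1 keeps the quotient defined for every volume.\<close>
  define t where "t = (\<eta> / (vol + 1)) powr (1 / p)"
  have vol: "0 \<le> vol" by (simp add: vol_def)
  have t: "0 < t" using \<eta> vol by (simp add: t_def)
  have tp: "t powr p * vol \<le> \<eta>"
  proof -
    have "t powr p = \<eta> / (vol + 1)" using \<eta> vol p by (simp add: t_def powr_powr)
    then have "t powr p * (vol + 1) = \<eta>" using vol by simp
    moreover have "t powr p * vol \<le> t powr p * (vol + 1)" by (intro mult_left_mono) auto
    ultimately show ?thesis by simp
  qed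
  obtain n0 where n0: "\<And>n x. n0 \<le> n \<Longrightarrow> x \<in> closure \<Omega> \<Longrightarrow> \<bar>avg r (u (k n)) x - g x\<bar> < t / 2"
    using k(2)[of "t / 2"] t by auto
  have [measurable]: "\<Omega> \<in> sets borel" using \<Omega> by simp
  have [measurable]: "u n \<in> borel_measurable borel" for n using finite_energyD(4)[OF u] .
  have "P (\<lambda>x. u (k m) x - u (k n) x) < e" if mn: "n0 \<le> m" "n0 \<le> n" for m n
  proof -
    \<comment> \<open>Everything is cut off to \<Omega>: the averages may be nonzero outside it,
      while their uniform convergence is known only on its closure.\<close>
    define a where "a j x = indicator \<Omega> x * (u j x - avg r (u j) x)" for j x
    have aL: "a j \<in> Lp lborel p" "P (a j) \<le> \<eta>" for j
    proof -
      have le: "AE x in lborel. \<bar>a j x\<bar> \<le> \<bar>u j x - avg r (u j) x\<bar>"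
        by (simp add: a_def indicator_def)
      have meas: "a j \<in> borel_measurable lborel" unfolding a_def by measurable
      show "a j \<in> Lp lborel p"
        by (rule Lp_dominated(1)[OF meas avg_error(1)[OF r(1) u] le]) (use p in simp)
      have "P (a j) \<le> P (\<lambda>x. u j x - avg r (u j) x)"
        by (rule Lp_dominated(2)[OF meas avg_error(1)[OF r(1) u] le]) (use p in simp)
      then show "P (a j) \<le> \<eta>" using r(2)[OF u B(2), of j] by linarith
    qed
    define c where "c x = indicator \<Omega> x * (avg r (u (k m)) x - avg r (u (k n)) x)" for x
    have ind: "(\<lambda>x. t * indicator \<Omega> x) \<in> Lp lborel p" "P (\<lambda>x. t * indicator \<Omega> x) = t powr p * vol"
    proof -
      have eq: "(indicator \<Omega> x :: real) powr p = indicator \<Omega> x" for x :: "real^'n"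
        by (simp add: indicator_def)
      have "(indicator \<Omega> :: real^'n \<Rightarrow> real) \<in> Lp lborel p"
        using emeasure_bounded_finite[OF \<Omega>(2)] by (simp add: Lp_def eq)
      then show "(\<lambda>x. t * indicator \<Omega> x) \<in> Lp lborel p" by (rule Lp_cmult)
      show "P (\<lambda>x. t * indicator \<Omega> x) = t powr p * vol"
        unfolding Lp_int_cmult using t by (simp add: Lp_int_def eq vol_def)
    qed
    have cle: "AE x in lborel. \<bar>c x\<bar> \<le> \<bar>t * indicator \<Omega> x\<bar>"
    proof (rule AE_I2)
      fix x
      show "\<bar>c x\<bar> \<le> \<bar>t * indicator \<Omega> x\<bar>"
      proof (cases "x \<in> \<Omega>")
        case True
        then have "x \<in> closure \<Omega>" using closure_subset by blast
        then have "\<bar>avg r (u (k m)) x - avg r (u (k n)) x\<bar> \<le> t"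
          using n0[OF mn(1), of x] n0[OF mn(2), of x] by linarith
        then show ?thesis using True t by (simp add: c_def)
      qed (simp add: c_def)
    qed
    have meas: "c \<in> borel_measurable lborel" unfolding c_def by measurable
    have cL: "c \<in> Lp lborel p" "P c \<le> \<eta>"
      using Lp_dominated[OF meas ind(1) cle] p tp ind(2) by auto
    have eq: "(\<lambda>x. u (k m) x - u (k n) x) = (\<lambda>x. (a (k m) x + c x) - a (k n) x)"
    proof
      fix x
      show "u (k m) x - u (k n) x = (a (k m) x + c x) - a (k n) x"
        using finite_energyD(3)[OF u, of x] by (cases "x \<in> \<Omega>") (simp_all add: a_def c_def)
    qed
    have acL: "(\<lambda>x. a (k m) x + c x) \<in> Lp lborel p" "P (\<lambda>x. a (k m) x + c x) \<le> 2 powr p * (\<eta> + \<eta>)"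
      using Lp_add[OF aL(1) cL(1), of "k m"] p
        order_trans[OF Lp_int_add_le[OF aL(1) cL(1), of "k m"] mult_left_mono[OF add_mono[OF aL(2) cL(2)]]] by auto
    have "P (\<lambda>x. u (k m) x - u (k n) x) \<le> 2 powr p * (P (\<lambda>x. a (k m) x + c x) + P (a (k n)))"
      unfolding eq using p by (intro Lp_int_diff_le acL(1) aL(1)) auto
    also have "\<dots> \<le> 2 powr p * (2 powr p * (\<eta> + \<eta>) + \<eta>)"
      using acL(2) aL(2)[of "k n"] by (intro mult_left_mono add_mono) auto
    also have "\<dots> \<le> 2 powr p * (2 powr p * (\<eta> + \<eta>) + 2 powr p * \<eta>)"
      using \<eta> p ge_one_powr_ge_zero[of 2 p] by (intro mult_left_mono add_left_mono) auto
    also have "\<dots> = 3 * (\<kappa> * \<eta>)" by (simp add: \<kappa>_def algebra_simps)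
    also have "\<kappa> * \<eta> = e / 4" using \<kappa> by (simp add: \<eta>_def)
    finally show ?thesis using e by simp
  qed
  with k(1) show ?thesis by blast
qed

text \<open>Each tolerance has its own subsequence; the diagonal sequence through the tolerances 1 /
  (j + 1) serves them all.\<close>

lemma compact_embedding:
  assumes \<Omega>: "open \<Omega>" "bounded \<Omega>" and u: "\<And>n. u n \<in> finite_energy \<Omega>"
    and B: "\<And>n. P (u n) \<le> B" "\<And>n. E (u n) \<le> B"
  obtains r where "strict_mono (r :: nat \<Rightarrow> nat)"
    "\<And>e. 0 < e \<Longrightarrow> \<exists>n0. \<forall>m\<ge>n0. \<forall>n\<ge>n0. P (\<lambda>x. u (r m) x - u (r n) x) < e"
proof -
  define R where "R j k \<longleftrightarrow> (\<exists>n0. \<forall>m\<ge>n0. \<forall>n\<ge>n0. P (\<lambda>x. u (k m) x - u (k n) x) < inverse (real (Suc j)))"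
    for j and k :: "nat \<Rightarrow> nat"
  interpret subseqs R
  proof
    fix j and k :: "nat \<Rightarrow> nat" assume "strict_mono k"
    show "\<exists>r'. strict_mono r' \<and> R j (k \<circ> r')"
      using Lp_Cauchy_step[OF \<Omega>, of "\<lambda>n. u (k n)" B "inverse (real (Suc j))"] u B by (simp add: R_def)
  qed
  \<comment> \<open>A strictly increasing selection never lowers an index, so a tail estimate
    survives further thinning, as the diagonal argument demands.\<close>
  have sub: "R j (k \<circ> r)" if sr: "strict_mono r" and Rk: "R j k" for j k r
  proof -
    obtain n0 where n0: "\<And>m n. n0 \<le> m \<Longrightarrow> n0 \<le> n \<Longrightarrow> P (\<lambda>x. u (k m) x - u (k n) x) < inverse (real (Suc j))"
      using Rk unfolding R_def by blast
    show ?thesis unfolding R_def o_def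
    proof (intro exI[of _ n0] allI impI)
      fix m n assume "n0 \<le> m" "n0 \<le> n"
      then show "P (\<lambda>x. u (k (r m)) x - u (k (r n)) x) < inverse (real (Suc j))"
        using seq_suble[OF sr, of m] seq_suble[OF sr, of n] by (intro n0) auto
    qed
  qed
  have "\<exists>n0. \<forall>m\<ge>n0. \<forall>n\<ge>n0. P (\<lambda>x. u (diagseq m) x - u (diagseq n) x) < e" if "0 < e" for e
  proof -
    obtain j where j: "inverse (real (Suc j)) < e" using reals_Archimedean[OF \<open>0 < e\<close>] by blast
    have "R j (diagseq \<circ> (+) (Suc j))" by (rule diagseq_holds[OF sub])
    then obtain n0 where n0: "\<And>m n. n0 \<le> m \<Longrightarrow> n0 \<le> n \<Longrightarrow>
        P (\<lambda>x. u (diagseq (Suc j + m)) x - u (diagseq (Suc j + n)) x) < inverse (real (Suc j))"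
      unfolding R_def o_def by blast
    show ?thesis
    proof (intro exI[of _ "Suc j + n0"] allI impI)
      fix m n assume mn: "Suc j + n0 \<le> m" "Suc j + n0 \<le> n"
      then have "P (\<lambda>x. u (diagseq (Suc j + (m - Suc j))) x - u (diagseq (Suc j + (n - Suc j))) x) < inverse (real (Suc j))"
        by (intro n0) auto
      then show "P (\<lambda>x. u (diagseq m) x - u (diagseq n) x) < e" using mn j by simp
    qed
  qed
  with subseq_diagseq that show ?thesis by blast
qed

end

section \<open>The sphere and the infimum of the energy\<close>

lemma Lp_uniform_convexity:
  fixes p e :: real and M :: "'a measure"
  assumes p: "1 < p" and e: "0 < e"
  obtains K where "0 < K"
    "\<And>f g. f \<in> Lp M p \<Longrightarrow> g \<in> Lp M p \<Longrightarrow>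
      Lp_int M p (\<lambda>x. f x - g x) \<le> e * (Lp_int M p f + Lp_int M p g)
        + K * ((Lp_int M p f + Lp_int M p g) / 2 - Lp_int M p (\<lambda>x. (f x + g x) / 2))"
proof -
  obtain K where K: "0 < K"
    "\<And>a b :: real. \<bar>a - b\<bar> powr p \<le> e * (\<bar>a\<bar> powr p + \<bar>b\<bar> powr p)
        + K * ((\<bar>a\<bar> powr p + \<bar>b\<bar> powr p) / 2 - \<bar>(a + b) / 2\<bar> powr p)"
    using uniform_convexity_abs_powr[OF assms] by blast
  show ?thesis
  proof (rule that[OF K(1)])
    fix f g assume f: "f \<in> Lp M p" and g: "g \<in> Lp M p"
    have "(\<lambda>x. (1/2) * (f x + g x)) \<in> Lp M p" using p by (intro Lp_cmult Lp_add f g) auto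
    then have mid: "(\<lambda>x. (f x + g x) / 2) \<in> Lp M p" by simp
    have diff: "(\<lambda>x. f x - g x) \<in> Lp M p" using p by (intro Lp_diff f g) auto
    note int = Lp_integrable[OF f] Lp_integrable[OF g] Lp_integrable[OF mid] Lp_integrable[OF diff]
    have "Lp_int M p (\<lambda>x. f x - g x) \<le> (\<integral>x. e * (\<bar>f x\<bar> powr p + \<bar>g x\<bar> powr p)
        + K * ((\<bar>f x\<bar> powr p + \<bar>g x\<bar> powr p) / 2 - \<bar>(f x + g x) / 2\<bar> powr p) \<partial>M)"
      unfolding Lp_int_def
      by (intro integral_mono K(2) Bochner_Integration.integrable_add integrable_mult_right
          Bochner_Integration.integrable_diff integrable_divide int)
    also have "\<dots> = (\<integral>x. e * (\<bar>f x\<bar> powr p + \<bar>g x\<bar> powr p) \<partial>M)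
        + (\<integral>x. K * ((\<bar>f x\<bar> powr p + \<bar>g x\<bar> powr p) / 2 - \<bar>(f x + g x) / 2\<bar> powr p) \<partial>M)"
      by (intro Bochner_Integration.integral_add Bochner_Integration.integrable_add integrable_mult_right
          Bochner_Integration.integrable_diff integrable_divide int)
    also have "(\<integral>x. e * (\<bar>f x\<bar> powr p + \<bar>g x\<bar> powr p) \<partial>M) = e * (Lp_int M p f + Lp_int M p g)"
      unfolding Lp_int_def by (simp only: integral_mult_right_zero Bochner_Integration.integral_add[OF int(1,2)])
    also have "(\<integral>x. K * ((\<bar>f x\<bar> powr p + \<bar>g x\<bar> powr p) / 2 - \<bar>(f x + g x) / 2\<bar> powr p) \<partial>M)
        = K * (\<integral>x. (\<bar>f x\<bar> powr p + \<bar>g x\<bar> powr p) / 2 - \<bar>(f x + g x) / 2\<bar> powr p \<partial>M)"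
      by (rule integral_mult_right_zero)
    also have "(\<integral>x. (\<bar>f x\<bar> powr p + \<bar>g x\<bar> powr p) / 2 - \<bar>(f x + g x) / 2\<bar> powr p \<partial>M)
        = (\<integral>x. (\<bar>f x\<bar> powr p + \<bar>g x\<bar> powr p) / 2 \<partial>M) - Lp_int M p (\<lambda>x. (f x + g x) / 2)"
      unfolding Lp_int_def
      by (intro Bochner_Integration.integral_diff Bochner_Integration.integrable_add integrable_divide int)
    also have "(\<integral>x. (\<bar>f x\<bar> powr p + \<bar>g x\<bar> powr p) / 2 \<partial>M) = (Lp_int M p f + Lp_int M p g) / 2"
      unfolding Lp_int_def by (simp only: integral_divide_zero Bochner_Integration.integral_add[OF int(1,2)])
    finally show "Lp_int M p (\<lambda>x. f x - g x) \<le> e * (Lp_int M p f + Lp_int M p g)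
        + K * ((Lp_int M p f + Lp_int M p g) / 2 - Lp_int M p (\<lambda>x. (f x + g x) / 2))" .
  qed
qed

lemma Lp_Chebyshev:
  assumes v: "v \<in> Lp M p" and c: "0 < c" and p: "0 < p"
    and A: "A \<in> sets M" "\<And>x. x \<in> A \<Longrightarrow> c \<le> \<bar>v x\<bar>"
  shows "emeasure M A \<le> ennreal (Lp_int M p v / c powr p)"
proof -
  have "ennreal (c powr p) * emeasure M A = (\<integral>\<^sup>+x. ennreal (c powr p) * indicator A x \<partial>M)"
    using A by (simp add: nn_integral_cmult_indicator)
  also have "\<dots> \<le> (\<integral>\<^sup>+x. ennreal (\<bar>v x\<bar> powr p) \<partial>M)"
  proof (rule nn_integral_mono)
    fix x
    show "ennreal (c powr p) * indicator A x \<le> ennreal (\<bar>v x\<bar> powr p)"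
      using A(2)[of x] c p by (cases "x \<in> A") (auto intro!: ennreal_leI powr_mono2)
  qed
  also have "\<dots> = ennreal (Lp_int M p v)"
    unfolding Lp_int_def by (intro nn_integral_eq_integral Lp_integrable v) auto
  finally have "ennreal (1 / c powr p) * (ennreal (c powr p) * emeasure M A) \<le> ennreal (1 / c powr p) * ennreal (Lp_int M p v)"
    by (intro mult_left_mono) auto
  moreover have "ennreal (1 / c powr p) * ennreal (c powr p) = 1"
    using c by (simp flip: ennreal_mult')
  ultimately show ?thesis
    using c by (simp add: mult.assoc[symmetric]) (simp flip: ennreal_mult')
qed

context fractional_energy
begin

abbreviation \<Lambda> :: "(real^'n) set \<Rightarrow> real" where "\<Lambda> \<Omega> \<equiv> lambda1 G N s p \<Omega>"

lemma unit_sphere_iff: "u \<in> unit_sphere G N s p \<Omega> \<longleftrightarrow> u \<in> X \<Omega> \<and> P u = 1"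
proof (cases "u \<in> X \<Omega>")
  case True
  have "Lp_norm p \<Omega> u = P u powr (1/p)"
    using finite_energyD(3)[OF X_finite_energy[OF True]] by (intro Lp_norm_zero_outside)
  moreover have "P u powr (1/p) = 1 \<longleftrightarrow> P u = 1"
  proof
    assume "P u powr (1/p) = 1"
    then have "(P u powr (1/p)) powr p = 1" by simp
    then show "P u = 1" using p by (simp add: powr_powr)
  qed simp
  ultimately show ?thesis using True by (simp add: unit_sphere_def)
qed (simp add: unit_sphere_def)

lemma X_normalize:
  assumes u: "u \<in> X \<Omega>" "0 < P u"
  shows "(\<lambda>x. P u powr (- (1/p)) * u x) \<in> unit_sphere G N s p \<Omega>"
    "E (\<lambda>x. P u powr (- (1/p)) * u x) = E u / P u"
proof -
  have "- (1/p) * p = -1" using p by simp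
  then have "(P u powr (- (1/p))) powr p = 1 / P u"
    unfolding powr_powr using u by (simp add: powr_minus divide_inverse)
  then have *: "\<bar>P u powr (- (1/p))\<bar> powr p = 1 / P u" by simp
  show "(\<lambda>x. P u powr (- (1/p)) * u x) \<in> unit_sphere G N s p \<Omega>"
    unfolding unit_sphere_iff Lp_int_cmult * using u by (auto intro: X_cmult)
  show "E (\<lambda>x. P u powr (- (1/p)) * u x) = E u / P u"
    unfolding E_cmult * by simp
qed

lemma unit_sphere_nonempty:
  assumes "open \<Omega>" "\<Omega> \<noteq> {}"
  shows "unit_sphere G N s p \<Omega> \<noteq> {}"
proof -
  obtain f where f: "f \<in> test_functions \<Omega>" "\<And>x. 0 \<le> f x" "open {x. f x \<noteq> 0}" "{x. f x \<noteq> 0} \<noteq> {}"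
    using ex_test_function[OF assms] by blast
  have fX: "f \<in> X \<Omega>" using f(1) by (rule test_functions_X)
  note fL = finite_energyD(1)[OF X_finite_energy[OF fX]]
  have "P f \<noteq> 0"
  proof
    assume "P f = 0"
    then have "AE x in lborel. \<bar>f x\<bar> powr p = 0"
      using integral_nonneg_eq_0_iff_AE[OF Lp_integrable[OF fL]] by (simp add: Lp_int_def)
    then have "AE x in lborel. x \<notin> {x. f x \<noteq> 0}" by eventually_elim simp
    then have "emeasure lborel {x. f x \<noteq> 0} = 0"
      using f(3) by (subst (asm) AE_iff_measurable[of "{x. f x \<noteq> 0}"]) auto
    then show False using emeasure_lborel_open_nonempty[OF f(3,4)] by simp
  qed
  then have "0 < P f" using Lp_int_nonneg[of lborel p f] by linarith
  then show ?thesis using X_normalize(1)[OF fX] by blast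
qed

lemma lambda1_le: "u \<in> unit_sphere G N s p \<Omega> \<Longrightarrow> \<Lambda> \<Omega> \<le> E u"
  unfolding lambda1_def energy_eq by (rule cINF_lower) (auto intro!: bdd_belowI2[of _ 0])

text \<open>The homogeneous form of the variational principle, obtained by normalizing u. It allows
  midpoints, perturbations and truncations to be tested without returning to the sphere; for P u = 0
  it is the nonnegativity of the energy.\<close>

lemma lambda1_P_le:
  assumes u: "u \<in> X \<Omega>"
  shows "\<Lambda> \<Omega> * P u \<le> E u"
proof (cases "P u = 0")
  case False
  then have pos: "0 < P u" using Lp_int_nonneg[of lborel p u] by linarith
  then show ?thesis
    using lambda1_le[OF X_normalize(1)[OF u pos]] unfolding X_normalize(2)[OF u pos]
    by (simp add: pos_le_divide_eq)
qed simp

lemma lambda1_nonneg: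
  assumes "open \<Omega>" "\<Omega> \<noteq> {}"
  shows "0 \<le> \<Lambda> \<Omega>"
  unfolding lambda1_def energy_eq
  using unit_sphere_nonempty[OF assms] by (intro cINF_greatest) auto

text \<open>The Faber-Krahn inequality with all of \<Omega> as carrier and P u = 1. Openness gives
  \<Omega> positive measure, and \<open>FK\<close> does not involve \<Omega>.\<close>

lemma lambda1_lower_bound:
  assumes \<Omega>: "open \<Omega>" "\<Omega> \<noteq> {}" "bounded \<Omega>"
  shows "1 / FK * measure lborel \<Omega> powr (- (p * s / Q)) \<le> \<Lambda> \<Omega>"
  unfolding lambda1_def energy_eq
proof (rule cINF_greatest[OF unit_sphere_nonempty[OF \<Omega>(1,2)]])
  fix u assume "u \<in> unit_sphere G N s p \<Omega>"
  then have u: "u \<in> X \<Omega>" "P u = 1" by (auto simp: unit_sphere_iff)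
  note uF = X_finite_energy[OF u(1)]
  define V where "V = measure lborel \<Omega>"
  have em: "emeasure lborel \<Omega> = ennreal V"
    using emeasure_bounded_finite[OF \<Omega>(3)] by (simp add: V_def emeasure_eq_ennreal_measure less_top)
  have "V \<noteq> 0" using emeasure_lborel_open_nonempty[OF \<Omega>(1,2)] em by auto
  then have V: "0 < V" using measure_nonneg[of lborel \<Omega>] unfolding V_def by linarith
  have "P u \<le> FK * V powr (p * s / Q) * E u"
    by (rule Faber_Krahn(2)[OF _ _ V finite_energyD(4)[OF uF] finite_energyD(3)[OF uF] finite_energyD(2)[OF uF]])
       (use \<Omega>(1) em in auto)
  then have "1 / (FK * V powr (p * s / Q)) \<le> E u"
    using FK_pos V u(2) by (simp add: field_simps)
  then show "1 / FK * measure lborel \<Omega> powr (- (p * s / Q)) \<le> E u"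
    by (simp add: V_def[symmetric] powr_minus divide_inverse)
qed

section \<open>Closedness and completeness of the closure\<close>

lemma X_closed:
  assumes u: "u \<in> finite_energy \<Omega>" and w: "\<And>n. w n \<in> X \<Omega>"
    and P: "(\<lambda>n. P (\<lambda>x. u x - w n x)) \<longlonglongrightarrow> 0" and E: "(\<lambda>n. E (\<lambda>x. u x - w n x)) \<longlonglongrightarrow> 0"
  shows "u \<in> X \<Omega>"
proof -
  define R where "R n f \<longleftrightarrow> f \<in> test_functions \<Omega> \<and> P (\<lambda>x. w n x - f x) < inverse (real (Suc n))
      \<and> E (\<lambda>x. w n x - f x) < inverse (real (Suc n))" for n f
  have "\<forall>n. \<exists>f. R n f"
  proof
    fix n
    obtain f where f: "\<And>j. f j \<in> test_functions \<Omega>"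
      "(\<lambda>j. P (\<lambda>x. w n x - f j x)) \<longlonglongrightarrow> 0" "(\<lambda>j. E (\<lambda>x. w n x - f j x)) \<longlonglongrightarrow> 0"
      using w[of n] unfolding X0_iff by blast
    have "\<forall>\<^sub>F j in sequentially. P (\<lambda>x. w n x - f j x) < inverse (real (Suc n)) \<and> E (\<lambda>x. w n x - f j x) < inverse (real (Suc n))"
      using f(2,3) by (intro eventually_conj order_tendstoD(2)) auto
    then obtain j where "P (\<lambda>x. w n x - f j x) < inverse (real (Suc n)) \<and> E (\<lambda>x. w n x - f j x) < inverse (real (Suc n))"
      using eventually_happens by force
    then show "\<exists>f. R n f" using f(1) unfolding R_def by blast
  qed
  from choice[OF this] obtain f where "\<forall>n. R n (f n)" by blast
  then have f: "\<And>n. f n \<in> test_functions \<Omega>" "\<And>n. P (\<lambda>x. w n x - f n x) < inverse (real (Suc n))"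
    "\<And>n. E (\<lambda>x. w n x - f n x) < inverse (real (Suc n))" by (simp_all only: R_def)
  note wF = X_finite_energy[OF w] and fF = test_functions_finite_energy[OF f(1)]
  note fe = finite_energy_diff[OF u wF] finite_energy_diff[OF wF fF]
  have eq: "(\<lambda>x. u x - f n x) = (\<lambda>x. (u x - w n x) + 1 * (w n x - f n x))" for n by simp
  have wf: "(\<lambda>n. P (\<lambda>x. w n x - f n x)) \<longlonglongrightarrow> 0" "(\<lambda>n. E (\<lambda>x. w n x - f n x)) \<longlonglongrightarrow> 0"
    by (rule Lim_null_comparison[OF _ LIMSEQ_inverse_real_of_nat], use less_imp_le[OF f(2)] less_imp_le[OF f(3)] in simp)+
  have "(\<lambda>n. P (\<lambda>x. u x - f n x)) \<longlonglongrightarrow> 0"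
    unfolding eq by (rule P_lincomb_tendsto_0[OF fe P wf(1)])
  moreover have "(\<lambda>n. E (\<lambda>x. u x - f n x)) \<longlonglongrightarrow> 0"
    unfolding eq by (rule E_lincomb_tendsto_0[OF fe E wf(2)])
  ultimately show ?thesis unfolding X0_iff using u f(1) by blast
qed

text \<open>A subsequence converges almost everywhere, and Fatou's lemma in the second index of the
  Cauchy conditions bounds the distance to this one limit in both the p-th mean and the energy.
  Closedness then puts the limit into the space.\<close>

lemma X_complete:
  assumes v: "\<And>n. v n \<in> X \<Omega>"
    and CP: "\<And>e. 0 < e \<Longrightarrow> \<exists>n0. \<forall>m\<ge>n0. \<forall>n\<ge>n0. P (\<lambda>x. v m x - v n x) < e"
    and CE: "\<And>e. 0 < e \<Longrightarrow> \<exists>n0. \<forall>m\<ge>n0. \<forall>n\<ge>n0. E (\<lambda>x. v m x - v n x) < e"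
  obtains u r where "u \<in> X \<Omega>" "strict_mono (r :: nat \<Rightarrow> nat)"
    "(\<lambda>n. P (\<lambda>x. v (r n) x - u x)) \<longlonglongrightarrow> 0" "(\<lambda>n. E (\<lambda>x. v (r n) x - u x)) \<longlonglongrightarrow> 0"
proof -
  note vF = X_finite_energy[OF v]
  have p0: "0 < p" using p by simp
  obtain r where r: "strict_mono r" "AE x in lborel. convergent (\<lambda>n. v (r n) x)"
    using Lp_Cauchy_AE_subseq[OF finite_energyD(1)[OF vF] p0 CP] by blast
  define w where "w n = v (r n)" for n
  have wX: "w n \<in> X \<Omega>" for n using v by (simp add: w_def)
  note wF = X_finite_energy[OF wX]
  have [measurable]: "w n \<in> borel_measurable borel" for n using finite_energyD(4)[OF wF] .
  \<comment> \<open>\<open>lim\<close> gives a Borel function defined everywhere. Outside \<Omega>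
    the sequence is constantly zero, so u vanishes there without exceptional points.\<close>
  define u where "u x = lim (\<lambda>n. w n x)" for x
  have um[measurable]: "u \<in> borel_measurable borel" unfolding u_def by measurable
  have wu: "AE x in lborel. (\<lambda>n. w n x) \<longlonglongrightarrow> u x"
    using r(2) by eventually_elim (simp add: w_def u_def convergent_LIMSEQ_iff)
  have u0: "u x = 0" if "x \<notin> \<Omega>" for x
    using finite_energyD(3)[OF wF that] by (simp add: u_def)
  have CauchyP: "\<exists>n0. \<forall>m\<ge>n0. (\<lambda>x. w m x - u x) \<in> Lp lborel p \<and> P (\<lambda>x. w m x - u x) \<le> e" if e: "0 < e" for e
  proof -
    obtain n0 where n0: "\<And>m n. n0 \<le> m \<Longrightarrow> n0 \<le> n \<Longrightarrow> P (\<lambda>x. v m x - v n x) < e" using CP[OF e] by blast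
    have "(\<lambda>x. w m x - u x) \<in> Lp lborel p \<and> P (\<lambda>x. w m x - u x) \<le> e" if m: "n0 \<le> m" for m
    proof -
      have L: "(\<lambda>x. w m x - w (n + n0) x) \<in> Lp lborel p" for n
        by (rule finite_energyD(1)[OF finite_energy_diff[OF wF wF]])
      have lim: "AE x in lborel. (\<lambda>n. w m x - w (n + n0) x) \<longlonglongrightarrow> w m x - u x"
        using wu by eventually_elim (intro tendsto_diff tendsto_const LIMSEQ_ignore_initial_segment)
      have b: "P (\<lambda>x. w m x - w (n + n0) x) \<le> e" for n
        unfolding w_def using m seq_suble[OF r(1), of m] seq_suble[OF r(1), of "n + n0"]
        by (intro less_imp_le[OF n0]) auto
      show ?thesis using Lp_Fatou[OF L _ lim b p0] by simp
    qed
    then show ?thesis by blast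
  qed
  have CauchyE: "\<exists>n0. \<forall>m\<ge>n0. quot (\<lambda>x. w m x - u x) \<in> Lp M2 p \<and> E (\<lambda>x. w m x - u x) \<le> e" if e: "0 < e" for e
  proof -
    obtain n0 where n0: "\<And>m n. n0 \<le> m \<Longrightarrow> n0 \<le> n \<Longrightarrow> E (\<lambda>x. v m x - v n x) < e" using CE[OF e] by blast
    have "quot (\<lambda>x. w m x - u x) \<in> Lp M2 p \<and> E (\<lambda>x. w m x - u x) \<le> e" if m: "n0 \<le> m" for m
    proof -
      have L: "quot (\<lambda>x. w m x - w (n + n0) x) \<in> Lp M2 p" for n
        by (rule finite_energyD(2)[OF finite_energy_diff[OF wF wF]])
      have meas: "quot (\<lambda>x. w m x - u x) \<in> borel_measurable M2" by (rule measurable_quot) measurable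
      have lim: "AE z in M2. (\<lambda>n. quot (\<lambda>x. w m x - w (n + n0) x) z) \<longlonglongrightarrow> quot (\<lambda>x. w m x - u x) z"
        using AE_lborel_pair[OF wu]
      proof eventually_elim
        fix z assume z: "(\<lambda>n. w n (fst z)) \<longlonglongrightarrow> u (fst z) \<and> (\<lambda>n. w n (snd z)) \<longlonglongrightarrow> u (snd z)"
        show "(\<lambda>n. quot (\<lambda>x. w m x - w (n + n0) x) z) \<longlonglongrightarrow> quot (\<lambda>x. w m x - u x) z"
          unfolding quot_def divide_inverse
          using z by (intro tendsto_mult tendsto_diff tendsto_const LIMSEQ_ignore_initial_segment) auto
      qed
      have b: "E (\<lambda>x. w m x - w (n + n0) x) \<le> e" for n
        unfolding w_def using m seq_suble[OF r(1), of m] seq_suble[OF r(1), of "n + n0"]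
        by (intro less_imp_le[OF n0]) auto
      show ?thesis using Lp_Fatou[OF L meas lim b p0] by simp
    qed
    then show ?thesis by blast
  qed
  have limP: "(\<lambda>n. P (\<lambda>x. w n x - u x)) \<longlonglongrightarrow> 0"
  proof (rule LIMSEQ_I)
    fix e :: real assume "0 < e"
    then obtain n0 where "\<forall>m\<ge>n0. P (\<lambda>x. w m x - u x) \<le> e / 2" using CauchyP[of "e / 2"] by auto
    then show "\<exists>n0. \<forall>n\<ge>n0. norm (P (\<lambda>x. w n x - u x) - 0) < e"
      using \<open>0 < e\<close> by (intro exI[of _ n0]) fastforce
  qed
  have limE: "(\<lambda>n. E (\<lambda>x. w n x - u x)) \<longlonglongrightarrow> 0"
  proof (rule LIMSEQ_I)
    fix e :: real assume "0 < e"
    then obtain n0 where "\<forall>m\<ge>n0. E (\<lambda>x. w m x - u x) \<le> e / 2" using CauchyE[of "e / 2"] by auto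
    then show "\<exists>n0. \<forall>n\<ge>n0. norm (E (\<lambda>x. w n x - u x) - 0) < e"
      using \<open>0 < e\<close> by (intro exI[of _ n0]) fastforce
  qed
  obtain m where m: "(\<lambda>x. w m x - u x) \<in> Lp lborel p" "quot (\<lambda>x. w m x - u x) \<in> Lp M2 p"
  proof -
    obtain n1 where n1: "\<forall>m\<ge>n1. (\<lambda>x. w m x - u x) \<in> Lp lborel p \<and> P (\<lambda>x. w m x - u x) \<le> 1"
      using CauchyP[OF zero_less_one] by blast
    obtain n2 where n2: "\<forall>m\<ge>n2. quot (\<lambda>x. w m x - u x) \<in> Lp M2 p \<and> E (\<lambda>x. w m x - u x) \<le> 1"
      using CauchyE[OF zero_less_one] by blast
    show ?thesis using that[of "max n1 n2"] n1 n2 by simp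
  qed
  have d: "(\<lambda>x. w m x - u x) \<in> finite_energy \<Omega>"
    using m u0 finite_energyD(3)[OF wF] by (simp add: finite_energy_def)
  \<comment> \<open>u is recovered as a difference of two functions of finite energy.\<close>
  have "(\<lambda>x. w m x - (w m x - u x)) \<in> finite_energy \<Omega>" by (rule finite_energy_diff[OF wF d])
  then have uF: "u \<in> finite_energy \<Omega>" by simp
  have "u \<in> X \<Omega>"
  proof (rule X_closed[OF uF wX])
    show "(\<lambda>n. P (\<lambda>x. u x - w n x)) \<longlonglongrightarrow> 0" using limP by (simp add: Lp_int_minus_commute[of lborel p u])
    show "(\<lambda>n. E (\<lambda>x. u x - w n x)) \<longlonglongrightarrow> 0"
      using limE by (simp add: quot_diff[abs_def] Lp_int_minus_commute[of M2 p "quot u"])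
  qed
  then show ?thesis using that[of u r] r(1) limP limE by (simp add: w_def)
qed

end

section \<open>Existence of a minimizer\<close>

context fractional_energy
begin

lemma ex_minimizer:
  assumes \<Omega>: "open \<Omega>" "\<Omega> \<noteq> {}" "bounded \<Omega>"
  obtains u where "u \<in> X \<Omega>" "P u = 1" "E u = \<Lambda> \<Omega>" "\<And>x. 0 \<le> u x"
proof -
  define L where "L = \<Lambda> \<Omega>"
  have L: "0 \<le> L" using lambda1_nonneg[OF \<Omega>(1,2)] by (simp add: L_def)
  have "\<forall>n. \<exists>u. u \<in> unit_sphere G N s p \<Omega> \<and> E u < L + inverse (real (Suc n))"
  proof
    fix n
    have "Inf (E ` unit_sphere G N s p \<Omega>) < L + inverse (real (Suc n))"
      by (simp add: L_def lambda1_def energy_eq)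
    then show "\<exists>u. u \<in> unit_sphere G N s p \<Omega> \<and> E u < L + inverse (real (Suc n))"
      using cInf_lessD[of "E ` unit_sphere G N s p \<Omega>"] unit_sphere_nonempty[OF \<Omega>(1,2)] by blast
  qed
  from choice[OF this] obtain u0 where u0: "\<And>n. u0 n \<in> X \<Omega>" "\<And>n. P (u0 n) = 1"
    "\<And>n. E (u0 n) < L + inverse (real (Suc n))"
    unfolding unit_sphere_iff by blast
  note u0F = X_finite_energy[OF u0(1)]
  have bound: "P (u0 n) \<le> L + 1" "E (u0 n) \<le> L + 1" for n
  proof -
    have "inverse (real (Suc n)) \<le> 1" by (simp add: inverse_le_1_iff)
    then show "E (u0 n) \<le> L + 1" using u0(3)[of n] by linarith
    show "P (u0 n) \<le> L + 1" using u0(2) L by simp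
  qed
  obtain r where r: "strict_mono (r :: nat \<Rightarrow> nat)"
    "\<And>e. 0 < e \<Longrightarrow> \<exists>n0. \<forall>m\<ge>n0. \<forall>n\<ge>n0. P (\<lambda>x. u0 (r m) x - u0 (r n) x) < e"
    using compact_embedding[of \<Omega> u0 "L + 1", OF \<Omega>(1,3) u0F bound] by blast
  define v where "v n = u0 (r n)" for n
  have v: "v n \<in> X \<Omega>" "P (v n) = 1" "E (v n) \<le> L + 1" for n
    using u0 bound by (simp_all add: v_def)
  note vF = X_finite_energy[OF v(1)]
  have Elim: "(\<lambda>n. E (v n)) \<longlonglongrightarrow> L"
  proof (rule tendsto_sandwich[OF _ _ tendsto_const])
    show "\<forall>\<^sub>F n in sequentially. L \<le> E (v n)"
      using lambda1_P_le[OF v(1)] v(2) by (simp add: L_def)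
    show "\<forall>\<^sub>F n in sequentially. E (v n) \<le> L + inverse (real (Suc n))"
    proof (intro always_eventually allI)
      fix n
      have "inverse (real (Suc (r n))) \<le> inverse (real (Suc n))"
        using seq_suble[OF r(1), of n] by simp
      then show "E (v n) \<le> L + inverse (real (Suc n))" using u0(3)[of "r n"] unfolding v_def by linarith
    qed
    show "(\<lambda>n. L + inverse (real (Suc n))) \<longlonglongrightarrow> L"
      using tendsto_add[OF tendsto_const LIMSEQ_inverse_real_of_nat, of L] by simp
  qed
  have CP: "\<exists>n0. \<forall>m\<ge>n0. \<forall>n\<ge>n0. P (\<lambda>x. v m x - v n x) < e" if "0 < e" for e
    using r(2)[OF that] by (simp add: v_def)
  have CE: "\<exists>n0. \<forall>m\<ge>n0. \<forall>n\<ge>n0. E (\<lambda>x. v m x - v n x) < e" if e: "0 < e" for e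
  proof -
    \<comment> \<open>The tolerances add up to less than e: the convexity error costs
      \<open>2 * \<epsilon> * (L + 1) = e / 4\<close>, the excess of the energies over L costs
      \<open>K * t = e / 4\<close>, and the deviation of the midpoint's p-th mean from one costs
      \<open>2 * K * L * d < e / 2\<close>.\<close>
    define \<epsilon> where "\<epsilon> = e / (8 * (L + 1))"
    have \<epsilon>: "0 < \<epsilon>" using e L by (simp add: \<epsilon>_def)
    obtain K where K: "0 < K" "\<And>f g. f \<in> Lp M2 p \<Longrightarrow> g \<in> Lp M2 p \<Longrightarrow>
        Lp_int M2 p (\<lambda>x. f x - g x) \<le> \<epsilon> * (Lp_int M2 p f + Lp_int M2 p g)
        + K * ((Lp_int M2 p f + Lp_int M2 p g) / 2 - Lp_int M2 p (\<lambda>x. (f x + g x) / 2))"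
      using Lp_uniform_convexity[OF p \<epsilon>] by blast
    define d where "d = e / (4 * K * (L + 1))"
    have d: "0 < d" using e K L by (simp add: d_def)
    obtain C where C: "0 < C" "\<And>f g. f \<in> Lp lborel p \<Longrightarrow> g \<in> Lp lborel p \<Longrightarrow>
        \<bar>P (\<lambda>x :: real^'n. f x + g x) - P f\<bar> \<le> d * P f + C * P g"
      using Lp_int_eps[OF p d] by blast
    define t where "t = e / (4 * K)"
    have t: "0 < t" using e K by (simp add: t_def)
    obtain n1 where n1: "\<And>n. n1 \<le> n \<Longrightarrow> E (v n) < L + t"
      using order_tendstoD(2)[OF Elim, of "L + t"] t by (auto simp: eventually_sequentially)
    have "0 < d / C" using d C by simp
    from CP[OF this] obtain n2 where n2: "\<And>m n. n2 \<le> m \<Longrightarrow> n2 \<le> n \<Longrightarrow> P (\<lambda>x. v m x - v n x) < d / C" by blast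
    have "E (\<lambda>x. v m x - v n x) < e" if mn: "max n1 n2 \<le> m" "max n1 n2 \<le> n" for m n
    proof -
      have half: "P (\<lambda>x. (1/2) * (v n x - v m x)) \<le> P (\<lambda>x. v n x - v m x)"
      proof -
        have "\<bar>1/2 :: real\<bar> powr p \<le> 1" using p powr_mono2[of p "1/2" 1] by simp
        then show ?thesis unfolding Lp_int_cmult using mult_right_mono[of "\<bar>1/2\<bar> powr p" 1] by simp
      qed
      have hC: "P (\<lambda>x. (1/2) * (v n x - v m x)) \<le> d / C"
        using half n2[of n m] mn by linarith
      \<comment> \<open>The midpoint is seen as v m perturbed by half the difference, so its p-th
        mean differs from 1 by at most 2 d; the factor \<open>2 powr p\<close> of the crude estimate
        would be useless here.\<close>
      have "\<bar>P (\<lambda>x. v m x + (1/2) * (v n x - v m x)) - P (v m)\<bar> \<le> d * P (v m) + C * P (\<lambda>x. (1/2) * (v n x - v m x))"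
        using p by (intro C(2) Lp_cmult Lp_diff finite_energyD(1)[OF vF]) auto
      also have "\<dots> \<le> d * 1 + C * (d / C)"
        unfolding v(2) using C(1) by (intro add_left_mono mult_left_mono hC) simp
      also have "\<dots> = 2 * d" using C by simp
      also have "(\<lambda>x. v m x + (1/2) * (v n x - v m x)) = (\<lambda>x. (1/2) * (v m x + 1 * v n x))"
        by (auto simp: field_simps)
      finally have Pmid: "1 - 2 * d \<le> P (\<lambda>x. (1/2) * (v m x + 1 * v n x))" using v(2)[of m] by linarith
      have midX: "(\<lambda>x. (1/2) * (v m x + 1 * v n x)) \<in> X \<Omega>" by (intro X_cmult X_lincomb v)
      have "L * (1 - 2 * d) \<le> L * P (\<lambda>x. (1/2) * (v m x + 1 * v n x))"
        using Pmid L by (rule mult_left_mono)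
      also have "\<dots> \<le> E (\<lambda>x. (1/2) * (v m x + 1 * v n x))" unfolding L_def by (rule lambda1_P_le[OF midX])
      also have "quot (\<lambda>x. (1/2) * (v m x + 1 * v n x)) = (\<lambda>z. (quot (v m) z + quot (v n) z) / 2)"
        by (rule ext) (simp add: quot_def add_divide_distrib diff_divide_distrib)
      finally have Emid: "L * (1 - 2 * d) \<le> Lp_int M2 p (\<lambda>z. (quot (v m) z + quot (v n) z) / 2)" .
      have "E (v m) + E (v n) < (L + t) + (L + t)" using n1 mn by (intro add_strict_mono) auto
      then have avgE: "(E (v m) + E (v n)) / 2 \<le> L + t" by (simp add: field_simps)
      have "E (\<lambda>x. v m x - v n x) \<le> \<epsilon> * (E (v m) + E (v n)) + K * ((E (v m) + E (v n)) / 2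
          - Lp_int M2 p (\<lambda>z. (quot (v m) z + quot (v n) z) / 2))"
        unfolding quot_diff[abs_def] by (intro K(2) finite_energyD(2)[OF vF])
      also have "\<dots> \<le> \<epsilon> * ((L + 1) + (L + 1)) + K * ((L + t) - L * (1 - 2 * d))"
        using K(1) \<epsilon> by (intro add_mono[OF mult_left_mono mult_left_mono] add_mono v diff_mono avgE Emid) auto
      also have "\<dots> = e / 4 + (e / 4 + 2 * (K * (L * d)))"
        using K L by (simp add: \<epsilon>_def t_def algebra_simps add_divide_distrib[symmetric]) (simp add: field_simps)
      also have "\<dots> < e"
      proof -
        have "K * (L * d) < K * ((L + 1) * d)" using K d by simp
        also have "\<dots> = e / 4"
        proof -
          have "L + 1 \<noteq> 0" using L by linarith
          then show ?thesis using K by (simp add: d_def)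
        qed
        finally show ?thesis by linarith
      qed
      finally show ?thesis .
    qed
    then show ?thesis by blast
  qed
  obtain w r2 where w: "w \<in> X \<Omega>" "strict_mono (r2 :: nat \<Rightarrow> nat)"
    "(\<lambda>n. P (\<lambda>x. v (r2 n) x - w x)) \<longlonglongrightarrow> 0" "(\<lambda>n. E (\<lambda>x. v (r2 n) x - w x)) \<longlonglongrightarrow> 0"
    using X_complete[of v \<Omega>, OF v(1) CP CE] by blast
  note wF = X_finite_energy[OF w(1)]
  have "(\<lambda>n. P (v (r2 n))) \<longlonglongrightarrow> P w"
    by (rule Lp_int_tendsto[OF p finite_energyD(1)[OF vF] finite_energyD(1)[OF wF] w(3)])
  then have "(\<lambda>n. 1) \<longlonglongrightarrow> P w" by (simp only: v(2))
  then have Pw: "P w = 1" by (rule LIMSEQ_unique[OF _ tendsto_const])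
  have "(\<lambda>n. E (v (r2 n))) \<longlonglongrightarrow> E w"
    using w(4) by (intro Lp_int_tendsto[OF p finite_energyD(2)[OF vF] finite_energyD(2)[OF wF]]) (simp add: quot_diff[abs_def])
  moreover have "(\<lambda>n. E (v (r2 n))) \<longlonglongrightarrow> L"
    using LIMSEQ_subseq_LIMSEQ[OF Elim w(2)] by (simp add: o_def)
  ultimately have Ew: "E w = L" by (rule LIMSEQ_unique)
  \<comment> \<open>Passing to |w| keeps the p-th mean and does not raise the energy, which cannot
    drop below the infimum.\<close>
  have aX: "(\<lambda>x. \<bar>w x\<bar>) \<in> X \<Omega>" and aE: "E (\<lambda>x. \<bar>w x\<bar>) \<le> L" using X_abs[OF w(1)] Ew by auto
  have aP: "P (\<lambda>x. \<bar>w x\<bar>) = 1" using Pw by (simp add: Lp_int_def)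
  have "L \<le> E (\<lambda>x. \<bar>w x\<bar>)" using lambda1_P_le[OF aX] aP by (simp add: L_def)
  with aE have "E (\<lambda>x. \<bar>w x\<bar>) = \<Lambda> \<Omega>" by (simp add: L_def)
  then show ?thesis using that[of "\<lambda>x. \<bar>w x\<bar>"] aX aP by simp
qed

text \<open>The kernel carries the total exponent (p - 2)/p + 1/p + 1/p = 1. In this form the weak
  operator is, up to the factor p, the derivative of the energy as a p-th mean of quotients.\<close>

lemma form_eq:
  "sub_Laplacian_form G N s p u \<phi> = (\<integral>z. \<bar>quot u z\<bar> powr (p - 2) * quot u z * quot \<phi> z \<partial>M2)"
  unfolding sub_Laplacian_form_def case_prod_beta'
proof (rule Bochner_Integration.integral_cong[OF refl])
  fix z :: "(real^'n) \<times> (real^'n)"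
  let ?a = "u (fst z) - u (snd z)" and ?b = "\<phi> (fst z) - \<phi> (snd z)"
  let ?k = "kernel G N s p (fst z) (snd z)"
  have "(p - 2) / p + 1 / p + 1 / p = 1" using p by (simp add: field_simps)
  then have k: "?k powr ((p - 2) / p) * ?k powr (1 / p) * ?k powr (1 / p) = ?k"
    using p by (simp flip: powr_add)
  have "\<bar>quot u z\<bar> powr (p - 2) * quot u z * quot \<phi> z
      = \<bar>?a\<bar> powr (p - 2) * ?a * ?b / (?k powr ((p - 2) / p) * ?k powr (1 / p) * ?k powr (1 / p))"
    using p by (simp add: quot_def abs_divide powr_divide powr_powr mult_ac)
  then show "\<bar>?a\<bar> powr (p - 2) * ?a * ?b / ?k = \<bar>quot u z\<bar> powr (p - 2) * quot u z * quot \<phi> z"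
    unfolding k by simp
qed

text \<open>Along u + t \<phi> the difference E - \<Lambda> P is nonnegative and vanishes at t = 0,
  so its derivative there is zero. Using this difference removes the constraint and with it any
  Lagrange multiplier.\<close>

lemma minimizer_weak_eigensolution:
  assumes u: "u \<in> X \<Omega>" and E: "E u = \<Lambda> \<Omega> * P u"
  shows "weak_eigensolution G N s p \<Omega> (\<Lambda> \<Omega>) u"
  unfolding weak_eigensolution_def
proof (intro conjI ballI u)
  fix \<phi> assume \<phi>: "\<phi> \<in> test_functions \<Omega>"
  note \<phi>X = test_functions_X[OF \<phi>]
  note uF = X_finite_energy[OF u] and \<phi>F = X_finite_energy[OF \<phi>X]
  define I1 where "I1 = (\<integral>z. \<bar>quot u z\<bar> powr (p - 2) * quot u z * quot \<phi> z \<partial>M2)"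
  define I2 where "I2 = (\<integral>x. \<bar>u x\<bar> powr (p - 2) * u x * \<phi> x \<partial>lborel)"
  define F where "F t = E (\<lambda>x. u x + t * \<phi> x) - \<Lambda> \<Omega> * P (\<lambda>x. u x + t * \<phi> x)" for t
  have quot_eq: "quot (\<lambda>x. u x + t * \<phi> x) = (\<lambda>z. quot u z + t * quot \<phi> z)" for t
    by (rule ext) (simp add: quot_add quot_cmult)
  have "((\<lambda>t. Lp_int M2 p (\<lambda>z. quot u z + t * quot \<phi> z) - \<Lambda> \<Omega> * P (\<lambda>x. u x + t * \<phi> x))
      has_real_derivative p * I1 - \<Lambda> \<Omega> * (p * I2)) (at 0)"
    unfolding I1_def I2_def
    by (intro DERIV_diff DERIV_cmult has_real_derivative_Lp_int p finite_energyD[OF uF] finite_energyD[OF \<phi>F])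
  then have der: "(F has_real_derivative p * I1 - \<Lambda> \<Omega> * (p * I2)) (at 0)"
    unfolding F_def[abs_def] quot_eq .
  have "F 0 \<le> F t" for t
  proof -
    have "F 0 = 0" using E by (simp add: F_def)
    also have "0 \<le> F t" using lambda1_P_le[OF X_lincomb[OF u \<phi>X, of t]] by (simp add: F_def)
    finally show ?thesis .
  qed
  then have "p * I1 - \<Lambda> \<Omega> * (p * I2) = 0"
    by (intro DERIV_local_min[OF der zero_less_one]) auto
  then have "p * I1 = p * (\<Lambda> \<Omega> * I2)" by (simp add: mult_ac)
  then have "I1 = \<Lambda> \<Omega> * I2" using p by simp
  moreover have "(LINT x:\<Omega>|lborel. \<bar>u x\<bar> powr (p - 2) * u x * \<phi> x) = I2"
    unfolding set_lebesgue_integral_def I2_def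
    by (rule Bochner_Integration.integral_cong[OF refl])
       (use test_functions_zero_outside[OF \<phi>] in \<open>auto simp: indicator_def\<close>)
  ultimately show "sub_Laplacian_form G N s p u \<phi> = \<Lambda> \<Omega> * (LINT x:\<Omega>|lborel. \<bar>u x\<bar> powr (p - 2) * u x * \<phi> x)"
    by (simp add: form_eq I1_def)
qed

end

section \<open>Boundedness of minimizers\<close>

context fractional_energy
begin

text \<open>The differences of the two truncations have the same sign, and
  |a|^p + |b|^p is at most |a + b|^p for numbers of the same sign.\<close>

lemma E_truncation_add_le:
  assumes u: "u \<in> X \<Omega>" and k: "0 \<le> k"
  shows "E (\<lambda>x. u x - min (u x) k) + E (\<lambda>x. min (u x) k) \<le> E u"
proof -
  have w: "(\<lambda>x. min (u x) k) \<in> X \<Omega>" by (rule X_min[OF u k])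
  note uF = X_finite_energy[OF u] and wF = X_finite_energy[OF w]
  note vF = finite_energy_diff[OF uF wF]
  note int = Lp_integrable[OF finite_energyD(2)[OF vF]] Lp_integrable[OF finite_energyD(2)[OF wF]]
    Lp_integrable[OF finite_energyD(2)[OF uF]]
  have pt: "\<bar>quot (\<lambda>x. u x - min (u x) k) z\<bar> powr p + \<bar>quot (\<lambda>x. min (u x) k) z\<bar> powr p \<le> \<bar>quot u z\<bar> powr p" for z
  proof -
    let ?V = "quot (\<lambda>x. u x - min (u x) k) z" and ?W = "quot (\<lambda>x. min (u x) k) z"
    have "\<bar>quot u z\<bar> = \<bar>?V\<bar> + \<bar>?W\<bar>"
    proof -
      have "\<bar>u (fst z) - u (snd z)\<bar> = \<bar>(u (fst z) - min (u (fst z)) k) - (u (snd z) - min (u (snd z)) k)\<bar>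
          + \<bar>min (u (fst z)) k - min (u (snd z)) k\<bar>"
        by (simp add: min_def)
      then show ?thesis by (simp add: quot_def add_divide_distrib)
    qed
    moreover have "a powr p + b powr p \<le> (a + b) powr p" if "0 \<le> a" "0 \<le> b" for a b
    proof -
      \<comment> \<open>Splitting off one factor reduces superadditivity to monotonicity of the
        power p - 1.\<close>
      have split: "c powr p = c * c powr (p - 1)" if "0 \<le> c" for c
        using that powr_add[of c 1 "p - 1"] by (cases "c = 0") auto
      have "a * a powr (p - 1) + b * b powr (p - 1) \<le> a * (a + b) powr (p - 1) + b * (a + b) powr (p - 1)"
        using that p by (intro add_mono mult_left_mono powr_mono2) auto
      also have "\<dots> = (a + b) * (a + b) powr (p - 1)" by (simp add: distrib_right)
      finally show ?thesis using that by (simp add: split)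
    qed
    ultimately show ?thesis by simp
  qed
  have "E (\<lambda>x. u x - min (u x) k) + E (\<lambda>x. min (u x) k)
      = (\<integral>z. \<bar>quot (\<lambda>x. u x - min (u x) k) z\<bar> powr p + \<bar>quot (\<lambda>x. min (u x) k) z\<bar> powr p \<partial>M2)"
    unfolding Lp_int_def using int by simp
  also have "\<dots> \<le> E u"
    unfolding Lp_int_def using int pt by (intro integral_mono Bochner_Integration.integrable_add)
  finally show ?thesis .
qed

text \<open>Write v = u - w with w = min u k. From E v + E w \<le> E u = \<Lambda> P u and E w \<ge>
  \<Lambda> P w follows E v \<le> \<Lambda> (P u - P w), a quantity living on {u > k}, where u = v +
  k. The Faber-Krahn inequality for v, carried by the same set, turns this into an estimate whose
  factor is small when V is small.\<close>

lemma minimizer_truncation: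
  assumes u: "u \<in> X \<Omega>" "\<And>x. 0 \<le> u x" and E: "E u = \<Lambda> \<Omega> * P u" and \<Lambda>: "0 \<le> \<Lambda> \<Omega>" and k: "0 < k"
    and V: "emeasure lborel {x. k < u x} \<le> ennreal V" "0 < V"
  shows "P (\<lambda>x. u x - min (u x) k)
    \<le> FK * V powr (p * s / Q) * (\<Lambda> \<Omega> * (2 powr p * (P (\<lambda>x. u x - min (u x) k) + k powr p * V)))"
proof -
  let ?v = "\<lambda>x. u x - min (u x) k" and ?w = "\<lambda>x. min (u x) k"
  have w: "?w \<in> X \<Omega>" using k by (intro X_min u) simp
  note uF = X_finite_energy[OF u(1)] and wF = X_finite_energy[OF w]
  note vF = finite_energy_diff[OF uF wF]
  have [measurable]: "u \<in> borel_measurable borel" using finite_energyD(4)[OF uF] .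
  let ?A = "{x. k < u x}"
  have A[measurable]: "?A \<in> sets borel" by measurable
  have fin: "emeasure lborel ?A < \<infinity>" using V(1) by (simp add: le_less_trans)
  have mA: "measure lborel ?A \<le> V" using V by (simp add: measure_def enn2real_leI)
  note int = Lp_integrable[OF finite_energyD(1)[OF uF]] Lp_integrable[OF finite_energyD(1)[OF wF]]
    Lp_integrable[OF finite_energyD(1)[OF vF]]
  have "E ?v + \<Lambda> \<Omega> * P ?w \<le> \<Lambda> \<Omega> * P u"
    using E_truncation_add_le[OF u(1), of k] lambda1_P_le[OF w] k E by linarith
  then have "E ?v \<le> \<Lambda> \<Omega> * (P u - P ?w)" by (simp add: right_diff_distrib)
  also have "\<dots> \<le> \<Lambda> \<Omega> * (2 powr p * (P ?v + k powr p * V))"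
  proof (rule mult_left_mono[OF _ \<Lambda>])
    have "P u - P ?w = (\<integral>x. \<bar>u x\<bar> powr p - \<bar>?w x\<bar> powr p \<partial>lborel)"
      unfolding Lp_int_def using int by simp
    also have "\<dots> \<le> (\<integral>x. 2 powr p * (\<bar>?v x\<bar> powr p + k powr p * indicator ?A x) \<partial>lborel)"
    proof (rule integral_mono)
      show "integrable lborel (\<lambda>x. 2 powr p * (\<bar>?v x\<bar> powr p + k powr p * indicator ?A x))"
        using int(3) fin by (intro integrable_mult_right Bochner_Integration.integrable_add integrable_real_indicator) auto
      fix x
      show "\<bar>u x\<bar> powr p - \<bar>?w x\<bar> powr p \<le> 2 powr p * (\<bar>?v x\<bar> powr p + k powr p * indicator ?A x)"
      proof (cases "k < u x")
        case True
        have "\<bar>?v x + k\<bar> powr p \<le> 2 powr p * (\<bar>?v x\<bar> powr p + \<bar>k\<bar> powr p)"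
          using p by (intro abs_powr_add_le) simp
        moreover have "?v x + k = u x" using True by simp
        ultimately have "\<bar>u x\<bar> powr p \<le> 2 powr p * (\<bar>?v x\<bar> powr p + k powr p * indicator ?A x)"
          using True k by simp
        then show ?thesis by (smt (verit) powr_ge_zero)
      qed simp
    qed (use int in \<open>auto intro: Bochner_Integration.integrable_diff\<close>)
    also have "\<dots> = 2 powr p * (P ?v + k powr p * measure lborel ?A)"
    proof -
      have "integrable lborel (\<lambda>x. k powr p * indicator ?A x)"
        using fin by (intro integrable_mult_right integrable_real_indicator) auto
      then show ?thesis
        unfolding integral_mult_right_zero Lp_int_def by (subst Bochner_Integration.integral_add[OF int(3)]) simp_all
    qed
    also have "\<dots> \<le> 2 powr p * (P ?v + k powr p * V)"
      using mA by (intro mult_left_mono add_left_mono) auto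
    finally show "P u - P ?w \<le> 2 powr p * (P ?v + k powr p * V)" .
  qed
  finally have Ev: "E ?v \<le> \<Lambda> \<Omega> * (2 powr p * (P ?v + k powr p * V))" .
  have "P ?v \<le> FK * V powr (p * s / Q) * E ?v"
  proof (rule Faber_Krahn(2)[OF A V finite_energyD(4)[OF vF] _ finite_energyD(2)[OF vF]])
    show "u x - min (u x) k = 0" if "x \<notin> ?A" for x using that by (simp add: min_def)
  qed
  also have "\<dots> \<le> FK * V powr (p * s / Q) * (\<Lambda> \<Omega> * (2 powr p * (P ?v + k powr p * V)))"
    using Ev FK_pos by (intro mult_left_mono) auto
  finally show ?thesis .
qed

text \<open>De Giorgi's iteration along the levels M (2 - 2^-j), with geometrically decreasing bounds for
  the volumes of the superlevel sets.\<close>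

lemma minimizer_bounded:
  assumes u: "u \<in> X \<Omega>" "\<And>x. 0 \<le> u x" and E: "E u = \<Lambda> \<Omega> * P u" and P1: "P u = 1" and \<Lambda>: "0 \<le> \<Lambda> \<Omega>"
  obtains M where "AE x in lborel. u x \<le> M"
proof -
  have pow_powr: "(x ^ n) powr y = (x powr y) ^ n" if "0 < x" for x y :: real and n
    using that by (simp add: powr_realpow[symmetric] powr_powr mult.commute)
  note uF = X_finite_energy[OF u(1)]
  have [measurable]: "u \<in> borel_measurable borel" using finite_energyD(4)[OF uF] .
  define a where "a = p * s / Q"
  have a: "0 < a" using ps_pos Q_pos by (simp add: a_def)
  \<comment> \<open>The added 1 makes \<open>C\<close> at least 1 when only nonnegativity of the
    eigenvalue is known.\<close>
  define C where "C = FK * \<Lambda> \<Omega> * 2 powr p + 1"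
  have C: "1 \<le> C" using FK_pos \<Lambda> by (simp add: C_def)
  \<comment> \<open>\<open>q\<close> is chosen so that \<open>2 powr p * q powr a = 1\<close>: the
    gain from the power a of the volume cancels the factor 2^(pj) lost through level gaps shrinking
    like 2^-j.\<close>
  define q where "q = 2 powr (- p / a)"
  have q: "0 < q" "q < 1"
    using p a powr_less_cancel_iff[of 2 "- p / a" 0] by (simp_all add: q_def)
  have qa: "2 powr p * q powr a = 1"
    using a by (simp add: q_def powr_powr flip: powr_add)
  \<comment> \<open>\<open>V0\<close> solves \<open>2 * C * 4 powr p * V0 powr a = q\<close>, so
    that each step multiplies the volume bound by q.\<close>
  define V0 where "V0 = (q / (2 * C * 4 powr p)) powr (1 / a)"
  have V0: "0 < V0" using q C by (simp add: V0_def)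
  have V0a: "2 * C * 4 powr p * V0 powr a = q"
    using q C a by (simp add: V0_def powr_powr)
  \<comment> \<open>With this \<open>M\<close>, Chebyshev's inequality at the level M and
    \<open>P u = 1\<close> start the iteration at \<open>V0\<close>.\<close>
  define M where "M = V0 powr (- (1 / p))"
  have M: "0 < M" using V0 by (simp add: M_def)
  have "- (1 / p) * p = -1" using p by simp
  then have "M powr p = V0 powr (-1)" unfolding M_def powr_powr by simp
  then have MV: "1 / M powr p = V0" using V0 by (simp add: powr_minus divide_inverse)
  define k where "k j = M * (2 - (1/2) ^ j)" for j :: nat
  have kM: "M \<le> k j" "k j \<le> 2 * M" for j
    using M power_le_one[of "1/2 :: real" j] by (simp_all add: k_def)
  have k: "0 < k j" for j using kM(1)[of j] M by linarith
  have kd: "k (Suc j) - k j = M * (1/2) ^ Suc j" for j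
    by (simp add: k_def algebra_simps)
  have step: "emeasure lborel {x. k j < u x} \<le> ennreal (V0 * q ^ j)" for j
  proof (induction j)
    case 0
    have "emeasure lborel {x. k 0 < u x} \<le> ennreal (P u / M powr p)"
      by (rule Lp_Chebyshev[OF finite_energyD(1)[OF uF] M]) (use p u(2) in \<open>auto simp: k_def\<close>)
    then show ?case using MV P1 by simp
  next
    case (Suc j)
    define V where "V = V0 * q ^ j"
    have V: "0 < V" "V \<le> V0" using V0 q by (simp_all add: V_def power_le_one mult_left_le)
    let ?v = "\<lambda>x. u x - min (u x) (k j)"
    have w: "(\<lambda>x. min (u x) (k j)) \<in> X \<Omega>" using k[of j] by (intro X_min u) simp
    note vF = finite_energy_diff[OF uF X_finite_energy[OF w]]
    have "P ?v \<le> FK * V powr a * (\<Lambda> \<Omega> * (2 powr p * (P ?v + k j powr p * V)))"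
      using minimizer_truncation[OF u E \<Lambda> k _ V(1)] Suc.IH by (simp add: a_def V_def)
    also have "\<dots> = (C - 1) * V powr a * (P ?v + k j powr p * V)" by (simp add: C_def mult_ac)
    also have "\<dots> \<le> C * V powr a * (P ?v + k j powr p * V)"
      using V by (intro mult_right_mono) auto
    finally have Pv: "P ?v \<le> C * V powr a * (P ?v + k j powr p * V)" .
    \<comment> \<open>The volume is small enough for the term in \<open>P ?v\<close> on the right of
      \<open>Pv\<close> to be absorbed into the left.\<close>
    have half: "C * V powr a \<le> 1 / 2"
    proof -
      have "1 \<le> 4 powr p" using p by (simp add: ge_one_powr_ge_zero)
      have "C * V powr a \<le> C * V0 powr a" using V a C by (intro mult_left_mono powr_mono2) auto
      also have "\<dots> \<le> 4 powr p * (C * V0 powr a)"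
        using \<open>1 \<le> 4 powr p\<close> C mult_right_mono[of 1 "4 powr p" "C * V0 powr a"] by simp
      also have "\<dots> = q / 2" using V0a by (simp add: mult_ac)
      finally show ?thesis using q by simp
    qed
    have "C * V powr a * P ?v \<le> 1 / 2 * P ?v" using half by (intro mult_right_mono) auto
    then have Pv2: "P ?v \<le> 2 * C * V powr a * (k j powr p * V)" using Pv by (simp add: distrib_left)
    have kp: "k j powr p \<le> (2 * M) powr p" using kM[of j] k[of j] p by (intro powr_mono2) auto
    define h where "h = M * (1/2) ^ Suc j"
    have h: "0 < h" using M by (simp add: h_def)
    have hp: "h powr p = M powr p / (2 powr p * (2 powr p) ^ j)"
    proof -
      have "h powr p = M powr p * ((1/2) powr p) ^ Suc j"
        unfolding h_def powr_mult using pow_powr[of "1/2" "Suc j" p] by simp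
      also have "(1/2 :: real) powr p = 1 / 2 powr p" by (simp add: powr_divide)
      finally show ?thesis by (simp add: power_divide)
    qed
    have "P ?v / h powr p \<le> V0 * q ^ Suc j"
    proof -
      have "P ?v / h powr p \<le> 2 * C * V powr a * ((2 * M) powr p * V) / h powr p"
        using Pv2 kp V C h
        by (intro divide_right_mono order_trans[OF Pv2] mult_left_mono mult_right_mono) auto
      also have "\<dots> = 2 * C * (2 powr p * 2 powr p) * V powr a * (2 powr p) ^ j * V"
        unfolding hp using M by (simp add: powr_mult)
      also have "2 powr p * 2 powr p = (4 :: real) powr p" by (simp flip: powr_mult)
      also have "V powr a = V0 powr a * (q powr a) ^ j"
        unfolding V_def powr_mult pow_powr[OF q(1)] ..
      also have "2 * C * 4 powr p * (V0 powr a * (q powr a) ^ j) * (2 powr p) ^ j * V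
          = (2 * C * 4 powr p * V0 powr a) * (2 powr p * q powr a) ^ j * V"
        by (simp add: power_mult_distrib mult_ac)
      also have "\<dots> = V0 * q ^ Suc j" unfolding V0a qa by (simp add: V_def)
      finally show ?thesis .
    qed
    \<comment> \<open>Above the next level the truncated function \<open>?v\<close> exceeds the gap
      h between the two levels.\<close>
    moreover have "emeasure lborel {x. k (Suc j) < u x} \<le> ennreal (P ?v / h powr p)"
    proof (rule Lp_Chebyshev[OF finite_energyD(1)[OF vF] h])
      fix x assume "x \<in> {x. k (Suc j) < u x}"
      then have "k j + h < u x" using kd[of j] by (simp add: h_def)
      then show "h \<le> \<bar>?v x\<bar>" using h by (simp add: min_def)
    qed (use p in auto)
    ultimately show ?case by (meson ennreal_leI order_trans)
  qed
  have "emeasure lborel {x. 2 * M < u x} \<le> ennreal (V0 * q ^ j)" for j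
  proof -
    have "emeasure lborel {x. 2 * M < u x} \<le> emeasure lborel {x. k j < u x}"
      using kM(2)[of j] by (intro emeasure_mono) auto
    then show ?thesis using step[of j] by (rule order_trans)
  qed
  moreover have "(\<lambda>j. ennreal (V0 * q ^ j)) \<longlonglongrightarrow> ennreal (V0 * 0)"
    using q by (intro tendsto_ennrealI tendsto_mult tendsto_const LIMSEQ_power_zero) auto
  ultimately have "emeasure lborel {x. 2 * M < u x} \<le> ennreal (V0 * 0)"
    by (intro LIMSEQ_le_const[of _ "ennreal (V0 * 0)"]) auto
  then have "emeasure lborel {x. 2 * M < u x} = 0" by simp
  then have "AE x in lborel. x \<notin> {x. 2 * M < u x}"
    by (intro AE_not_in) (simp add: null_sets_def)
  then have "AE x in lborel. u x \<le> 2 * M" by eventually_elim auto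
  then show ?thesis by (rule that)
qed

lemma ex_bounded_first_eigenfunction:
  assumes "bounded_domain \<Omega>"
  shows "\<exists>u\<in>unit_sphere G N s p \<Omega>. (\<forall>x. 0 \<le> u x) \<and>
    (\<forall>v\<in>unit_sphere G N s p \<Omega>. energy G N s p u \<le> energy G N s p v) \<and>
    weak_eigensolution G N s p \<Omega> (lambda1 G N s p \<Omega>) u \<and> essentially_bounded_on \<Omega> u"
proof -
  have \<Omega>: "open \<Omega>" "\<Omega> \<noteq> {}" "bounded \<Omega>" using assms by (auto simp: bounded_domain_def)
  obtain u where u: "u \<in> X \<Omega>" "P u = 1" "E u = \<Lambda> \<Omega>" "\<And>x. 0 \<le> u x" using ex_minimizer[OF \<Omega>] by blast
  have E: "E u = \<Lambda> \<Omega> * P u" using u by simp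
  obtain M where M: "AE x in lborel. u x \<le> M"
    using minimizer_bounded[OF u(1,4) E u(2) lambda1_nonneg[OF \<Omega>(1,2)]] by blast
  have [measurable]: "u \<in> borel_measurable borel" "\<Omega> \<in> sets borel"
    using finite_energyD(4)[OF X_finite_energy[OF u(1)]] \<Omega>(1) by auto
  have "set_borel_measurable lborel \<Omega> u" unfolding set_borel_measurable_def by measurable
  moreover have "AE x in lborel. x \<in> \<Omega> \<longrightarrow> \<bar>u x\<bar> \<le> M"
    using M by eventually_elim (use u(4) in simp)
  ultimately have "essentially_bounded_on \<Omega> u" unfolding essentially_bounded_on_def by blast
  moreover have "weak_eigensolution G N s p \<Omega> (lambda1 G N s p \<Omega>) u"
    by (rule minimizer_weak_eigensolution[OF u(1) E])
  moreover have "u \<in> unit_sphere G N s p \<Omega>" using u by (simp add: unit_sphere_iff)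
  moreover have "energy G N s p u \<le> energy G N s p v" if "v \<in> unit_sphere G N s p \<Omega>" for v
    using lambda1_le[OF that] u(3) by (simp add: energy_eq)
  ultimately show ?thesis using u(4) by blast
qed

end

theorem theorem3p2:
  fixes G :: "'n::finite stratified" and N :: "real^'n \<Rightarrow> real" and s p :: real
  assumes "stratified_Lie_group G"
    and "homogeneous_quasi_norm G N"
    and "0 < s" and "s < 1" and "1 < p"
    and "real (homogeneous_dim G) > p * s"
  shows "(\<forall>\<Omega>. bounded_domain \<Omega> \<longrightarrow>
            (\<exists>\<phi>\<^sub>1\<in>unit_sphere G N s p \<Omega>.
               (\<forall>x. 0 \<le> \<phi>\<^sub>1 x) \<and>
               (\<forall>u\<in>unit_sphere G N s p \<Omega>. energy G N s p \<phi>\<^sub>1 \<le> energy G N s p u) \<and>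
               weak_eigensolution G N s p \<Omega> (lambda1 G N s p \<Omega>) \<phi>\<^sub>1 \<and>
               essentially_bounded_on \<Omega> \<phi>\<^sub>1)) \<and>
         (\<exists>C>0. \<forall>\<Omega>. bounded_domain \<Omega> \<longrightarrow>
            lambda1 G N s p \<Omega> \<ge> C * measure lborel \<Omega> powr (- (p * s / real (homogeneous_dim G))))"
proof -
  interpret fractional_energy G N s p
    by unfold_locales (use assms in auto)
  have "1 / FK * measure lborel \<Omega> powr (- (p * s / real (homogeneous_dim G))) \<le> lambda1 G N s p \<Omega>"
    if "bounded_domain \<Omega>" for \<Omega> :: "(real^'n) set"
    using that by (intro lambda1_lower_bound) (auto simp: bounded_domain_def)
  moreover have "0 < 1 / FK" using FK_pos by simp
  ultimately show ?thesis using ex_bounded_first_eigenfunction by blast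
qed

end
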